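(* Let $f:\mathcal{X}\to\mathbb{R}$ be continuously differentiable on $\mathcal{X}:=\mathbb{R}^{m_1\times n_1}\times\cdots\times\mathbb{R}^{m_J\times n_J}$ ($m_j\le n_j$), let $L_1,\dots,L_J>0$, and suppose: (a) there is a finite $f_{\mathrm{low}}$ with $f(\mathbf X)\ge f_{\mathrm{low}}$ for all $\mathbf X\in\mathcal{X}$; (b) $\alpha\in[2,\infty]$, $\beta\in[1,2]$ are a conjugate pair, and $p_j\in[2,\infty]$, $q_j\in[1,2]$ are a conjugate pair for every $j\in[J]$; (c) $\|\nabla f(\mathbf Y)-\nabla f(\mathbf X)\|_{\mathbf v,\mathbf q}\le\|\mathbf Y-\mathbf X\|_{\mathbf w,\mathbf p}$ for all $\mathbf X,\mathbf Y\in\mathcal{X}$, with the mixed norms defined in the context; (d) there are $V_j\in\mathbb{R}^{m_j\times m_j}$, $j\in[J]$, such that the stochastic gradient estimator $\mathbf G:\mathcal{X}\times\Xi\to\mathcal{X}$ satisfies, for all $\mathbf X\in\mathcal{X}$ and $j\in[J]$, $\mathbb{E}[\mathbf G(\mathbf X;\xi)]=\nabla f(\mathbf X)$ and $\mathbb{E}[([\mathbf G(\mathbf X;\xi)]_j-[\nabla f(\mathbf X)]_j)([\mathbf G(\mathbf X;\xi)]_j-[\nabla f(\mathbf X)]_j)^T]\preceq V_jV_j^T$. Let $B\ge1$ be an integer, $\Delta_f:=f(\mathbf X_0)-f_{\mathrm{low}}$, and $$\sigma_{\mathbf v,\mathbf q,B}:=\frac{1}{\sqrt B}\left\|\left(L_1^{-1/2}\|V_1\|_{S_{q_1}},\ldots,L_J^{-1/2}\|V_J\|_{S_{q_J}}\right)\right\|_\beta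 .$$ Let $K\ge1$ be any integer, and let $\{\mathbf X_k\}$ be generated by the multi-block method with regularization oracle (see context) with batch size $B$ and parameters $$\eta=\frac{\theta}{4},\qquad\theta=\min\left\{\sqrt{\frac{\Delta_f+\sigma_{\mathbf v,\mathbf q,B}^2}{\sigma_{\mathbf v,\mathbf q,B}^2K}},\,1\right\}$$ (with $\theta=1$ if $\sigma_{\mathbf v,\mathbf q,B}=0$). Then $$\frac1K\sum_{k=0}^{K-1}\mathbb{E}[\|\nabla f(\mathbf X_k)\|_{\mathbf v,\mathbf q}^2]\le67\left[\sqrt{\frac{\sigma_{\mathbf v,\mathbf q,B}^2(\Delta_f+\sigma_{\mathbf v,\mathbf q,B}^2)}{K}}+\frac{\Delta_f+\sigma_{\mathbf v,\mathbf q,B}^2}{K}\right].$$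
   Context: $[X]_j\in\mathbb{R}^{m_j\times n_j}$ is the $j$th block of $\mathbf X\in\mathcal{X}$, and $[J]=\{1,\dots,J\}$. $\|Z\|_{S_r}$ is the Schatten-$r$ norm (the $\ell_r$ norm of the singular values), $r\in[1,\infty]$. Exponents $a,b\in[1,\infty]$ are conjugate if $1/a+1/b=1$ with $1/\infty:=0$. The inner product on $\mathcal{X}$ is $\langle\mathbf X,\mathbf Y\rangle=\sum_{j=1}^J\langle[X]_j,[Y]_j\rangle$ with the trace inner product on each block. $A_1\preceq A_2$ means $A_2-A_1$ is positive semidefinite. The mixed norms are $$\|\mathbf X\|_{\mathbf w,\mathbf p}:=\big\|\big(L_j^{1/2}\|[X]_j\|_{S_{p_j}}\big)_{j=1}^J\big\|_\alpha,\qquad\|\mathbf X\|_{\mathbf v,\mathbf q}:=\big\|\big(L_j^{-1/2}\|[X]_j\|_{S_{q_j}}\big)_{j=1}^J\big\|_\beta,$$ where $\|\cdot\|_\alpha,\|\cdot\|_\beta$ are the $\ell_\alpha$, $\ell_\beta$ norms on $\mathbb{R}^J$. $\xi$ is a random element of the measurable space $\Xi$ and $\mathbf G$ is measurable. Multi-block method with regularization oracle: inputs are a (deterministic) starting point $\mathbf X_0\in\mathcal{X}$, $\theta\in(0,1]$, $\alpha\in[2,\infty]$, $\mathbf p=(p_1,\dots,p_J)\in[2,\infty]^J$, $\eta>0$, and an integer batch size $B\ge1$. For $k=0,1,2,\dots$: draw $\xi_{k,1},\dots,\xi_{k,B}$, i.i.d. copies of $\xi$ independent of all previous samples, and set $\bar{\mathbf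 G}_k=\frac1B\sum_{i=1}^B\mathbf G(\mathbf X_k;\xi_{k,i})$; set $\mathbf M_0=\bar{\mathbf G}_0$ and $\mathbf M_k=(1-\theta)\mathbf M_{k-1}+\theta\bar{\mathbf G}_k$ for $k\ge1$; let $\mathbf X_{k+1}$ be a minimizer over $\mathbf X\in\mathcal{X}$ of $\langle\mathbf M_k,\mathbf X-\mathbf X_k\rangle+\frac{1}{2\eta}\|\mathbf X-\mathbf X_k\|_{\mathbf w,\mathbf p}^2$ (when the minimizer is not unique, it is selected so that $\mathbf X_{k+1}$ is measurable with respect to $\sigma(\{\xi_{s,i}:0\le s\le k,\,1\le i\le B\})$). *)

theory Defs
  imports
    "HOL-Probability.Probability"
    "HOL-Computational_Algebra.Computational_Algebra"
    "Jordan_Normal_Form.Char_Poly"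
begin

section \<open>Norms of finite families and Schatten norms\<close>

definition ell_norm :: "ereal \<Rightarrow> real multiset \<Rightarrow> real" where
  "ell_norm r S =
     (if r = \<infinity> then Max (insert 0 (abs ` set_mset S))
      else (\<Sum>x\<in>#S. \<bar>x\<bar> powr real_of_ereal r) powr (1 / real_of_ereal r))"

text \<open>
  The square roots of the eigenvalues of \<open>A A\<^sup>T\<close>, counted with multiplicity. An
  \<open>m \<times> n\<close> matrix with \<open>m \<le> n\<close> has exactly \<open>m\<close> of them; for \<open>m > n\<close> the usual list of
  \<open>n\<close> singular values would be padded by zeros.
\<close>

definition singular_values :: "real mat \<Rightarrow> real multiset" where
  "singular_values A = image_mset sqrt (proots (char_poly (A * transpose_mat A)))"

definition schatten_norm :: "ereal \<Rightarrow> real mat \<Rightarrow> real" where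
  "schatten_norm r A = ell_norm r (singular_values A)"

definition conjugate_exponents :: "ereal \<Rightarrow> ereal \<Rightarrow> bool" where
  "conjugate_exponents a b \<longleftrightarrow> 1 \<le> a \<and> 1 \<le> b \<and> 1 / a + 1 / b = 1"


section \<open>Matrices\<close>

text \<open>Trace inner product \<open>tr (A B\<^sup>T)\<close>.\<close>

definition mat_inner :: "real mat \<Rightarrow> real mat \<Rightarrow> real" where
  "mat_inner A B = (\<Sum>i<dim_row A. (A * transpose_mat B) $$ (i, i))"

definition pos_semidef :: "nat \<Rightarrow> real mat \<Rightarrow> bool" where
  "pos_semidef d A \<longleftrightarrow> A \<in> carrier_mat d d \<and> transpose_mat A = A \<and>
     (\<forall>v\<in>carrier_vec d. 0 \<le> scalar_prod v (A *\<^sub>v v))"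

definition loewner_le :: "nat \<Rightarrow> real mat \<Rightarrow> real mat \<Rightarrow> bool" where
  "loewner_le d A1 A2 \<longleftrightarrow> A1 \<in> carrier_mat d d \<and> A2 \<in> carrier_mat d d \<and> pos_semidef d (A2 - A1)"

definition has_mat_expectation ::
    "'r measure \<Rightarrow> nat \<Rightarrow> nat \<Rightarrow> ('r \<Rightarrow> real mat) \<Rightarrow> real mat \<Rightarrow> bool" where
  "has_mat_expectation Q r c Z E \<longleftrightarrow> E \<in> carrier_mat r c \<and>
     (\<forall>i<r. \<forall>l<c. has_bochner_integral Q (\<lambda>\<omega>. Z \<omega> $$ (i, l)) (E $$ (i, l)))"


section \<open>The block matrix space\<close>

text \<open>
  The dimensions \<open>m j\<close>, \<open>n j\<close> are terms, so the product of the spaces of \<open>m j \<times> n j\<close>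
  matrices (\<open>j = 1, \<dots>, J\<close>) is represented by a Euclidean space \<open>'x\<close> together with block maps
  \<open>blk X j\<close> that identify it, as an inner product space, with this product. Differentiability,
  measurability and integration are then those of \<open>'x\<close>. The lemma below
  provides such an identification for \<open>real ^ 'e\<close>, where \<open>'e\<close> is any index type having as many
  elements as there are matrix entries.
\<close>

definition block_space ::
    "nat \<Rightarrow> (nat \<Rightarrow> nat) \<Rightarrow> (nat \<Rightarrow> nat) \<Rightarrow> ('x::euclidean_space \<Rightarrow> nat \<Rightarrow> real mat) \<Rightarrow> bool" where
  "block_space J m n blk \<longleftrightarrow>
     bij_betw (\<lambda>X. \<lambda>j\<in>{1..J}. blk X j) UNIV (\<Pi>\<^sub>E j\<in>{1..J}. carrier_mat (m j) (n j)) \<and>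
     (\<forall>X Y. \<forall>j\<in>{1..J}. blk (X + Y) j = blk X j + blk Y j) \<and>
     (\<forall>c X. \<forall>j\<in>{1..J}. blk (c *\<^sub>R X) j = c \<cdot>\<^sub>m blk X j) \<and>
     (\<forall>X Y. inner X Y = (\<Sum>j=1..J. mat_inner (blk X j) (blk Y j)))"

lemma block_space_exists:
  fixes m n :: "nat \<Rightarrow> nat"
  assumes "CARD('e::finite) = (\<Sum>j=1..J. m j * n j)"
  shows "\<exists>blk :: real ^ 'e \<Rightarrow> nat \<Rightarrow> real mat. block_space J m n blk"
proof -
  define I where "I = (SIGMA j:{1..J}. {..<m j} \<times> {..<n j})"
  have "card I = CARD('e)"
    unfolding I_def using assms by (simp add: card_cartesian_product)
  moreover have "finite I" unfolding I_def by auto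
  ultimately obtain \<phi> :: "nat \<times> nat \<times> nat \<Rightarrow> 'e" where \<phi>: "bij_betw \<phi> I UNIV"
    by (metis finite_same_card_bij finite_class.finite_UNIV)
  define blk :: "real ^ 'e \<Rightarrow> nat \<Rightarrow> real mat"
    where "blk = (\<lambda>X j. Matrix.mat (m j) (n j) (\<lambda>(i, l). vec_nth X (\<phi> (j, i, l))))"
  define \<psi> where "\<psi> = the_inv_into I \<phi>"
  have \<psi>\<phi>: "\<psi> (\<phi> t) = t" if "t \<in> I" for t
    using \<phi> that by (simp add: \<psi>_def bij_betw_def the_inv_into_f_f)
  have \<phi>\<psi>: "\<phi> (\<psi> e) = e" for e
    using \<phi> by (metis UNIV_I \<psi>_def bij_betw_def f_the_inv_into_f)
  have \<psi>I: "\<psi> e \<in> I" for e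
    using \<phi> by (metis UNIV_I \<psi>\<phi> bij_betw_def imageE)
  define emb :: "(nat \<Rightarrow> real mat) \<Rightarrow> real ^ 'e"
    where "emb = (\<lambda>F. vec_lambda (\<lambda>e. case \<psi> e of (j, i, l) \<Rightarrow> F j $$ (i, l)))"
  have bij: "bij_betw (\<lambda>X. \<lambda>j\<in>{1..J}. blk X j) UNIV (\<Pi>\<^sub>E j\<in>{1..J}. carrier_mat (m j) (n j))"
  proof (rule bij_betw_byWitness[where f' = emb])
    show "\<forall>X\<in>UNIV. emb (\<lambda>j\<in>{1..J}. blk X j) = X"
    proof
      fix X :: "real ^ 'e"
      show "emb (\<lambda>j\<in>{1..J}. blk X j) = X"
      proof (rule Finite_Cartesian_Product.vec_eq_iff[THEN iffD2], rule allI)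
        fix e
        obtain j i l where t: "\<psi> e = (j, i, l)" by (cases "\<psi> e") auto
        have "(j, i, l) \<in> I" using \<psi>I[of e] t by simp
        then show "vec_nth (emb (\<lambda>j\<in>{1..J}. blk X j)) e = vec_nth X e"
          using t \<phi>\<psi>[of e] by (simp add: emb_def blk_def I_def)
      qed
    qed
    show "\<forall>F\<in>\<Pi>\<^sub>E j\<in>{1..J}. carrier_mat (m j) (n j). (\<lambda>j\<in>{1..J}. blk (emb F) j) = F"
    proof
      fix F :: "nat \<Rightarrow> real mat"
      assume F: "F \<in> (\<Pi>\<^sub>E j\<in>{1..J}. carrier_mat (m j) (n j))"
      have "blk (emb F) j = F j" if j: "j \<in> {1..J}" for j
      proof (rule eq_matI)
        have c: "F j \<in> carrier_mat (m j) (n j)" using F j by auto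
        show "dim_row (blk (emb F) j) = dim_row (F j)" "dim_col (blk (emb F) j) = dim_col (F j)"
          using c by (auto simp: blk_def)
        fix i l assume "i < dim_row (F j)" "l < dim_col (F j)"
        then have "i < m j" "l < n j" using c by auto
        moreover have "(j, i, l) \<in> I" using calculation j by (auto simp: I_def)
        ultimately show "blk (emb F) j $$ (i, l) = F j $$ (i, l)"
          using \<psi>\<phi>[of "(j, i, l)"] by (simp add: blk_def emb_def)
      qed
      then show "(\<lambda>j\<in>{1..J}. blk (emb F) j) = F"
        using F by (intro ext) (auto simp: restrict_def PiE_def extensional_def)
    qed
    show "(\<lambda>X. \<lambda>j\<in>{1..J}. blk X j) ` UNIV \<subseteq> (\<Pi>\<^sub>E j\<in>{1..J}. carrier_mat (m j) (n j))"
      by (auto simp: blk_def)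
    show "emb ` (\<Pi>\<^sub>E j\<in>{1..J}. carrier_mat (m j) (n j)) \<subseteq> UNIV" by simp
  qed
  have inn: "inner X Y = (\<Sum>j=1..J. mat_inner (blk X j) (blk Y j))" for X Y :: "real ^ 'e"
  proof -
    have "inner X Y = (\<Sum>e\<in>UNIV. vec_nth X e * vec_nth Y e)"
      by (simp add: inner_vec_def)
    also have "\<dots> = (\<Sum>t\<in>I. vec_nth X (\<phi> t) * vec_nth Y (\<phi> t))"
      by (rule sum.reindex_bij_betw[OF \<phi>, symmetric])
    also have "\<dots> = (\<Sum>j=1..J. \<Sum>s\<in>{..<m j} \<times> {..<n j}.
                      vec_nth X (\<phi> (j, s)) * vec_nth Y (\<phi> (j, s)))"
      unfolding I_def by (subst sum.Sigma) auto
    also have "\<dots> = (\<Sum>j=1..J. \<Sum>i<m j. \<Sum>l<n j.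
                      vec_nth X (\<phi> (j, i, l)) * vec_nth Y (\<phi> (j, i, l)))"
      by (simp add: sum.cartesian_product case_prod_beta)
    also have "\<dots> = (\<Sum>j=1..J. mat_inner (blk X j) (blk Y j))"
      by (intro sum.cong refl)
        (simp add: mat_inner_def blk_def scalar_prod_def lessThan_atLeast0)
    finally show ?thesis .
  qed
  have "block_space J m n blk"
    unfolding block_space_def
  proof (intro conjI allI ballI)
    fix X Y :: "real ^ 'e" and j
    show "blk (X + Y) j = blk X j + blk Y j"
      by (rule eq_matI) (auto simp: blk_def)
  next
    fix c and X :: "real ^ 'e" and j
    show "blk (c *\<^sub>R X) j = c \<cdot>\<^sub>m blk X j"
      by (rule eq_matI) (auto simp: blk_def)
  qed (use bij inn in auto)
  then show ?thesis by blast
qed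

definition mixed_norm ::
    "nat \<Rightarrow> ('x \<Rightarrow> nat \<Rightarrow> real mat) \<Rightarrow> (nat \<Rightarrow> real) \<Rightarrow> (nat \<Rightarrow> ereal) \<Rightarrow> ereal \<Rightarrow> 'x \<Rightarrow> real" where
  "mixed_norm J blk c r s X =
     ell_norm s {# c j * schatten_norm (r j) (blk X j). j \<in># mset_set {1..J} #}"

definition wp_norm ::
    "nat \<Rightarrow> ('x \<Rightarrow> nat \<Rightarrow> real mat) \<Rightarrow> (nat \<Rightarrow> real) \<Rightarrow> (nat \<Rightarrow> ereal) \<Rightarrow> ereal \<Rightarrow> 'x \<Rightarrow> real" where
  "wp_norm J blk L p \<alpha> = mixed_norm J blk (\<lambda>j. L j powr (1 / 2)) p \<alpha>"

definition vq_norm ::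
    "nat \<Rightarrow> ('x \<Rightarrow> nat \<Rightarrow> real mat) \<Rightarrow> (nat \<Rightarrow> real) \<Rightarrow> (nat \<Rightarrow> ereal) \<Rightarrow> ereal \<Rightarrow> 'x \<Rightarrow> real" where
  "vq_norm J blk L q \<beta> = mixed_norm J blk (\<lambda>j. L j powr (- 1 / 2)) q \<beta>"


section \<open>Sampling and the multi-block method\<close>

definition iid_copies ::
    "'r measure \<Rightarrow> 's measure \<Rightarrow> ('r \<Rightarrow> 's) \<Rightarrow> 'w measure \<Rightarrow> 'i set \<Rightarrow> ('i \<Rightarrow> 'w \<Rightarrow> 's) \<Rightarrow> bool" where
  "iid_copies Q S \<xi> P I \<zeta> \<longleftrightarrow>
     prob_space.indep_vars P (\<lambda>_. S) \<zeta> I \<and>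
     (\<forall>t\<in>I. distr P S (\<zeta> t) = distr Q S \<xi>)"

definition sample_history ::
    "'w measure \<Rightarrow> 's measure \<Rightarrow> nat \<Rightarrow> (nat \<times> nat \<Rightarrow> 'w \<Rightarrow> 's) \<Rightarrow> nat \<Rightarrow> 'w measure" where
  "sample_history P S B \<zeta> k =
     sigma (space P) {\<zeta> (s, i) -` A \<inter> space P | s i A. s \<le> k \<and> i \<in> {1..B} \<and> A \<in> sets S}"

definition batch_gradient ::
    "('x::real_vector \<Rightarrow> 's \<Rightarrow> 'x) \<Rightarrow> nat \<Rightarrow> (nat \<times> nat \<Rightarrow> 'w \<Rightarrow> 's) \<Rightarrow> (nat \<Rightarrow> 'w \<Rightarrow> 'x) \<Rightarrow>
     nat \<Rightarrow> 'w \<Rightarrow> 'x" where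
  "batch_gradient G B \<zeta> X k \<omega> = (1 / real B) *\<^sub>R (\<Sum>i=1..B. G (X k \<omega>) (\<zeta> (k, i) \<omega>))"

text \<open>
  \<open>X\<close> and \<open>M\<close> are the iterate and momentum processes. The regularization oracle may return any
  minimizer, as long as the choice is adapted to the samples drawn so far; a unique minimizer
  is adapted automatically.
\<close>

definition multi_block_method ::
    "'w measure \<Rightarrow> 's measure \<Rightarrow> ('x::euclidean_space \<Rightarrow> real) \<Rightarrow> ('x \<Rightarrow> 's \<Rightarrow> 'x) \<Rightarrow>
     nat \<Rightarrow> real \<Rightarrow> real \<Rightarrow> 'x \<Rightarrow> (nat \<times> nat \<Rightarrow> 'w \<Rightarrow> 's) \<Rightarrow>
     (nat \<Rightarrow> 'w \<Rightarrow> 'x) \<Rightarrow> (nat \<Rightarrow> 'w \<Rightarrow> 'x) \<Rightarrow> bool" where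
  "multi_block_method P S nrm G B \<theta> \<eta> X0 \<zeta> X M \<longleftrightarrow>
     (\<forall>\<omega>\<in>space P. X 0 \<omega> = X0) \<and>
     (\<forall>\<omega>\<in>space P. M 0 \<omega> = batch_gradient G B \<zeta> X 0 \<omega>) \<and>
     (\<forall>k. \<forall>\<omega>\<in>space P.
        M (Suc k) \<omega> = (1 - \<theta>) *\<^sub>R M k \<omega> + \<theta> *\<^sub>R batch_gradient G B \<zeta> X (Suc k) \<omega>) \<and>
     (\<forall>k. \<forall>\<omega>\<in>space P.
        is_arg_min (\<lambda>Y. inner (M k \<omega>) (Y - X k \<omega>) + 1 / (2 * \<eta>) * (nrm (Y - X k \<omega>))\<^sup>2)
          (\<lambda>Y. Y \<in> UNIV) (X (Suc k) \<omega>)) \<and>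
     (\<forall>k. X (Suc k) \<in> borel_measurable (sample_history P S B \<zeta> k))"

end

theory Submission
  imports Defs "Jordan_Normal_Form.Spectral_Radius"
begin

text \<open>
  The norms \<open>wp_norm\<close> and \<open>vq_norm\<close> are dual to each other, so the minimizer satisfies
  \<open>\<parallel>X\<^sub>k\<^sub>+\<^sub>1 - X\<^sub>k\<parallel> = \<eta> \<parallel>M\<^sub>k\<parallel>\<^sub>*\<close> and \<open>\<langle>M\<^sub>k, X\<^sub>k\<^sub>+\<^sub>1 - X\<^sub>k\<rangle> = - \<eta> \<parallel>M\<^sub>k\<parallel>\<^sub>*\<^sup>2\<close>. Split the momentum error
  \<open>M\<^sub>k - \<nabla>f(X\<^sub>k)\<close> into a drift \<open>A\<^sub>k\<close> with \<open>A\<^sub>k\<^sub>+\<^sub>1 = (1 - \<theta>) (A\<^sub>k + \<nabla>f(X\<^sub>k) - \<nabla>f(X\<^sub>k\<^sub>+\<^sub>1))\<close> and an average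
  \<open>S\<^sub>k\<close> of the sampling noise. The drift is controlled by the step lengths, hence by the momenta, and
  the descent inequality gives a bound that holds on every path:
  \<open>\<Sum> \<parallel>\<nabla>f(X\<^sub>k)\<parallel>\<^sub>*\<^sup>2 \<le> 34 \<Delta> / \<theta> + 23/2 \<Sum> \<parallel>S\<^sub>k\<parallel>\<^sub>*\<^sup>2\<close>.

  The dual norm is not Euclidean, but its exponents are at most 2. Therefore it is dominated by the
  mixed norm of the row norms of \<open>W\<^sub>j\<^sup>T [S\<^sub>k]\<^sub>j\<close>, where \<open>W\<^sub>j\<close> diagonalizes \<open>V\<^sub>j V\<^sub>j\<^sup>T\<close>. The square of each row
  norm is a quadratic form in \<open>S\<^sub>k\<close>, so that its second moment follows from the orthogonality of the
  noise of different samples, and by Jensen's inequality a mixed norm with exponents at most 2 turns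
  bounds on the second moments of the entries into a bound on the second moment of the norm.
\<close>

section \<open>Diagonalization of symmetric matrices\<close>

text \<open>For a norm that comes from an inner product, the second moments of uncorrelated terms
  add up. \<open>vq_norm\<close> has no such rule, and comparison with the Frobenius norm would
  bring the dimensions into the bound. The passage to row norms avoids this loss because
  \<open>W j\<close> is deterministic and depends on \<open>V j\<close> alone: in its basis the row
  norms of \<open>V j\<close> are exactly its singular values, so the constant in the noise bound is
  \<sigma> itself.

  The path bound comes before any expectation. Hence nothing need be known about moments of the
  momenta, of the steps or of \<open>f\<close> at the iterates; the gradients inherit integrability
  from the noise.

  Conditional expectations are replaced by Fubini's theorem: a sample is independent of the
  sigma-algebra of all the other samples, which already determines the iterate at which this sample
  is used.

  The constants combine to 34 and 23/2, whose sum is below 67, so the stated factor leaves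
  slack.\<close>

definition orthogonal_mat_dim :: "nat \<Rightarrow> real mat \<Rightarrow> bool" where
  "orthogonal_mat_dim n U \<longleftrightarrow>
     U \<in> carrier_mat n n \<and> transpose_mat U * U = 1\<^sub>m n \<and> U * transpose_mat U = 1\<^sub>m n"

lemma orthogonal_mat_dimD:
  assumes "orthogonal_mat_dim n U"
  shows "U \<in> carrier_mat n n" "transpose_mat U \<in> carrier_mat n n"
    "transpose_mat U * U = 1\<^sub>m n" "U * transpose_mat U = 1\<^sub>m n"
  using assms by (auto simp: orthogonal_mat_dim_def)

lemma orthogonal_mat_dim_transpose:
  "orthogonal_mat_dim n U \<Longrightarrow> orthogonal_mat_dim n (transpose_mat U)"
  by (auto simp: orthogonal_mat_dim_def)

lemma orthogonal_mat_dim_mult: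
  assumes "orthogonal_mat_dim n U" "orthogonal_mat_dim n W"
  shows "orthogonal_mat_dim n (U * W)"
proof -
  note U = orthogonal_mat_dimD[OF assms(1)] and W = orthogonal_mat_dimD[OF assms(2)]
  have t: "transpose_mat (U * W) = transpose_mat W * transpose_mat U"
    using U(1) W(1) by (rule transpose_mult)
  have "transpose_mat U * (U * W) = W" "W * (transpose_mat W * transpose_mat U) = transpose_mat U"
    using U W by (simp_all add: assoc_mult_mat[of _ n n _ n _ n, symmetric] del: assoc_mult_mat)
  then show ?thesis using U W
    by (simp add: orthogonal_mat_dim_def t assoc_mult_mat[of _ n n _ n _ n] del: assoc_mult_mat)
qed

text \<open>Over the complex numbers an eigenvector \<open>z\<close> exists; the Hermitian form
  \<open>q\<close> of a real symmetric matrix is real, which makes the eigenvalue real. The real and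
  imaginary parts of \<open>z\<close> then satisfy the same linear system separately, and one of
  them does not vanish.\<close>

lemma symmetric_unit_eigenvector:
  fixes A :: "real mat"
  assumes A: "A \<in> carrier_mat n n" and sym: "transpose_mat A = A" and n: "n > 0"
  obtains v e where "v \<in> carrier_vec n" "(\<Sum>i<n. (vec_index v i)\<^sup>2) = 1"
    "\<And>i. i < n \<Longrightarrow> (\<Sum>j<n. A $$ (i, j) * vec_index v j) = e * vec_index v i"
proof -
  let ?C = "map_mat complex_of_real A"
  have C: "?C \<in> carrier_mat n n" using A by simp
  from spectrum_non_empty[OF C n] obtain k where "eigenvalue ?C k"
    by (auto simp: spectrum_def)
  then obtain z where z: "z \<in> carrier_vec n" "z \<noteq> 0\<^sub>v n" "?C *\<^sub>v z = k \<cdot>\<^sub>v z"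
    using A by (auto simp: eigenvalue_def eigenvector_def)
  have ev: "(\<Sum>j<n. complex_of_real (A $$ (i, j)) * vec_index z j) = k * vec_index z i" if i: "i < n" for i
  proof -
    have "vec_index (?C *\<^sub>v z) i = vec_index (k \<cdot>\<^sub>v z) i" using z(3) by simp
    then show ?thesis using i A z(1) by (simp add: scalar_prod_def lessThan_atLeast0)
  qed
  have Asym: "A $$ (i, j) = A $$ (j, i)" if "i < n" "j < n" for i j
    using arg_cong[OF sym, of "\<lambda>M. M $$ (i, j)"] that A by auto
  define q where "q = (\<Sum>i<n. cnj (vec_index z i) * (\<Sum>j<n. complex_of_real (A $$ (i, j)) * vec_index z j))"
  define N where "N = (\<Sum>i<n. (cmod (vec_index z i))\<^sup>2)"
  have qk: "q = k * complex_of_real N"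
    unfolding q_def N_def
    unfolding of_real_sum sum_distrib_left
    by (intro sum.cong refl, subst sum_distrib_left[symmetric], subst ev) (simp_all add: complex_norm_square[symmetric] mult_ac)
  have "cnj q = (\<Sum>i<n. \<Sum>j<n. vec_index z i * complex_of_real (A $$ (i, j)) * cnj (vec_index z j))"
    unfolding q_def by (simp add: sum_distrib_left mult_ac)
  also have "\<dots> = (\<Sum>j<n. \<Sum>i<n. vec_index z i * complex_of_real (A $$ (i, j)) * cnj (vec_index z j))"
    by (rule sum.swap)
  also have "\<dots> = q"
    unfolding q_def by (auto simp: sum_distrib_left mult_ac Asym intro!: sum.cong)
  finally have qr: "cnj q = q" .
  obtain i0 where i0: "i0 < n" "vec_index z i0 \<noteq> 0"
    using z(1,2) by (metis eq_vecI carrier_vecD index_zero_vec)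
  have Npos: "N > 0"
    unfolding N_def using i0 by (intro sum_pos2[of _ i0]) auto
  have "cnj k = k"
    using qr Npos unfolding qk by simp
  then have kr: "k = complex_of_real (Re k)"
    by (metis Reals_cnj_iff complex_is_Real_iff complex_eq_iff Im_complex_of_real Re_complex_of_real)
  have re: "(\<Sum>j<n. A $$ (i, j) * Re (vec_index z j)) = Re k * Re (vec_index z i)"
    and im: "(\<Sum>j<n. A $$ (i, j) * Im (vec_index z j)) = Re k * Im (vec_index z i)" if i: "i < n" for i
  proof -
    have e: "(\<Sum>j<n. complex_of_real (A $$ (i, j)) * vec_index z j) = complex_of_real (Re k) * vec_index z i"
      using ev[OF i] kr by metis
    show "(\<Sum>j<n. A $$ (i, j) * Re (vec_index z j)) = Re k * Re (vec_index z i)"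
      using arg_cong[OF e, of Re] by simp
    show "(\<Sum>j<n. A $$ (i, j) * Im (vec_index z j)) = Re k * Im (vec_index z i)"
      using arg_cong[OF e, of Im] by simp
  qed
  have "\<exists>x :: nat \<Rightarrow> real. (\<exists>i<n. x i \<noteq> 0) \<and> (\<forall>i<n. (\<Sum>j<n. A $$ (i, j) * x j) = Re k * x i)"
  proof (cases "Re (vec_index z i0) = 0")
    case True
    then have "Im (vec_index z i0) \<noteq> 0" using i0 complex_eq_iff by auto
    then show ?thesis using im i0 by (intro exI[of _ "\<lambda>j. Im (vec_index z j)"]) auto
  next
    case False
    then show ?thesis using re i0 by (intro exI[of _ "\<lambda>j. Re (vec_index z j)"]) auto
  qed
  then obtain x :: "nat \<Rightarrow> real" and i1 where x: "i1 < n" "x i1 \<noteq> 0"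
    "\<And>i. i < n \<Longrightarrow> (\<Sum>j<n. A $$ (i, j) * x j) = Re k * x i" by blast
  define c where "c = sqrt (\<Sum>i<n. (x i)\<^sup>2)"
  have "(\<Sum>i<n. (x i)\<^sup>2) > 0" using x by (intro sum_pos2[of _ i1]) auto
  then have c: "c\<^sup>2 = (\<Sum>i<n. (x i)\<^sup>2)" "c \<noteq> 0" by (auto simp: c_def)
  show ?thesis
  proof (rule that[of "Matrix.vec n (\<lambda>i. x i / c)" "Re k"])
    show "(\<Sum>i<n. (vec_index (Matrix.vec n (\<lambda>i. x i / c)) i)\<^sup>2) = 1"
      using c by (simp add: power_divide sum_divide_distrib[symmetric] flip: c(1))
    show "(\<Sum>j<n. A $$ (i, j) * vec_index (Matrix.vec n (\<lambda>i. x i / c)) j) = Re k * vec_index (Matrix.vec n (\<lambda>i. x i / c)) i"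
      if "i < n" for i
      using x(3)[OF that] that by (simp add: sum_divide_distrib[symmetric])
  qed simp
qed

text \<open>\<open>Q\<close> is the reflection \<open>I - c w w^T\<close> with
  \<open>w = e_0 - v\<close> and \<open>c = 2 / |w|^2\<close>, which exchanges the first basis
  vector \<open>e_0\<close> with \<open>v\<close>. If \<open>v = e_0\<close>, then
  \<open>c = 2 / 0 = 0\<close> and \<open>Q\<close> is the identity.\<close>

lemma householder:
  fixes v :: "real vec"
  assumes v: "v \<in> carrier_vec n" "(\<Sum>i<n. (vec_index v i)\<^sup>2) = 1" and n: "n > 0"
  obtains Q where "orthogonal_mat_dim n Q" "transpose_mat Q = Q" "\<And>i. i < n \<Longrightarrow> Q $$ (i, 0) = vec_index v i"
proof -
  define w where "w = (\<lambda>i. (if i = 0 then 1 else 0) - vec_index v i)"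
  define s where "s = (\<Sum>i<n. (w i)\<^sup>2)"
  define c where "c = 2 / s"
  define Q where "Q = Matrix.mat n n (\<lambda>(i, j). (if i = j then 1 else 0) - c * w i * w j)"
  \<comment> \<open>\<open>|e_0 - v|^2 = 2 - 2 v_0\<close> because \<open>v\<close> has length 1; if
    \<open>s\<close> is nonzero, this yields \<open>c * w 0 = 1\<close>.\<close>
  have s2: "s = 2 * w 0"
  proof -
    have "s = (\<Sum>i<n. (if i = 0 then 1 - 2 * vec_index v i else 0) + (vec_index v i)\<^sup>2)"
      unfolding s_def w_def by (intro sum.cong) (auto simp: power2_eq_square algebra_simps)
    then show ?thesis using v n by (simp add: sum.distrib w_def)
  qed
  have cs: "c * c * s = 2 * c" by (simp add: c_def)
  have "(Q * Q) $$ (i, j) = 1\<^sub>m n $$ (i, j)" if ij: "i < n" "j < n" for i j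
  proof -
    have "(Q * Q) $$ (i, j) = (\<Sum>l<n. ((if i = l then 1 else 0) - c * w i * w l) *
        ((if l = j then 1 else 0) - c * w l * w j))"
      using ij by (simp add: Q_def scalar_prod_def lessThan_atLeast0)
    also have "\<dots> = (\<Sum>l<n. (if l = i then (if i = j then 1 else 0) - c * w i * w j else 0)
        - (if l = j then c * w i * w j else 0) + c * c * w i * w j * (w l)\<^sup>2)"
      by (intro sum.cong) (auto simp: algebra_simps power2_eq_square)
    also have "\<dots> = (if i = j then 1 else 0) - 2 * c * w i * w j + c * c * w i * w j * s"
      using ij by (simp add: sum.distrib sum_subtractf sum_distrib_left[symmetric] s_def[symmetric])
    also have "\<dots> = (if i = j then 1 else 0)"
    proof -
      have "c * c * w i * w j * s = (c * c * s) * (w i * w j)" by simp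
      then show ?thesis unfolding cs by simp
    qed
    finally show ?thesis using ij by simp
  qed
  then have QQ: "Q * Q = 1\<^sub>m n" by (intro eq_matI) (auto simp: Q_def)
  have Qt: "transpose_mat Q = Q" by (rule eq_matI) (auto simp: Q_def)
  have "Q $$ (i, 0) = vec_index v i" if i: "i < n" for i
  proof (cases "s = 0")
    case True
    then have "w i = 0" "c = 0" using i by (auto simp: s_def sum_nonneg_eq_0_iff c_def)
    then show ?thesis using i n by (simp add: Q_def w_def)
  next
    case False
    then have "c * w 0 = 1" by (simp add: c_def s2)
    then have "c * w i * w 0 = w i" by (metis mult.assoc mult.commute mult.right_neutral)
    moreover have "Q $$ (i, 0) = (if i = 0 then 1 else 0) - c * w i * w 0"
      using i n by (simp add: Q_def)
    ultimately have "Q $$ (i, 0) = (if i = 0 then 1 else 0) - w i" by simp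
    then show ?thesis by (simp add: w_def)
  qed
  then show ?thesis
    using that[of Q] QQ Qt by (auto simp: orthogonal_mat_dim_def Q_def)
qed

text \<open>Deflation: conjugation by a reflection whose first column is a unit eigenvector turns
  the first column of the matrix into a multiple of the first basis vector, and symmetry does the
  same to the first row. What remains is a symmetric block of size \<open>n\<close>.\<close>

lemma symmetric_diagonalization:
  fixes A :: "real mat"
  assumes "A \<in> carrier_mat n n" "transpose_mat A = A"
  shows "\<exists>U d. orthogonal_mat_dim n U \<and> transpose_mat U * A * U = mat_diag n d"
  using assms
proof (induction n arbitrary: A)
  case 0
  then show ?case
    by (intro exI[of _ "1\<^sub>m 0"] exI[of _ "\<lambda>_. 0"]) (auto simp: orthogonal_mat_dim_def mat_diag_def)
next
  case (Suc n)
  note A = Suc.prems(1) and sym = Suc.prems(2)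
  obtain v e where v: "v \<in> carrier_vec (Suc n)" "(\<Sum>i<Suc n. (vec_index v i)\<^sup>2) = 1"
    "\<And>i. i < Suc n \<Longrightarrow> (\<Sum>j<Suc n. A $$ (i, j) * vec_index v j) = e * vec_index v i"
    using symmetric_unit_eigenvector[OF A sym] by blast
  obtain Q where Q: "orthogonal_mat_dim (Suc n) Q" "transpose_mat Q = Q"
    "\<And>i. i < Suc n \<Longrightarrow> Q $$ (i, 0) = vec_index v i"
    using householder[OF v(1,2)] by blast
  note Qc = orthogonal_mat_dimD[OF Q(1)]
  have QQ: "Q * Q = 1\<^sub>m (Suc n)" using Qc(3) Q(2) by simp
  define B where "B = Q * (A * Q)"
  have Bc: "B \<in> carrier_mat (Suc n) (Suc n)" using Qc A by (simp add: B_def)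
  have Bt: "transpose_mat B = B"
    unfolding B_def using Qc(1) A Q(2) sym
    by (simp add: transpose_mult[of _ "Suc n" "Suc n" _ "Suc n"])
  have AQ0: "(A * Q) $$ (i, 0) = e * vec_index v i" if "i < Suc n" for i
    using that v(3)[OF that] A Qc(1) Q(3) by (simp add: scalar_prod_def lessThan_atLeast0)
  have B0: "B $$ (i, 0) = (if i = 0 then e else 0)" if i: "i < Suc n" for i
  proof -
    have "B $$ (i, 0) = (\<Sum>l<Suc n. Q $$ (i, l) * (A * Q) $$ (l, 0))"
      unfolding B_def using i A Qc(1) by (simp add: scalar_prod_def lessThan_atLeast0 del: sum.lessThan_Suc index_mult_mat(1))
         (auto simp: scalar_prod_def lessThan_atLeast0 intro!: sum.cong)
    also have "\<dots> = e * (\<Sum>l<Suc n. Q $$ (i, l) * Q $$ (l, 0))"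
      unfolding sum_distrib_left by (intro sum.cong) (auto simp: AQ0 Q(3) simp del: index_mult_mat)
    also have "(\<Sum>l<Suc n. Q $$ (i, l) * Q $$ (l, 0)) = (Q * Q) $$ (i, 0)"
      using i Qc(1) by (simp add: scalar_prod_def lessThan_atLeast0)
    finally show ?thesis using i by (simp add: QQ)
  qed
  have B0': "B $$ (0, i) = (if i = 0 then e else 0)" if i: "i < Suc n" for i
    using B0[OF i] arg_cong[OF Bt, of "\<lambda>M. M $$ (i, 0)"] i Bc by simp
  define A' where "A' = Matrix.mat n n (\<lambda>(i, j). B $$ (Suc i, Suc j))"
  have A'c: "A' \<in> carrier_mat n n" by (simp add: A'_def)
  have A't: "transpose_mat A' = A'"
  proof (rule eq_matI)
    fix i j assume "i < dim_row A'" "j < dim_col A'"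
    then show "transpose_mat A' $$ (i, j) = A' $$ (i, j)"
      using arg_cong[OF Bt, of "\<lambda>M. M $$ (Suc i, Suc j)"] Bc by (simp add: A'_def)
  qed (auto simp: A'_def)
  have Bblock: "B = four_block_mat (mat_diag 1 (\<lambda>_. e)) (0\<^sub>m 1 n) (0\<^sub>m n 1) A'"
    using Bc B0 B0' by (intro eq_matI) (auto simp: A'_def mat_diag_def)
  obtain U d where U: "orthogonal_mat_dim n U" "transpose_mat U * A' * U = mat_diag n d"
    using Suc.IH[OF A'c A't] by blast
  note Uc = orthogonal_mat_dimD[OF U(1)]
  define F where "F = four_block_mat (1\<^sub>m 1) (0\<^sub>m 1 n) (0\<^sub>m n 1) U"
  have Fc: "F \<in> carrier_mat (Suc n) (Suc n)"
    unfolding F_def using four_block_carrier_mat[of "1\<^sub>m 1" 1 1 U n n] Uc by auto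
  have Ft: "transpose_mat F = four_block_mat (1\<^sub>m 1) (0\<^sub>m 1 n) (0\<^sub>m n 1) (transpose_mat U)"
    unfolding F_def using Uc by (subst transpose_four_block_mat[of _ 1 1 _ n _ n]) auto
  have one: "four_block_mat (1\<^sub>m 1) (0\<^sub>m 1 n) (0\<^sub>m n 1) (1\<^sub>m n) = (1\<^sub>m (Suc n) :: real mat)"
    by (rule eq_matI) auto
  have FF: "transpose_mat F * F = 1\<^sub>m (Suc n)" "F * transpose_mat F = 1\<^sub>m (Suc n)"
    unfolding Ft unfolding F_def using Uc
    by (auto simp: mult_four_block_mat[of _ 1 1 _ n _ n _ _ 1 _ n] one)
  have Fo: "orthogonal_mat_dim (Suc n) F"
    using Fc FF by (simp add: orthogonal_mat_dim_def)
  have "transpose_mat F * B * F = four_block_mat (mat_diag 1 (\<lambda>_. e)) (0\<^sub>m 1 n) (0\<^sub>m n 1) (transpose_mat U * A' * U)"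
    unfolding Ft unfolding F_def Bblock using Uc A'c
    by (simp add: mult_four_block_mat[of _ 1 1 _ n _ n _ _ 1 _ n] mat_diag_def)
  also have "\<dots> = mat_diag (Suc n) (\<lambda>i. case i of 0 \<Rightarrow> e | Suc i \<Rightarrow> d i)"
    unfolding U(2) by (rule eq_matI) (auto simp: mat_diag_def split: nat.splits)
  finally have FBF: "transpose_mat F * B * F = mat_diag (Suc n) (\<lambda>i. case i of 0 \<Rightarrow> e | Suc i \<Rightarrow> d i)" .
  have Ftc: "transpose_mat F \<in> carrier_mat (Suc n) (Suc n)" using Fc by simp
  have "transpose_mat (Q * F) * A * (Q * F) = transpose_mat F * B * F"
    using Qc(1) Fc Ftc A Q(2)
    by (simp add: transpose_mult[of _ "Suc n" "Suc n" _ "Suc n"] B_def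
        assoc_mult_mat[of _ "Suc n" "Suc n" _ "Suc n" _ "Suc n"] del: assoc_mult_mat)
  then show ?case
    using FBF orthogonal_mat_dim_mult[OF Q(1) Fo]
    by (intro exI[of _ "Q * F"] exI[of _ "\<lambda>i. case i of 0 \<Rightarrow> e | Suc i \<Rightarrow> d i"] conjI) simp_all
qed

section \<open>Norms of finite families\<close>

lemma powr_convex_nonneg:
  assumes "1 \<le> r"
  shows "convex_on {0..} (\<lambda>x::real. x powr r)"
proof (rule convex_onI)
  fix t x y :: real
  assume t: "0 < t" "t < 1" and xy: "x \<in> {0..}" "y \<in> {0..}"
  have small: "c powr r \<le> c" if "0 < c" "c < 1" for c :: real
    using powr_mono'[of 1 r c] that assms by simp
  show "((1 - t) *\<^sub>R x + t *\<^sub>R y) powr r \<le> (1 - t) * x powr r + t * y powr r"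
  \<comment> \<open>On the open half line this is \<open>powr_convex\<close>. If one point is 0, its
    power is 0 and the claim reduces to \<open>c powr r \<le> c\<close> for a weight
    \<open>c\<close> below 1.\<close>
  proof (cases "x = 0 \<or> y = 0")
    case True
    then show ?thesis
      using small[of t] small[of "1 - t"] t xy
      by (auto simp: powr_mult intro!: mult_right_mono)
  next
    case False
    then have "x \<in> {0<..}" "y \<in> {0<..}" using xy by auto
    then show ?thesis using convex_onD[OF powr_convex[OF assms], of t x y] t by simp
  qed
qed (rule convex_real_interval)

lemma powr_sum_le_sum_powr:
  fixes a y :: "'i \<Rightarrow> real"
  assumes "finite I" "\<And>i. i \<in> I \<Longrightarrow> 0 \<le> a i" "(\<Sum>i\<in>I. a i) = 1" "\<And>i. i \<in> I \<Longrightarrow> 0 \<le> y i" "1 \<le> r"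
  shows "(\<Sum>i\<in>I. a i * y i) powr r \<le> (\<Sum>i\<in>I. a i * y i powr r)"
proof -
  have "I \<noteq> {}" using assms(3) by auto
  then show ?thesis
    using convex_on_sum[OF assms(1) _ powr_convex_nonneg[OF assms(5)] assms(3,2), of y] assms(4) by simp
qed

text \<open>The concave case is the convex one for the exponent \<open>1 / r\<close>, applied to the
  numbers \<open>y i powr r\<close>.\<close>

lemma sum_powr_le_powr_sum:
  fixes a y :: "'i \<Rightarrow> real"
  assumes "finite I" "\<And>i. i \<in> I \<Longrightarrow> 0 \<le> a i" "(\<Sum>i\<in>I. a i) = 1" "\<And>i. i \<in> I \<Longrightarrow> 0 \<le> y i"
    and r: "0 < r" "r \<le> 1"
  shows "(\<Sum>i\<in>I. a i * y i powr r) \<le> (\<Sum>i\<in>I. a i * y i) powr r"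
proof -
  let ?S = "\<Sum>i\<in>I. a i * y i powr r"
  have S: "0 \<le> ?S" using assms by (intro sum_nonneg) auto
  have "?S powr (1 / r) \<le> (\<Sum>i\<in>I. a i * (y i powr r) powr (1 / r))"
    using assms by (intro powr_sum_le_sum_powr) auto
  also have "\<dots> = (\<Sum>i\<in>I. a i * y i)"
    using assms by (intro sum.cong) (auto simp: powr_powr)
  finally have "(?S powr (1 / r)) powr r \<le> (\<Sum>i\<in>I. a i * y i) powr r"
    using r by (intro powr_mono2) auto
  then show ?thesis using r S by (simp add: powr_powr)
qed

lemma ell_norm_finite_exponent:
  assumes "r \<noteq> \<infinity>"
  shows "ell_norm r {# g i. i \<in># mset_set I #} =
    (\<Sum>i\<in>I. \<bar>g i\<bar> powr real_of_ereal r) powr (1 / real_of_ereal r)"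
  using assms by (simp add: ell_norm_def sum_unfold_sum_mset multiset.map_comp comp_def)

lemma ell_norm_infinity:
  "finite I \<Longrightarrow> ell_norm \<infinity> {# g i. i \<in># mset_set I #} = Max (insert 0 ((\<lambda>i. \<bar>g i\<bar>) ` I))"
  by (simp add: ell_norm_def image_image)

lemma ell_norm_infinity_le_iff:
  "finite I \<Longrightarrow> ell_norm \<infinity> {# g i. i \<in># mset_set I #} \<le> c \<longleftrightarrow> 0 \<le> c \<and> (\<forall>i\<in>I. \<bar>g i\<bar> \<le> c)"
  by (simp add: ell_norm_infinity)

lemma abs_le_ell_norm_infinity:
  "finite I \<Longrightarrow> i \<in> I \<Longrightarrow> \<bar>g i\<bar> \<le> ell_norm \<infinity> {# g i. i \<in># mset_set I #}"
  by (simp add: ell_norm_infinity)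

lemma ell_norm_nonneg: "0 \<le> ell_norm r S"
  by (simp add: ell_norm_def)

lemma ell_norm_cong:
  "(\<And>i. i \<in> I \<Longrightarrow> g i = h i) \<Longrightarrow> ell_norm r {# g i. i \<in># mset_set I #} = ell_norm r {# h i. i \<in># mset_set I #}"
  by (cases "finite I") (auto intro!: arg_cong[of _ _ "ell_norm r"] image_mset_cong)

lemma ell_norm_powr:
  assumes "0 < x"
  shows "ell_norm (ereal x) {# g i. i \<in># mset_set I #} powr x = (\<Sum>i\<in>I. \<bar>g i\<bar> powr x)"
proof -
  have "0 \<le> (\<Sum>i\<in>I. \<bar>g i\<bar> powr x)" by (intro sum_nonneg) simp
  then show ?thesis using assms by (simp add: ell_norm_finite_exponent powr_powr)
qed

lemma ell_norm_eq_0_iff: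
  assumes "finite I" "0 < x"
  shows "ell_norm (ereal x) {# g i. i \<in># mset_set I #} = 0 \<longleftrightarrow> (\<forall>i\<in>I. g i = 0)"
  using assms by (auto simp: ell_norm_finite_exponent sum_nonneg_eq_0_iff)

lemma ell_norm_mono:
  assumes "finite I" "1 \<le> r" "\<And>i. i \<in> I \<Longrightarrow> \<bar>g i\<bar> \<le> \<bar>h i\<bar>"
  shows "ell_norm r {# g i. i \<in># mset_set I #} \<le> ell_norm r {# h i. i \<in># mset_set I #}"
proof (cases r)
  case (real x)
  then show ?thesis using assms
    by (auto simp: ell_norm_finite_exponent intro!: powr_mono2 sum_mono sum_nonneg)
next
  case PInf
  then show ?thesis
    using assms by (auto simp: ell_norm_infinity_le_iff ell_norm_nonneg intro: order_trans abs_le_ell_norm_infinity)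
qed (use assms in auto)

lemma ell_norm_scale:
  assumes "finite I" "1 \<le> r"
  shows "ell_norm r {# c * g i. i \<in># mset_set I #} = \<bar>c\<bar> * ell_norm r {# g i. i \<in># mset_set I #}"
proof (cases r)
  case (real x)
  have "0 \<le> (\<Sum>i\<in>I. \<bar>g i\<bar> powr x)" by (intro sum_nonneg) simp
  then show ?thesis using assms real
    by (simp add: ell_norm_finite_exponent abs_mult powr_mult sum_distrib_left[symmetric] powr_powr)
next
  case PInf
  let ?n = "\<lambda>g. ell_norm \<infinity> {# g i. i \<in># mset_set I #}"
  have le: "?n (\<lambda>i. c * g i) \<le> \<bar>c\<bar> * ?n g" for c :: real and g
    using assms by (auto simp: ell_norm_infinity_le_iff ell_norm_nonneg abs_mult abs_le_ell_norm_infinity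
        intro!: mult_left_mono)
  have "\<bar>c\<bar> * ?n g \<le> ?n (\<lambda>i. c * g i)"
  proof (cases "c = 0")
    case False
    then have "?n g \<le> \<bar>1 / c\<bar> * ?n (\<lambda>i. c * g i)" using le[of "1 / c" "\<lambda>i. c * g i"] by simp
    then show ?thesis using False by (simp add: field_simps)
  qed (simp add: ell_norm_nonneg)
  then show ?thesis using le[of c g] PInf by simp
qed (use assms in auto)

section \<open>Conjugate exponents and Hoelder duality\<close>

lemma conjugate_exponents_cases:
  assumes "conjugate_exponents a b" "2 \<le> a" "b \<le> 2"
  obtains "a = \<infinity>" "b = 1"
  | x y where "a = ereal x" "b = ereal y" "2 \<le> x" "1 < y" "y \<le> 2" "1 / x + 1 / y = 1"
proof (cases a)
  case PInf
  then obtain y where y: "b = ereal y" using assms by (cases b) (auto simp: conjugate_exponents_def)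
  then have "1 / y = 1" using assms PInf
    by (auto simp: conjugate_exponents_def one_ereal_def divide_ereal_def split: if_splits)
  then show ?thesis using that(1) PInf y by (simp add: one_ereal_def)
next
  case (real x)
  obtain y where y: "b = ereal y" using assms by (cases b) (auto simp: conjugate_exponents_def)
  have x: "2 \<le> x" and y2: "y \<le> 2" and y1: "1 \<le> y" using assms real y by (auto simp: conjugate_exponents_def)
  then have e: "1 / x + 1 / y = 1"
    using assms real y by (auto simp: conjugate_exponents_def one_ereal_def)
  \<comment> \<open>For finite \<open>x\<close> the sum \<open>1 / x + 1\<close> would exceed 1, so
    the only degenerate pair is \<open>(\<infinity>, 1)\<close>.\<close>
  have "y \<noteq> 1" using e x by auto
  then show ?thesis using that(2)[OF real y x] y1 y2 e by simp
qed (use assms in auto)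

lemma ell_norm_Holder:
  assumes conj: "conjugate_exponents a b" "2 \<le> a" "b \<le> 2" and I: "finite I"
  shows "(\<Sum>i\<in>I. \<bar>g i * h i\<bar>) \<le>
    ell_norm b {# g i. i \<in># mset_set I #} * ell_norm a {# h i. i \<in># mset_set I #}"
  using conj
proof (cases rule: conjugate_exponents_cases)
  case 1
  have "(\<Sum>i\<in>I. \<bar>g i * h i\<bar>) \<le> (\<Sum>i\<in>I. \<bar>g i\<bar> * ell_norm \<infinity> {# h i. i \<in># mset_set I #})"
    using I by (intro sum_mono) (auto simp: abs_mult abs_le_ell_norm_infinity intro!: mult_left_mono)
  then show ?thesis using 1
    by (simp add: ell_norm_finite_exponent sum_distrib_right sum_nonneg)
next
  case (2 x y)
  define A where "A = ell_norm a {# h i. i \<in># mset_set I #}"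
  define C where "C = ell_norm b {# g i. i \<in># mset_set I #}"
  show ?thesis
  proof (cases "A = 0 \<or> C = 0")
    case True
    then have "g i * h i = 0" if "i \<in> I" for i
      using that I 2 ell_norm_eq_0_iff[of I x h] ell_norm_eq_0_iff[of I y g] by (auto simp: A_def C_def)
    then have "(\<Sum>i\<in>I. \<bar>g i * h i\<bar>) = 0" by (intro sum.neutral) simp
    then show ?thesis by (simp add: ell_norm_nonneg)
  next
    case False
    then have pos: "A > 0" "C > 0" using ell_norm_nonneg unfolding A_def C_def by (metis less_eq_real_def)+
    have sA: "(\<Sum>i\<in>I. \<bar>h i\<bar> powr x) = A powr x" and sC: "(\<Sum>i\<in>I. \<bar>g i\<bar> powr y) = C powr y"
      using ell_norm_powr[of x h I] ell_norm_powr[of y g I] 2 by (simp_all add: A_def C_def)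
    have "(\<Sum>i\<in>I. (\<bar>h i\<bar> / A) * (\<bar>g i\<bar> / C)) \<le> (\<Sum>i\<in>I. (\<bar>h i\<bar> / A) powr x / x + (\<bar>g i\<bar> / C) powr y / y)"
      using 2 pos by (intro sum_mono Youngs_inequality) auto
    also have "\<dots> = (\<Sum>i\<in>I. \<bar>h i\<bar> powr x) / A powr x / x + (\<Sum>i\<in>I. \<bar>g i\<bar> powr y) / C powr y / y"
      using pos by (simp add: sum.distrib powr_divide sum_divide_distrib)
    also have "\<dots> = 1" using pos 2 by (simp add: sA sC)
    finally have "(\<Sum>i\<in>I. \<bar>g i * h i\<bar>) / (C * A) \<le> 1"
      by (simp add: sum_divide_distrib abs_mult mult.commute)
    then show ?thesis using pos by (simp add: A_def C_def)
  qed
qed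

text \<open>\<open>g\<close> is the equality case of Hoelder's inequality. That it vanishes where
  \<open>h\<close> does is recorded because the matrix version divides by the row norms that
  \<open>h\<close> stands for.\<close>

lemma ell_norm_dual_attained:
  assumes conj: "conjugate_exponents a b" "2 \<le> a" "b \<le> 2" and I: "finite I"
    and h: "\<And>i. i \<in> I \<Longrightarrow> 0 \<le> h i"
  obtains g where "\<And>i. i \<in> I \<Longrightarrow> 0 \<le> g i" "\<And>i. i \<in> I \<Longrightarrow> h i = 0 \<Longrightarrow> g i = 0"
    "(\<Sum>i\<in>I. g i * h i) = ell_norm b {# h i. i \<in># mset_set I #}"
    "ell_norm a {# g i. i \<in># mset_set I #} \<le> 1"
proof -
  obtain y where y: "b = ereal y" "1 \<le> y" "y \<le> 2"
    using conj by (cases b) (auto simp: conjugate_exponents_def)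
  define F where "F = ell_norm b {# h i. i \<in># mset_set I #}"
  \<comment> \<open>Since \<open>0 powr 0 = 0\<close>, for \<open>y = 1\<close> this is the
    indicator of the support of \<open>h\<close>; if \<open>F = 0\<close>, the quotients and hence
    all \<open>g i\<close> are 0.\<close>
  define g where "g = (\<lambda>i. (h i / F) powr (y - 1))"
  have F0: "0 \<le> F" by (simp add: F_def ell_norm_nonneg)
  have Fy: "(\<Sum>i\<in>I. h i powr y) = F powr y"
    using ell_norm_powr[of y h I] y h by (simp add: F_def)
  have gh: "(\<Sum>i\<in>I. g i * h i) = F"
  proof (cases "F = 0")
    case True
    then show ?thesis by (simp add: g_def)
  next
    case False
    have "g i * h i = h i powr y / F powr (y - 1)" if "i \<in> I" for i
    proof (cases "h i = 0")
      case False
      then have "0 < h i" using h[OF that] by simp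
      then show ?thesis using F0 by (simp add: g_def powr_divide powr_diff)
    qed (simp add: g_def)
    then have "(\<Sum>i\<in>I. g i * h i) = F powr y / F powr (y - 1)"
      by (simp add: Fy[symmetric] sum_divide_distrib)
    then show ?thesis using False F0 by (simp add: powr_diff)
  qed
  have "ell_norm a {# g i. i \<in># mset_set I #} \<le> 1"
    using conj
  proof (cases rule: conjugate_exponents_cases)
    case 1
    then have "y = 1" using y by (simp add: one_ereal_def)
    then show ?thesis using 1 I by (auto simp: ell_norm_infinity_le_iff g_def)
  next
    case (2 x z)
    then have z: "z = y" using y by simp
    have xy: "(y - 1) * x = y" using 2 z by (simp add: field_simps)
    have "(\<Sum>i\<in>I. \<bar>g i\<bar> powr x) = (\<Sum>i\<in>I. h i powr y) / F powr y"
      using h F0 by (simp add: g_def powr_powr xy powr_divide sum_divide_distrib)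
    also have "\<dots> \<le> 1" by (simp add: Fy)
    finally show ?thesis using 2 sum_nonneg[of I "\<lambda>i. \<bar>g i\<bar> powr x"]
      by (auto simp: ell_norm_finite_exponent intro!: powr_le1)
  qed
  then show ?thesis using gh by (intro that[of g]) (auto simp: g_def F_def)
qed

section \<open>Averages of squares with doubly stochastic weights\<close>

lemma abs_powr_eq_square_powr: "\<bar>u\<bar> powr x = (u\<^sup>2) powr (x / 2)" for u :: real
proof -
  have "u\<^sup>2 = \<bar>u\<bar> powr 2" by simp
  then show ?thesis by (simp add: powr_powr del: powr_numeral)
qed

text \<open>Jensen's inequality for the convex power \<open>x / 2\<close> bounds each
  \<open>\<bar>y i\<bar> powr x\<close> by an average of powers; row sums equal to 1 allow this, and
  column sums equal to 1 remove the weights after summation over \<open>i\<close>. For the maximum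
  norm, an average never exceeds the largest entry.\<close>

lemma ell_norm_doubly_stochastic_ge2:
  assumes I: "finite I" and P: "\<And>i l. i \<in> I \<Longrightarrow> l \<in> I \<Longrightarrow> 0 \<le> P i l"
    "\<And>i. i \<in> I \<Longrightarrow> (\<Sum>l\<in>I. P i l) = 1" "\<And>l. l \<in> I \<Longrightarrow> (\<Sum>i\<in>I. P i l) = 1"
    and y: "\<And>i. i \<in> I \<Longrightarrow> (y i)\<^sup>2 = (\<Sum>l\<in>I. P i l * (t l)\<^sup>2)" and r: "2 \<le> r"
  shows "ell_norm r {# y i. i \<in># mset_set I #} \<le> ell_norm r {# t i. i \<in># mset_set I #}"
proof (cases r)
  case (real x)
  note sq = abs_powr_eq_square_powr
  have "(\<Sum>i\<in>I. \<bar>y i\<bar> powr x) = (\<Sum>i\<in>I. (\<Sum>l\<in>I. P i l * (t l)\<^sup>2) powr (x / 2))"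
    by (intro sum.cong refl) (simp add: sq[of _ x] y)
  also have "\<dots> \<le> (\<Sum>i\<in>I. \<Sum>l\<in>I. P i l * ((t l)\<^sup>2) powr (x / 2))"
    using I P r real by (intro sum_mono powr_sum_le_sum_powr) auto
  also have "\<dots> = (\<Sum>l\<in>I. (\<Sum>i\<in>I. P i l) * \<bar>t l\<bar> powr x)"
    unfolding sum_distrib_right sq[of _ x] by (rule sum.swap)
  also have "\<dots> = (\<Sum>l\<in>I. \<bar>t l\<bar> powr x)" using P by simp
  finally show ?thesis using real r
    by (auto simp: ell_norm_finite_exponent intro!: powr_mono2 sum_nonneg)
next
  case PInf
  define m where "m = ell_norm \<infinity> {# t i. i \<in># mset_set I #}"
  have m: "0 \<le> m" "\<And>l. l \<in> I \<Longrightarrow> \<bar>t l\<bar> \<le> m"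
    using I by (auto simp: m_def ell_norm_nonneg abs_le_ell_norm_infinity)
  have "\<bar>y i\<bar> \<le> m" if i: "i \<in> I" for i
  proof -
    have "(y i)\<^sup>2 \<le> (\<Sum>l\<in>I. P i l * m\<^sup>2)"
      unfolding y[OF i] using m P i by (intro sum_mono mult_left_mono) (auto simp: abs_le_square_iff[symmetric])
    also have "\<dots> = m\<^sup>2" using P i by (simp add: sum_distrib_right[symmetric])
    finally show ?thesis using m(1) by (simp add: abs_le_square_iff[symmetric])
  qed
  then show ?thesis using PInf I m(1) by (simp add: ell_norm_infinity_le_iff m_def[symmetric])
qed (use r in auto)

text \<open>For exponents up to 2 the power \<open>x / 2\<close> is concave, so averaging now
  increases the norm. This reversal is what bounds a Schatten norm with exponent at most 2 from
  above by row norms in an arbitrary basis.\<close>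

lemma ell_norm_doubly_stochastic_le2:
  assumes I: "finite I" and P: "\<And>i l. i \<in> I \<Longrightarrow> l \<in> I \<Longrightarrow> 0 \<le> P i l"
    "\<And>i. i \<in> I \<Longrightarrow> (\<Sum>l\<in>I. P i l) = 1" "\<And>l. l \<in> I \<Longrightarrow> (\<Sum>i\<in>I. P i l) = 1"
    and y: "\<And>i. i \<in> I \<Longrightarrow> (y i)\<^sup>2 = (\<Sum>l\<in>I. P i l * (t l)\<^sup>2)" and r: "1 \<le> r" "r \<le> 2"
  shows "ell_norm r {# t i. i \<in># mset_set I #} \<le> ell_norm r {# y i. i \<in># mset_set I #}"
proof -
  obtain x where x: "r = ereal x" "1 \<le> x" "x \<le> 2" using r by (cases r) auto
  note sq = abs_powr_eq_square_powr
  have "(\<Sum>l\<in>I. \<bar>t l\<bar> powr x) = (\<Sum>l\<in>I. (\<Sum>i\<in>I. P i l) * \<bar>t l\<bar> powr x)" using P by simp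
  also have "\<dots> = (\<Sum>i\<in>I. \<Sum>l\<in>I. P i l * ((t l)\<^sup>2) powr (x / 2))"
    unfolding sum_distrib_right sq[of _ x] by (rule sum.swap)
  also have "\<dots> \<le> (\<Sum>i\<in>I. (\<Sum>l\<in>I. P i l * (t l)\<^sup>2) powr (x / 2))"
    using I P x by (intro sum_mono sum_powr_le_powr_sum) auto
  also have "\<dots> = (\<Sum>i\<in>I. \<bar>y i\<bar> powr x)"
    by (intro sum.cong refl) (simp add: sq[of _ x] y)
  finally show ?thesis using x
    by (auto simp: ell_norm_finite_exponent intro!: powr_mono2 sum_nonneg)
qed

text \<open>With the weights \<open>v\<^sub>i\<^sup>q / \<parallel>v\<parallel>\<^sup>q\<close> this is the inequality between the means of order \<open>q\<close> and 2
  of the ratios \<open>x\<^sub>i / v\<^sub>i\<close>.\<close>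

lemma ell_norm_le_weighted_squares:
  assumes I: "finite I" and q: "1 \<le> q" "q \<le> 2"
    and v: "\<And>i. i \<in> I \<Longrightarrow> 0 \<le> v i" and x: "\<And>i. i \<in> I \<Longrightarrow> v i = 0 \<Longrightarrow> x i = 0"
  defines "F \<equiv> ell_norm (ereal q) {# v i. i \<in># mset_set I #}"
  shows "(ell_norm (ereal q) {# x i. i \<in># mset_set I #})\<^sup>2
    \<le> F\<^sup>2 * (\<Sum>i\<in>I. v i powr q / F powr q * ((x i)\<^sup>2 / (v i)\<^sup>2))"
proof (cases "F = 0")
  case True
  then have "x i = 0" if "i \<in> I" for i
    using that I q x ell_norm_eq_0_iff[of I q v] by (auto simp: F_def)
  then show ?thesis using I q True ell_norm_eq_0_iff[of I q x] by simp
next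
  case False
  then have F: "F > 0" unfolding F_def using ell_norm_nonneg by (metis less_eq_real_def)
  have Fq: "(\<Sum>i\<in>I. v i powr q) = F powr q"
    using ell_norm_powr[of q v I] q v by (simp add: F_def)
  define a where "a = (\<lambda>i. v i powr q / F powr q)"
  define z where "z = (\<lambda>i. (x i)\<^sup>2 / (v i)\<^sup>2)"
  define X where "X = ell_norm (ereal q) {# x i. i \<in># mset_set I #}"
  have X0: "0 \<le> X" by (simp add: X_def ell_norm_nonneg)
  have a: "(\<Sum>i\<in>I. a i) = 1" using F by (simp add: a_def sum_divide_distrib[symmetric] Fq)
  have az: "a i * z i powr (q / 2) = \<bar>x i\<bar> powr q / F powr q" if i: "i \<in> I" for i
  proof (cases "v i = 0")
    case True
    then show ?thesis using x[OF i] by (simp add: a_def)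
  next
    case False
    then have "0 < v i" using v[OF i] by simp
    moreover have "z i powr (q / 2) = (\<bar>x i\<bar> / v i) powr q"
    proof -
      have "z i = (\<bar>x i\<bar> / v i) powr 2" using \<open>0 < v i\<close> by (simp add: z_def power_divide)
      then show ?thesis by (simp add: powr_powr)
    qed
    ultimately show ?thesis by (simp add: a_def powr_divide)
  qed
  have "X powr q / F powr q = (\<Sum>i\<in>I. a i * z i powr (q / 2))"
    using ell_norm_powr[of q x I] q by (simp add: X_def az sum_divide_distrib)
  also have "\<dots> \<le> (\<Sum>i\<in>I. a i * z i) powr (q / 2)"
    using I q a by (intro sum_powr_le_powr_sum) (auto simp: a_def z_def)
  finally have le: "(X / F) powr q \<le> (\<Sum>i\<in>I. a i * z i) powr (q / 2)"
    using X0 F by (simp add: powr_divide)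
  have S0: "0 \<le> (\<Sum>i\<in>I. a i * z i)" by (intro sum_nonneg) (auto simp: a_def z_def)
  have "((X / F) powr q) powr (2 / q) \<le> ((\<Sum>i\<in>I. a i * z i) powr (q / 2)) powr (2 / q)"
    using le q by (intro powr_mono2) auto
  then have "(X / F)\<^sup>2 \<le> (\<Sum>i\<in>I. a i * z i)"
    using q X0 F S0 by (simp add: powr_powr)
  then have "F\<^sup>2 * (X / F)\<^sup>2 \<le> F\<^sup>2 * (\<Sum>i\<in>I. a i * z i)" by (intro mult_left_mono) auto
  then show ?thesis using F by (simp add: power_divide a_def z_def X_def)
qed

text \<open>The majorant from \<open>ell_norm_le_weighted_squares\<close> is linear in the squares
  \<open>(x i \<omega>)\<^sup>2\<close> with weights free of \<omega>, so the expectation passes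
  through it and each ratio becomes at most 1. The entries may depend on each other in any
  way.\<close>

lemma (in prob_space) ell_norm_second_moment_le:
  fixes x :: "'i \<Rightarrow> 'a \<Rightarrow> real" and r :: ereal
  assumes I: "finite I" and r: "1 \<le> r" "r \<le> 2" and v: "\<And>i. i \<in> I \<Longrightarrow> 0 \<le> v i"
    and meas: "\<And>i. i \<in> I \<Longrightarrow> x i \<in> borel_measurable M"
    and int: "\<And>i. i \<in> I \<Longrightarrow> integrable M (\<lambda>\<omega>. (x i \<omega>)\<^sup>2)"
    and le: "\<And>i. i \<in> I \<Longrightarrow> (\<integral>\<omega>. (x i \<omega>)\<^sup>2 \<partial>M) \<le> (v i)\<^sup>2"
  shows "(\<lambda>\<omega>. ell_norm r {# x i \<omega>. i \<in># mset_set I #}) \<in> borel_measurable M"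
    "integrable M (\<lambda>\<omega>. (ell_norm r {# x i \<omega>. i \<in># mset_set I #})\<^sup>2)"
    "(\<integral>\<omega>. (ell_norm r {# x i \<omega>. i \<in># mset_set I #})\<^sup>2 \<partial>M) \<le> (ell_norm r {# v i. i \<in># mset_set I #})\<^sup>2"
proof -
  obtain q where q: "r = ereal q" "1 \<le> q" "q \<le> 2" using r by (cases r) auto
  define F where "F = ell_norm (ereal q) {# v i. i \<in># mset_set I #}"
  let ?R = "\<lambda>\<omega>. F\<^sup>2 * (\<Sum>i\<in>I. v i powr q / F powr q * ((x i \<omega>)\<^sup>2 / (v i)\<^sup>2))"
  let ?X = "\<lambda>\<omega>. ell_norm r {# x i \<omega>. i \<in># mset_set I #}"
  show mX: "?X \<in> borel_measurable M"
    unfolding q(1) by (simp add: ell_norm_finite_exponent) (use meas in measurable)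
  \<comment> \<open>Where \<open>v i = 0\<close> the second moment is 0, so \<open>x i\<close>
    vanishes almost everywhere; the pointwise majorant holds off this null set.\<close>
  have "AE \<omega> in M. x i \<omega> = 0" if "i \<in> I" "v i = 0" for i
  proof -
    have "(\<integral>\<omega>. (x i \<omega>)\<^sup>2 \<partial>M) = 0"
      using le[OF that(1)] that(2) by (intro antisym integral_nonneg_AE) auto
    then show ?thesis using integral_nonneg_eq_0_iff_AE[OF int[OF that(1)]] by auto
  qed
  then have "AE \<omega> in M. \<forall>i\<in>I. v i = 0 \<longrightarrow> x i \<omega> = 0"
    using I by (intro AE_finite_allI AE_impI) auto
  then have le': "AE \<omega> in M. (?X \<omega>)\<^sup>2 \<le> ?R \<omega>"
    unfolding q(1) F_def
    by eventually_elim (use I q v in \<open>intro ell_norm_le_weighted_squares, auto\<close>)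
  have intR: "integrable M ?R" using int by (intro integrable_mult_right Bochner_Integration.integrable_sum integrable_divide) auto
  have "AE \<omega> in M. norm ((?X \<omega>)\<^sup>2) \<le> norm (?R \<omega>)"
    using le' by eventually_elim (auto intro: order_trans[OF _ abs_ge_self])
  then show intX: "integrable M (\<lambda>\<omega>. (?X \<omega>)\<^sup>2)"
    using mX by (intro Bochner_Integration.integrable_bound[OF intR]) auto
  have "(\<integral>\<omega>. (?X \<omega>)\<^sup>2 \<partial>M) \<le> (\<integral>\<omega>. ?R \<omega> \<partial>M)"
    using intX intR le' by (rule integral_mono_AE)
  also have "\<dots> = F\<^sup>2 * (\<Sum>i\<in>I. v i powr q / F powr q * ((\<integral>\<omega>. (x i \<omega>)\<^sup>2 \<partial>M) / (v i)\<^sup>2))"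
    using int by (simp add: Bochner_Integration.integral_sum)
  also have "\<dots> \<le> F\<^sup>2 * (\<Sum>i\<in>I. v i powr q / F powr q)"
  proof (intro mult_left_mono sum_mono)
    fix i assume i: "i \<in> I"
    have "(\<integral>\<omega>. (x i \<omega>)\<^sup>2 \<partial>M) / (v i)\<^sup>2 \<le> 1"
      using le[OF i] by (cases "v i = 0") auto
    then show "v i powr q / F powr q * ((\<integral>\<omega>. (x i \<omega>)\<^sup>2 \<partial>M) / (v i)\<^sup>2) \<le> v i powr q / F powr q"
      by (intro mult_left_le) auto
  qed auto
  also have "\<dots> \<le> F\<^sup>2"
    using ell_norm_powr[of q v I] q v by (cases "F = 0") (simp_all add: F_def sum_divide_distrib[symmetric])
  finally show "(\<integral>\<omega>. (?X \<omega>)\<^sup>2 \<partial>M) \<le> (ell_norm r {# v i. i \<in># mset_set I #})\<^sup>2"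
    by (simp add: F_def q(1))
qed

section \<open>Schatten norms\<close>

definition row_norm :: "real mat \<Rightarrow> nat \<Rightarrow> real" where
  "row_norm A i = sqrt (\<Sum>c<dim_col A. (A $$ (i, c))\<^sup>2)"

text \<open>Equivalently, \<open>A * transpose_mat A\<close> is diagonal.\<close>

definition orthogonal_rows :: "real mat \<Rightarrow> bool" where
  "orthogonal_rows A \<longleftrightarrow>
     (\<forall>i<dim_row A. \<forall>k<dim_row A. i \<noteq> k \<longrightarrow> (\<Sum>c<dim_col A. A $$ (i, c) * A $$ (k, c)) = 0)"

lemma row_norm_nonneg: "0 \<le> row_norm A i"
  by (simp add: row_norm_def sum_nonneg)

lemma row_norm_square: "(row_norm A i)\<^sup>2 = (\<Sum>c<dim_col A. (A $$ (i, c))\<^sup>2)"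
  by (simp add: row_norm_def sum_nonneg)

lemma index_mult_mat_sum:
  assumes "A \<in> carrier_mat a b" "C \<in> carrier_mat b c" "i < a" "k < c"
  shows "(A * C) $$ (i, k) = (\<Sum>l<b. A $$ (i, l) * C $$ (l, k))"
  using assms by (simp add: scalar_prod_def lessThan_atLeast0)

lemma mult_transpose_index:
  assumes "A \<in> carrier_mat m n" "C \<in> carrier_mat m n" "i < m" "k < m"
  shows "(A * transpose_mat C) $$ (i, k) = (\<Sum>c<n. A $$ (i, c) * C $$ (k, c))"
  using assms by (simp add: scalar_prod_def lessThan_atLeast0)

lemma orthogonal_mat_dim_row_sum:
  assumes "orthogonal_mat_dim n U" "i < n" "k < n"
  shows "(\<Sum>l<n. U $$ (i, l) * U $$ (k, l)) = (if i = k then 1 else 0)"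
  using mult_transpose_index[of U n n U i k] orthogonal_mat_dimD[OF assms(1)] assms by simp

lemma orthogonal_mat_dim_col_sum:
  assumes "orthogonal_mat_dim n U" "i < n" "k < n"
  shows "(\<Sum>l<n. U $$ (l, i) * U $$ (l, k)) = (if i = k then 1 else 0)"
  using orthogonal_mat_dim_row_sum[OF orthogonal_mat_dim_transpose[OF assms(1)] assms(2,3)]
    orthogonal_mat_dimD(1)[OF assms(1)] assms by simp

lemma sum_rotate:
  "(\<Sum>i\<in>I. \<Sum>a\<in>A. \<Sum>b\<in>B. F i a b) = (\<Sum>a\<in>A. \<Sum>b\<in>B. \<Sum>i\<in>I. F i a b)"
  by (rule trans[OF sum.swap], rule sum.cong[OF refl], rule sum.swap)

lemma proots_linear_factors:
  fixes f :: "'i \<Rightarrow> 'a::idom"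
  shows "proots (\<Prod>i\<leftarrow>xs. [:- f i, 1:]) = {# f i. i \<in># mset xs #}"
proof (induction xs)
  case (Cons x xs)
  have "(\<Prod>i\<leftarrow>xs. [:- f i, 1:]) \<noteq> 0" by (auto simp: prod_list_zero_iff)
  then show ?case using Cons by (subst list.map, subst prod_list.Cons, subst proots_mult) auto
qed simp

text \<open>\<open>A A^T\<close> is similar to the diagonal matrix of the squared row norms of
  \<open>transpose_mat U * A\<close>, and similar matrices share their characteristic polynomial.
  This takes the place of a singular value decomposition: the columns of \<open>U\<close> are left
  singular vectors, and the right ones are never constructed.\<close>

lemma singular_values_eq_row_norms:
  assumes U: "orthogonal_mat_dim m U" and A: "A \<in> carrier_mat m n"
    and orth: "orthogonal_rows (transpose_mat U * A)"
  shows "singular_values A = {# row_norm (transpose_mat U * A) i. i \<in># mset_set {..<m} #}"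
proof -
  note Uc = orthogonal_mat_dimD[OF U]
  define C where "C = transpose_mat U * A"
  have C: "C \<in> carrier_mat m n" using Uc A by (simp add: C_def)
  have o: "orthogonal_rows C" using orth by (simp only: C_def)
  define D where "D = C * transpose_mat C"
  have D: "D \<in> carrier_mat m m" using C by (simp add: D_def)
  have Dii: "D $$ (i, i) = (row_norm C i)\<^sup>2" if "i < m" for i
    using mult_transpose_index[OF C C that that] C unfolding row_norm_square by (simp add: D_def power2_eq_square)
  have Dik: "D $$ (i, k) = 0" if "i < m" "k < m" "i \<noteq> k" for i k
    using mult_transpose_index[OF C C that(1,2)] o that C by (simp add: D_def orthogonal_rows_def)
  have UC: "U * C = A"
    using Uc A by (simp add: C_def assoc_mult_mat[of U m m _ m A n, symmetric] del: assoc_mult_mat)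
  have "A * transpose_mat A = (U * C) * transpose_mat (U * C)" by (simp add: UC)
  also have "\<dots> = U * D * transpose_mat U"
  proof -
    have "transpose_mat (U * C) = transpose_mat C * transpose_mat U" using Uc(1) C by (rule transpose_mult)
    moreover have "U * C * (transpose_mat C * transpose_mat U) = U * (C * (transpose_mat C * transpose_mat U))"
      using Uc C by (intro assoc_mult_mat) auto
    moreover have "C * (transpose_mat C * transpose_mat U) = C * transpose_mat C * transpose_mat U"
      using Uc C by (intro assoc_mult_mat[symmetric]) auto
    moreover have "U * (D * transpose_mat U) = U * D * transpose_mat U"
      using Uc D by (intro assoc_mult_mat[symmetric]) auto
    ultimately show ?thesis by (simp add: D_def)
  qed
  finally have AA: "A * transpose_mat A = U * D * transpose_mat U" .
  have "similar_mat (A * transpose_mat A) D"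
    by (rule similar_matI[of _ _ U "transpose_mat U" m]) (use Uc D A AA in auto)
  then have "char_poly (A * transpose_mat A) = char_poly D" by (rule char_poly_similar)
  also have "\<dots> = (\<Prod>a\<leftarrow>diag_mat D. [:- a, 1:])"
    by (rule char_poly_upper_triangular[OF D]) (use D Dik in \<open>auto simp: upper_triangular_def\<close>)
  also have "diag_mat D = map (\<lambda>i. (row_norm C i)\<^sup>2) [0..<m]"
    using D Dii by (auto simp: diag_mat_def)
  finally have cp: "char_poly (A * transpose_mat A) = (\<Prod>i\<leftarrow>[0..<m]. [:- (row_norm C i)\<^sup>2, 1:])"
    by (simp add: comp_def)
  have "proots (char_poly (A * transpose_mat A)) = {# (row_norm C i)\<^sup>2. i \<in># mset [0..<m] #}"
    unfolding cp by (rule proots_linear_factors)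
  also have "mset [0..<m] = mset_set {..<m}"
    by (metis mset_set_upto_eq_mset_upto atLeast0LessThan mset_upt)
  finally show ?thesis
    by (simp add: singular_values_def multiset.map_comp comp_def row_norm_nonneg C_def)
qed

text \<open>An eigenbasis of \<open>A A^T\<close> works: with \<open>C = U^T A\<close> one has
  \<open>C C^T = U^T (A A^T) U\<close>, which is diagonal.\<close>

lemma orthogonal_rows_exists:
  assumes A: "A \<in> carrier_mat m n"
  obtains U where "orthogonal_mat_dim m U" "orthogonal_rows (transpose_mat U * A)"
proof -
  have AA: "A * transpose_mat A \<in> carrier_mat m m" using A by simp
  have "transpose_mat (A * transpose_mat A) = A * transpose_mat A"
    using A by (simp add: transpose_mult[of _ m n _ m])
  from symmetric_diagonalization[OF AA this] obtain U d
    where U: "orthogonal_mat_dim m U" and d: "transpose_mat U * (A * transpose_mat A) * U = mat_diag m d"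
    by blast
  note Uc = orthogonal_mat_dimD[OF U]
  define C where "C = transpose_mat U * A"
  have C: "C \<in> carrier_mat m n" using Uc A by (simp add: C_def)
  have "C * transpose_mat C = C * (transpose_mat A * U)"
    using Uc A by (simp add: C_def transpose_mult[of _ m m _ n])
  also have "\<dots> = C * transpose_mat A * U"
    using Uc A C by (intro assoc_mult_mat[symmetric]) auto
  also have "C * transpose_mat A = transpose_mat U * (A * transpose_mat A)"
    unfolding C_def using Uc A by (intro assoc_mult_mat) auto
  finally have CC: "C * transpose_mat C = mat_diag m d" using d by simp
  have "orthogonal_rows C"
    unfolding orthogonal_rows_def
  proof (intro allI impI)
    fix i k assume ik: "i < dim_row C" "k < dim_row C" "i \<noteq> k"
    then show "(\<Sum>c<dim_col C. C $$ (i, c) * C $$ (k, c)) = 0"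
      using mult_transpose_index[OF C C, of i k] C by (simp add: CC mat_diag_def)
  qed
  then show ?thesis using that U by (simp add: C_def)
qed

lemma schatten_norm_eq_row_norms:
  assumes A: "A \<in> carrier_mat m n"
  obtains U where "orthogonal_mat_dim m U" "orthogonal_rows (transpose_mat U * A)"
    "\<And>r. schatten_norm r A = ell_norm r {# row_norm (transpose_mat U * A) i. i \<in># mset_set {..<m} #}"
  using orthogonal_rows_exists[OF A] singular_values_eq_row_norms[OF _ A]
  by (metis schatten_norm_def)

lemma mat_inner_eq_sum:
  assumes "A \<in> carrier_mat m n" "C \<in> carrier_mat m n"
  shows "mat_inner A C = (\<Sum>i<m. \<Sum>c<n. A $$ (i, c) * C $$ (i, c))"
  unfolding mat_inner_def using assms mult_transpose_index[OF assms] by (auto intro!: sum.cong)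

lemma mat_inner_orthogonal_invariant:
  assumes U: "orthogonal_mat_dim m U" and A: "A \<in> carrier_mat m n" and C: "C \<in> carrier_mat m n"
  shows "mat_inner (transpose_mat U * A) (transpose_mat U * C) = mat_inner A C"
proof -
  note Uc = orthogonal_mat_dimD[OF U]
  have ix: "(transpose_mat U * A) $$ (i, c) = (\<Sum>a<m. U $$ (a, i) * A $$ (a, c))"
    if "A \<in> carrier_mat m n" "i < m" "c < n" for A i c
    using that Uc by (subst index_mult_mat_sum[of _ m m _ n]) (auto intro!: sum.cong)
  have c1: "transpose_mat U * A \<in> carrier_mat m n" "transpose_mat U * C \<in> carrier_mat m n"
    using Uc A C by auto
  have "mat_inner (transpose_mat U * A) (transpose_mat U * C) =
      (\<Sum>i<m. \<Sum>c<n. (\<Sum>a<m. U $$ (a, i) * A $$ (a, c)) * (\<Sum>b<m. U $$ (b, i) * C $$ (b, c)))"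
    unfolding mat_inner_eq_sum[OF c1] using A C by (intro sum.cong) (auto simp: ix simp del: index_mult_mat)
  also have "\<dots> = (\<Sum>c<n. \<Sum>i<m. \<Sum>a<m. \<Sum>b<m. A $$ (a, c) * C $$ (b, c) * (U $$ (a, i) * U $$ (b, i)))"
    by (subst sum.swap) (simp add: sum_product mult_ac)
  also have "\<dots> = (\<Sum>c<n. \<Sum>a<m. \<Sum>b<m. \<Sum>i<m. A $$ (a, c) * C $$ (b, c) * (U $$ (a, i) * U $$ (b, i)))"
    by (rule sum.cong[OF refl], rule sum_rotate)
  also have "\<dots> = (\<Sum>c<n. \<Sum>a<m. \<Sum>b<m. A $$ (a, c) * C $$ (b, c) * (if b = a then 1 else 0))"
    by (intro sum.cong refl) (auto simp add: sum_distrib_left[symmetric] orthogonal_mat_dim_row_sum[OF U])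
  also have "\<dots> = (\<Sum>c<n. \<Sum>a<m. A $$ (a, c) * C $$ (a, c))"
    by (simp add: if_distrib[of "\<lambda>x. _ * x"] cong: if_cong)
  also have "\<dots> = mat_inner A C"
    unfolding mat_inner_eq_sum[OF A C] by (rule sum.swap)
  finally show ?thesis .
qed

text \<open>Pythagoras: orthogonal rows of \<open>C\<close> leave only the diagonal terms. For
  orthogonal \<open>R\<close> the coefficients \<open>(R $$ (i, l))\<^sup>2\<close> are doubly
  stochastic, which links the row norms in two different bases.\<close>

lemma row_norm_orthogonal_mult:
  assumes C: "C \<in> carrier_mat m n" "orthogonal_rows C" and R: "R \<in> carrier_mat m m" and i: "i < m"
  shows "(row_norm (R * C) i)\<^sup>2 = (\<Sum>l<m. (R $$ (i, l))\<^sup>2 * (row_norm C l)\<^sup>2)"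
proof -
  have "(row_norm (R * C) i)\<^sup>2 = (\<Sum>c<n. (\<Sum>l<m. R $$ (i, l) * C $$ (l, c))\<^sup>2)"
    unfolding row_norm_square using C R i
    by (intro sum.cong) (auto simp: index_mult_mat_sum[of R m m C n] simp del: index_mult_mat(1))
  also have "\<dots> = (\<Sum>c<n. \<Sum>l<m. \<Sum>k<m. R $$ (i, l) * R $$ (i, k) * (C $$ (l, c) * C $$ (k, c)))"
    by (simp add: power2_eq_square sum_product mult_ac)
  also have "\<dots> = (\<Sum>l<m. \<Sum>k<m. \<Sum>c<n. R $$ (i, l) * R $$ (i, k) * (C $$ (l, c) * C $$ (k, c)))"
    by (rule sum_rotate)
  also have "\<dots> = (\<Sum>l<m. \<Sum>k<m. if k = l then (R $$ (i, l))\<^sup>2 * (row_norm C l)\<^sup>2 else 0)"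
  proof (intro sum.cong refl)
    fix l k assume "l \<in> {..<m}" "k \<in> {..<m}"
    then have "(\<Sum>c<n. C $$ (l, c) * C $$ (k, c)) = (if k = l then (row_norm C l)\<^sup>2 else 0)"
      using C unfolding row_norm_square by (auto simp: orthogonal_rows_def power2_eq_square)
    then show "(\<Sum>c<n. R $$ (i, l) * R $$ (i, k) * (C $$ (l, c) * C $$ (k, c))) =
        (if k = l then (R $$ (i, l))\<^sup>2 * (row_norm C l)\<^sup>2 else 0)"
      by (simp add: sum_distrib_left[symmetric] power2_eq_square)
  qed
  finally show ?thesis by simp
qed

text \<open>The squared entries of the orthogonal matrix \<open>W\<^sup>T U\<close> are doubly stochastic, where \<open>U\<close>
  diagonalizes \<open>A A\<^sup>T\<close>.\<close>

lemma
  assumes W: "orthogonal_mat_dim m W" and A: "A \<in> carrier_mat m n"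
  shows row_norms_le_schatten_norm: "2 \<le> r \<Longrightarrow>
      ell_norm r {# row_norm (transpose_mat W * A) i. i \<in># mset_set {..<m} #} \<le> schatten_norm r A"
    and schatten_norm_le_row_norms: "1 \<le> r \<Longrightarrow> r \<le> 2 \<Longrightarrow>
      schatten_norm r A \<le> ell_norm r {# row_norm (transpose_mat W * A) i. i \<in># mset_set {..<m} #}"
proof -
  obtain U where U: "orthogonal_mat_dim m U" and o: "orthogonal_rows (transpose_mat U * A)"
    and S: "\<And>r. schatten_norm r A = ell_norm r {# row_norm (transpose_mat U * A) i. i \<in># mset_set {..<m} #}"
    using schatten_norm_eq_row_norms[OF A] by blast
  note Uc = orthogonal_mat_dimD[OF U] and Wc = orthogonal_mat_dimD[OF W]
  define R where "R = transpose_mat W * U"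
  have R: "orthogonal_mat_dim m R"
    unfolding R_def using W U by (intro orthogonal_mat_dim_mult orthogonal_mat_dim_transpose)
  have Rc: "R \<in> carrier_mat m m" using R by (rule orthogonal_mat_dimD)
  have C: "transpose_mat U * A \<in> carrier_mat m n" using Uc A by simp
  have "R * (transpose_mat U * A) = transpose_mat W * (U * (transpose_mat U * A))"
    unfolding R_def using Uc Wc A by (intro assoc_mult_mat) auto
  also have "U * (transpose_mat U * A) = U * transpose_mat U * A"
    using Uc A by (intro assoc_mult_mat[symmetric]) auto
  finally have RC: "R * (transpose_mat U * A) = transpose_mat W * A" using Uc A by simp
  have row: "(row_norm (transpose_mat W * A) i)\<^sup>2 =
      (\<Sum>l\<in>{..<m}. (R $$ (i, l))\<^sup>2 * (row_norm (transpose_mat U * A) l)\<^sup>2)" if "i \<in> {..<m}" for i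
    using row_norm_orthogonal_mult[OF C o Rc, of i] that by (simp add: RC)
  have stoch: "(\<Sum>l\<in>{..<m}. (R $$ (i, l))\<^sup>2) = 1" "(\<Sum>l\<in>{..<m}. (R $$ (l, i))\<^sup>2) = 1" if "i \<in> {..<m}" for i
    using orthogonal_mat_dim_row_sum[OF R, of i i] orthogonal_mat_dim_col_sum[OF R, of i i] that
    by (simp_all add: power2_eq_square)
  show "ell_norm r {# row_norm (transpose_mat W * A) i. i \<in># mset_set {..<m} #} \<le> schatten_norm r A"
    if "2 \<le> r"
    unfolding S by (rule ell_norm_doubly_stochastic_ge2[where P = "\<lambda>i l. (R $$ (i, l))\<^sup>2"])
      (use that row stoch in auto)
  show "schatten_norm r A \<le> ell_norm r {# row_norm (transpose_mat W * A) i. i \<in># mset_set {..<m} #}"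
    if "1 \<le> r" "r \<le> 2"
    unfolding S by (rule ell_norm_doubly_stochastic_le2[where P = "\<lambda>i l. (R $$ (i, l))\<^sup>2"])
      (use that row stoch in auto)
qed

section \<open>Duality of the Schatten norms\<close>

lemma schatten_norm_nonneg: "0 \<le> schatten_norm r A"
  by (simp add: schatten_norm_def ell_norm_nonneg)

text \<open>In the basis \<open>U\<close> belonging to \<open>A\<close> the row norms of
  \<open>A\<close> are its singular values, and Cauchy-Schwarz on each row reduces the claim to
  vectors. The row norms of \<open>C\<close> in this basis need not be its singular values, but
  their norm is at most the Schatten norm since the exponent \<open>p\<close> is at least 2.\<close>

lemma schatten_norm_Holder:
  assumes conj: "conjugate_exponents p q" "2 \<le> p" "q \<le> 2"
    and A: "A \<in> carrier_mat m n" and C: "C \<in> carrier_mat m n"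
  shows "\<bar>mat_inner A C\<bar> \<le> schatten_norm q A * schatten_norm p C"
proof -
  obtain U where U: "orthogonal_mat_dim m U"
    and S: "\<And>r. schatten_norm r A = ell_norm r {# row_norm (transpose_mat U * A) i. i \<in># mset_set {..<m} #}"
    using schatten_norm_eq_row_norms[OF A] by metis
  note Uc = orthogonal_mat_dimD[OF U]
  let ?A = "transpose_mat U * A" and ?C = "transpose_mat U * C"
  have c: "?A \<in> carrier_mat m n" "?C \<in> carrier_mat m n" using Uc A C by auto
  have "\<bar>mat_inner A C\<bar> = \<bar>\<Sum>i<m. \<Sum>l<n. ?A $$ (i, l) * ?C $$ (i, l)\<bar>"
    by (simp only: mat_inner_orthogonal_invariant[OF U A C, symmetric] mat_inner_eq_sum[OF c])
  also have "\<dots> \<le> (\<Sum>i<m. \<bar>\<Sum>l<n. ?A $$ (i, l) * ?C $$ (i, l)\<bar>)" by (rule sum_abs)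
  also have "\<dots> \<le> (\<Sum>i<m. \<bar>row_norm ?A i * row_norm ?C i\<bar>)"
  proof (intro sum_mono)
    fix i
    have "(\<Sum>l<n. ?A $$ (i, l) * ?C $$ (i, l))\<^sup>2 \<le> (row_norm ?A i * row_norm ?C i)\<^sup>2"
      using Cauchy_Schwarz_ineq_sum[of "\<lambda>l. ?A $$ (i, l)" "\<lambda>l. ?C $$ (i, l)" "{..<n}"] c
      by (simp only: power_mult_distrib row_norm_square carrier_matD)
    then show "\<bar>\<Sum>l<n. ?A $$ (i, l) * ?C $$ (i, l)\<bar> \<le> \<bar>row_norm ?A i * row_norm ?C i\<bar>"
      by (simp only: abs_le_square_iff)
  qed
  also have "\<dots> \<le> ell_norm q {# row_norm ?A i. i \<in># mset_set {..<m} #} * ell_norm p {# row_norm ?C i. i \<in># mset_set {..<m} #}"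
    using conj by (intro ell_norm_Holder) auto
  also have "\<dots> \<le> schatten_norm q A * schatten_norm p C"
    unfolding S[of q] using conj by (intro mult_left_mono row_norms_le_schatten_norm[OF U C] ell_norm_nonneg)
  finally show ?thesis .
qed

text \<open>\<open>C\<close> keeps the singular vectors of \<open>A\<close> and replaces the
  singular values by the extremal vector \<open>g\<close>: the rows of
  \<open>transpose_mat U * A\<close> are rescaled to length \<open>g i\<close> and rotated
  back.\<close>

lemma schatten_norm_dual_attained:
  assumes conj: "conjugate_exponents p q" "2 \<le> p" "q \<le> 2" and A: "A \<in> carrier_mat m n"
  obtains C where "C \<in> carrier_mat m n" "mat_inner A C = schatten_norm q A" "schatten_norm p C \<le> 1"
proof -
  obtain U where U: "orthogonal_mat_dim m U" and o: "orthogonal_rows (transpose_mat U * A)"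
    and S: "\<And>r. schatten_norm r A = ell_norm r {# row_norm (transpose_mat U * A) i. i \<in># mset_set {..<m} #}"
    using schatten_norm_eq_row_norms[OF A] by blast
  note Uc = orthogonal_mat_dimD[OF U]
  define R where "R = transpose_mat U * A"
  have R: "R \<in> carrier_mat m n" using Uc A by (simp add: R_def)
  obtain g where g: "\<And>i. i \<in> {..<m} \<Longrightarrow> 0 \<le> g i" "\<And>i. i \<in> {..<m} \<Longrightarrow> row_norm R i = 0 \<Longrightarrow> g i = 0"
    "(\<Sum>i<m. g i * row_norm R i) = ell_norm q {# row_norm R i. i \<in># mset_set {..<m} #}"
    "ell_norm p {# g i. i \<in># mset_set {..<m} #} \<le> 1"
    using ell_norm_dual_attained[OF conj, of "{..<m}" "row_norm R"] row_norm_nonneg by auto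
  \<comment> \<open>A zero row has \<open>g i = 0\<close> as well, so the quotient
    \<open>0 / 0 = 0\<close> still gives the row length \<open>g i\<close>.\<close>
  define T where "T = Matrix.mat m n (\<lambda>(i, c). g i / row_norm R i * R $$ (i, c))"
  have T: "T \<in> carrier_mat m n" by (simp add: T_def)
  have UT: "transpose_mat U * (U * T) = T"
    using Uc T by (simp add: assoc_mult_mat[of _ m m _ m T n, symmetric] del: assoc_mult_mat)
  have Tn: "row_norm T i = g i" if i: "i < m" for i
  proof -
    have "(row_norm T i)\<^sup>2 = (g i / row_norm R i)\<^sup>2 * (row_norm R i)\<^sup>2"
      unfolding row_norm_square using i R by (simp add: T_def power_mult_distrib power_divide sum_distrib_left)
    also have "\<dots> = (g i)\<^sup>2" using g(2)[of i] i by (auto simp: power_divide)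
    finally show ?thesis using g(1)[of i] i row_norm_nonneg[of T i] by (simp add: power2_eq_iff_nonneg)
  qed
  have To: "orthogonal_rows T"
    unfolding orthogonal_rows_def
  proof (intro allI impI)
    fix i k assume ik: "i < dim_row T" "k < dim_row T" "i \<noteq> k"
    have "(\<Sum>c<dim_col T. T $$ (i, c) * T $$ (k, c)) =
        (g i / row_norm R i * (g k / row_norm R k)) * (\<Sum>c<n. R $$ (i, c) * R $$ (k, c))"
      unfolding sum_distrib_left using ik by (intro sum.cong) (auto simp: T_def)
    then show "(\<Sum>c<dim_col T. T $$ (i, c) * T $$ (k, c)) = 0"
      using o ik R T by (simp add: orthogonal_rows_def R_def[symmetric])
  qed
  define C where "C = U * T"
  have C: "C \<in> carrier_mat m n" using Uc T by (simp add: C_def)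
  have UC: "transpose_mat U * C = T" by (simp only: C_def UT)
  have SC: "schatten_norm p C = ell_norm p {# row_norm T i. i \<in># mset_set {..<m} #}"
    using singular_values_eq_row_norms[OF U C] To by (simp add: UC schatten_norm_def)
  also have "\<dots> = ell_norm p {# g i. i \<in># mset_set {..<m} #}"
    by (rule ell_norm_cong) (simp add: Tn)
  finally have "schatten_norm p C \<le> 1" using g(4) by simp
  moreover have "mat_inner A C = schatten_norm q A"
  proof -
    have "mat_inner A C = mat_inner R T"
      using mat_inner_orthogonal_invariant[OF U A C] by (simp add: UC R_def)
    also have "\<dots> = (\<Sum>i<m. g i / row_norm R i * (row_norm R i)\<^sup>2)"
      unfolding mat_inner_eq_sum[OF R T] row_norm_square using R
      by (auto simp: T_def sum_distrib_left power2_eq_square intro!: sum.cong)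
    also have "\<dots> = (\<Sum>i<m. g i * row_norm R i)" by (intro sum.cong) (auto simp: power2_eq_square)
    finally show ?thesis using g(3) S[of q] by (simp only: R_def)
  qed
  ultimately show ?thesis using that C by blast
qed

lemma schatten_norm_smult:
  assumes A: "A \<in> carrier_mat m n" and r: "1 \<le> r"
  shows "schatten_norm r (c \<cdot>\<^sub>m A) = \<bar>c\<bar> * schatten_norm r A"
proof -
  obtain U where U: "orthogonal_mat_dim m U" and o: "orthogonal_rows (transpose_mat U * A)"
    and S: "\<And>r. schatten_norm r A = ell_norm r {# row_norm (transpose_mat U * A) i. i \<in># mset_set {..<m} #}"
    using schatten_norm_eq_row_norms[OF A] by blast
  note Uc = orthogonal_mat_dimD[OF U]
  define R where "R = transpose_mat U * A"
  have R: "R \<in> carrier_mat m n" using Uc A by (simp add: R_def)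
  have cR: "transpose_mat U * (c \<cdot>\<^sub>m A) = c \<cdot>\<^sub>m R"
    using Uc A by (simp add: R_def mult_smult_distrib[of _ m m _ n])
  have "orthogonal_rows (c \<cdot>\<^sub>m R)"
    unfolding orthogonal_rows_def
  proof (intro allI impI)
    fix i k assume ik: "i < dim_row (c \<cdot>\<^sub>m R)" "k < dim_row (c \<cdot>\<^sub>m R)" "i \<noteq> k"
    have "(\<Sum>l<dim_col (c \<cdot>\<^sub>m R). (c \<cdot>\<^sub>m R) $$ (i, l) * (c \<cdot>\<^sub>m R) $$ (k, l)) = c * c * (\<Sum>l<dim_col R. R $$ (i, l) * R $$ (k, l))"
      unfolding sum_distrib_left using ik by (intro sum.cong) auto
    then show "(\<Sum>l<dim_col (c \<cdot>\<^sub>m R). (c \<cdot>\<^sub>m R) $$ (i, l) * (c \<cdot>\<^sub>m R) $$ (k, l)) = 0"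
      using o ik by (simp add: orthogonal_rows_def R_def[symmetric])
  qed
  then have "schatten_norm r (c \<cdot>\<^sub>m A) = ell_norm r {# row_norm (c \<cdot>\<^sub>m R) i. i \<in># mset_set {..<m} #}"
    using singular_values_eq_row_norms[OF U, of "c \<cdot>\<^sub>m A" n] A by (simp add: cR schatten_norm_def)
  also have "\<dots> = ell_norm r {# \<bar>c\<bar> * row_norm R i. i \<in># mset_set {..<m} #}"
  proof (rule ell_norm_cong)
    fix i assume "i \<in> {..<m}"
    then have "(\<Sum>l<n. ((c \<cdot>\<^sub>m R) $$ (i, l))\<^sup>2) = c\<^sup>2 * (\<Sum>l<n. (R $$ (i, l))\<^sup>2)"
      using R by (simp add: power_mult_distrib sum_distrib_left)
    then show "row_norm (c \<cdot>\<^sub>m R) i = \<bar>c\<bar> * row_norm R i"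
      using R by (simp add: row_norm_def real_sqrt_mult)
  qed
  also have "\<dots> = \<bar>c\<bar> * schatten_norm r A"
    using r by (simp add: ell_norm_scale S R_def)
  finally show ?thesis .
qed

section \<open>Momentum methods for a pair of dual norms\<close>

text \<open>The axioms make \<open>D\<close> the support function of the set of all \<open>Y\<close>
  with \<open>N Y \<le> 1\<close>. Subadditivity and continuity of the dual norm follow from this
  description, so the triangle inequality never has to be proved for singular values.\<close>

locale dual_norm_pair =
  fixes N D :: "'x::euclidean_space \<Rightarrow> real"
  assumes N_nonneg: "0 \<le> N Y" and D_nonneg: "0 \<le> D U"
    and N_scale: "N (c *\<^sub>R Y) = \<bar>c\<bar> * N Y"
    and inner_le: "inner U Y \<le> D U * N Y"
    and dual_attained: "\<exists>Y. N Y \<le> 1 \<and> D U \<le> inner U Y"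
begin

lemma D_leI:
  assumes "\<And>Y. N Y \<le> 1 \<Longrightarrow> inner U Y \<le> c"
  shows "D U \<le> c"
  using dual_attained[of U] assms by (blast intro: order_trans)

lemma inner_le_D: "N Y \<le> 1 \<Longrightarrow> inner U Y \<le> D U"
  using inner_le[of U Y] mult_left_le[of "N Y" "D U"] D_nonneg[of U] by linarith

lemma D_triangle: "D (U + W) \<le> D U + D W"
  by (rule D_leI) (simp add: inner_add_left add_mono inner_le_D)

lemma D_scale_le: "D (c *\<^sub>R U) \<le> \<bar>c\<bar> * D U"
proof (rule D_leI)
  fix Y assume Y: "N Y \<le> 1"
  have "inner (c *\<^sub>R U) Y = inner U (c *\<^sub>R Y)" by simp
  also have "\<dots> \<le> D U * (\<bar>c\<bar> * N Y)" using inner_le[of U "c *\<^sub>R Y"] by (simp only: N_scale)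
  also have "\<dots> \<le> D U * (\<bar>c\<bar> * 1)" using Y D_nonneg by (intro mult_left_mono) auto
  finally show "inner (c *\<^sub>R U) Y \<le> \<bar>c\<bar> * D U" by (simp add: mult.commute)
qed

lemma D_uminus_le: "D (- U) \<le> D U"
  using D_scale_le[of "-1" U] by simp

lemma D_diff_le: "D (U - W) \<le> D U + D W"
  using D_triangle[of U "- W"] D_uminus_le[of W] by simp

text \<open>A finite convex function on a Euclidean space is continuous. The purpose is Borel
  measurability of the dual norm without a study of how singular values depend on the
  matrix.\<close>

lemma continuous_on_D: "continuous_on UNIV D"
proof (rule convex_on_continuous[OF open_UNIV], rule convex_onI)
  fix t :: real and x y :: 'x
  assume t: "0 < t" "t < 1"
  show "D ((1 - t) *\<^sub>R x + t *\<^sub>R y) \<le> (1 - t) * D x + t * D y"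
    using D_triangle[of "(1 - t) *\<^sub>R x" "t *\<^sub>R y"] D_scale_le[of "1 - t" x] D_scale_le[of t y] t by simp
qed simp

text \<open>The trial step \<open>Z\<close> along a dual maximizer has value at most
  \<open>- \<eta> / 2 * (D M)\<^sup>2\<close>, while \<open>inner_le\<close> bounds the value at
  \<open>d\<close> from below by the same number plus
  \<open>(N d - \<eta> * D M)\<^sup>2 / (2 * \<eta>)\<close>. Both can hold only if this square is
  0, so all minimizers share the step length and the pairing with \<open>M\<close>.\<close>

lemma minimizer_step:
  assumes \<eta>: "0 < \<eta>"
    and min: "\<And>Y. inner M d + 1 / (2 * \<eta>) * (N d)\<^sup>2 \<le> inner M Y + 1 / (2 * \<eta>) * (N Y)\<^sup>2"
  shows "N d = \<eta> * D M" "inner M d = - \<eta> * (D M)\<^sup>2"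
proof -
  obtain Y where Y: "N Y \<le> 1" "D M \<le> inner M Y" using dual_attained by blast
  define Z where "Z = (- \<eta> * D M) *\<^sub>R Y"
  have "N Z = \<eta> * D M * N Y" using \<eta> D_nonneg[of M] unfolding Z_def N_scale by (simp add: abs_mult)
  also have "\<dots> \<le> \<eta> * D M" using Y \<eta> D_nonneg[of M] by (simp add: mult_left_le)
  finally have "(N Z)\<^sup>2 \<le> (\<eta> * D M)\<^sup>2" by (rule power_mono[OF _ N_nonneg])
  then have "1 / (2 * \<eta>) * (N Z)\<^sup>2 \<le> 1 / (2 * \<eta>) * (\<eta> * D M)\<^sup>2" using \<eta> by (intro mult_left_mono) auto
  also have "\<dots> = \<eta> / 2 * (D M)\<^sup>2" using \<eta> by (simp add: power2_eq_square field_simps)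
  finally have NZ: "1 / (2 * \<eta>) * (N Z)\<^sup>2 \<le> \<eta> / 2 * (D M)\<^sup>2" .
  have "\<eta> * D M * D M \<le> \<eta> * D M * inner M Y" using Y(2) \<eta> D_nonneg[of M] by (intro mult_left_mono) auto
  then have MZ: "inner M Z \<le> - \<eta> * (D M)\<^sup>2" by (simp add: Z_def power2_eq_square)
  have up: "inner M d + 1 / (2 * \<eta>) * (N d)\<^sup>2 \<le> - \<eta> / 2 * (D M)\<^sup>2"
    using min[of Z] NZ MZ by simp
  have "inner M (- d) \<le> D M * N (- d)" by (rule inner_le)
  moreover have "N (- d) = N d" using N_scale[of "-1" d] by simp
  ultimately have low: "- (D M * N d) \<le> inner M d" by simp
  have "(N d - \<eta> * D M)\<^sup>2 = 2 * \<eta> * (1 / (2 * \<eta>) * (N d)\<^sup>2 - D M * N d + \<eta> / 2 * (D M)\<^sup>2)"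
    using \<eta> by (simp add: power2_diff algebra_simps power2_eq_square)
  also have "\<dots> \<le> 0" using up low \<eta> by (intro mult_nonneg_nonpos) auto
  finally show Nd: "N d = \<eta> * D M" by simp
  have e: "1 / (2 * \<eta>) * (N d)\<^sup>2 = \<eta> / 2 * (D M)\<^sup>2" "D M * N d = \<eta> * (D M)\<^sup>2"
    using \<eta> by (simp_all add: Nd power2_eq_square field_simps)
  show "inner M d = - \<eta> * (D M)\<^sup>2" using up low unfolding e by simp
qed

text \<open>Along the segment the gap between \<open>f\<close> and its quadratic model is
  nonincreasing: its derivative is the pairing of a gradient difference with \<open>d\<close>, minus
  \<open>t * (N d)\<^sup>2\<close>, which duality and smoothness make nonpositive.\<close>

lemma smooth_descent:
  assumes deriv: "\<And>Y. GDERIV f Y :> g Y"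
    and smooth: "\<And>Y Z. D (g Z - g Y) \<le> N (Z - Y)"
  shows "f (x + d) \<le> f x + inner (g x) d + (N d)\<^sup>2 / 2"
proof -
  define h where "h = (\<lambda>t. f (x + t *\<^sub>R d) - t * inner (g x) d - t\<^sup>2 * (N d)\<^sup>2 / 2)"
  have "h 1 \<le> h 0"
  proof (rule DERIV_nonpos_imp_nonincreasing[of 0 1 h])
    fix t :: real
    assume t: "0 \<le> t" "t \<le> 1"
    have "(f has_derivative (\<lambda>v. inner v (g (x + t *\<^sub>R d)))) (at (x + t *\<^sub>R d))"
      using deriv by (simp add: gderiv_def)
    then have "((\<lambda>t. f (x + t *\<^sub>R d)) has_derivative (\<lambda>s. inner (s *\<^sub>R d) (g (x + t *\<^sub>R d)))) (at t)"
      by (rule has_derivative_compose[rotated]) (auto intro!: derivative_eq_intros)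
    then have "((\<lambda>t. f (x + t *\<^sub>R d)) has_real_derivative inner (g (x + t *\<^sub>R d)) d) (at t)"
      by (simp add: has_field_derivative_def inner_commute mult_commute_abs)
    then have "(h has_real_derivative (inner (g (x + t *\<^sub>R d)) d - inner (g x) d - t * (N d)\<^sup>2)) (at t)"
      unfolding h_def by (auto intro!: derivative_eq_intros)
    moreover have "inner (g (x + t *\<^sub>R d)) d - inner (g x) d - t * (N d)\<^sup>2 \<le> 0"
    proof -
      have "inner (g (x + t *\<^sub>R d) - g x) d \<le> D (g (x + t *\<^sub>R d) - g x) * N d" by (rule inner_le)
      also have "\<dots> \<le> N ((x + t *\<^sub>R d) - x) * N d" by (intro mult_right_mono smooth N_nonneg)
      also have "\<dots> = t * (N d)\<^sup>2" using t by (simp add: N_scale power2_eq_square)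
      finally show ?thesis by (simp add: inner_diff_left)
    qed
    ultimately show "\<exists>y. (h has_real_derivative y) (at t) \<and> y \<le> 0" by blast
  qed simp
  then show ?thesis by (simp add: h_def)
qed

text \<open>The momentum error \<open>M k - g (X k)\<close> is the sum of the accumulated noise \<open>S k\<close> and of a drift
  caused by the motion of the iterates, which is controlled by the steps \<open>N (X (Suc k) - X k)\<close>.\<close>

lemma momentum_path_bound:
  fixes X M G S :: "nat \<Rightarrow> 'x"
  assumes deriv: "\<And>Y. GDERIV f Y :> g Y"
    and smooth: "\<And>Y Z. D (g Z - g Y) \<le> N (Z - Y)"
    and lower: "\<And>Y. f_low \<le> f Y"
    and \<theta>: "0 < \<theta>" "\<theta> \<le> 1" and \<eta>: "\<eta> = \<theta> / 4"
    and M: "M 0 = G 0" "\<And>k. M (Suc k) = (1 - \<theta>) *\<^sub>R M k + \<theta> *\<^sub>R G (Suc k)"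
    and S: "S 0 = G 0 - g (X 0)"
      "\<And>k. S (Suc k) = (1 - \<theta>) *\<^sub>R S k + \<theta> *\<^sub>R (G (Suc k) - g (X (Suc k)))"
    and X: "\<And>k Y. inner (M k) (X (Suc k) - X k) + 1 / (2 * \<eta>) * (N (X (Suc k) - X k))\<^sup>2
      \<le> inner (M k) (Y - X k) + 1 / (2 * \<eta>) * (N (Y - X k))\<^sup>2"
  shows "(\<Sum>k<K. (D (g (X k)))\<^sup>2) \<le> 34 * (f (X 0) - f_low) / \<theta> + 23 / 2 * (\<Sum>k<K. (D (S k))\<^sup>2)"
proof -
  have \<eta>0: "0 < \<eta>" using \<theta> \<eta> by simp
  define A where "A = (\<lambda>k. M k - g (X k) - S k)"
  define m a s where "m = (\<lambda>k. D (M k))" and "a = (\<lambda>k. D (A k))" and "s = (\<lambda>k. D (S k))"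
  have nn: "0 \<le> m k" "0 \<le> a k" "0 \<le> s k" for k by (simp_all add: m_def a_def s_def D_nonneg)
  have Xd: "inner (M k) (X (Suc k) - X k) + 1 / (2 * \<eta>) * (N (X (Suc k) - X k))\<^sup>2
      \<le> inner (M k) Y + 1 / (2 * \<eta>) * (N Y)\<^sup>2" for k Y
    using X[of k "X k + Y"] by simp
  have step: "N (X (Suc k) - X k) = \<eta> * m k" "inner (M k) (X (Suc k) - X k) = - \<eta> * (m k)\<^sup>2" for k
    using minimizer_step[OF \<eta>0 Xd, of k] by (simp_all add: m_def)
  have a0: "a 0 = 0"
    using D_scale_le[of 0 0] D_nonneg[of 0] by (simp add: a_def A_def M S)
  have aS: "(a (Suc k))\<^sup>2 \<le> (1 - \<theta>) * (a k)\<^sup>2 + \<theta> / 16 * (m k)\<^sup>2" for k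
  proof -
    have "A (Suc k) = (1 - \<theta>) *\<^sub>R (A k - (g (X (Suc k)) - g (X k)))"
      by (simp add: A_def M S algebra_simps)
    then have "a (Suc k) \<le> (1 - \<theta>) * D (A k - (g (X (Suc k)) - g (X k)))"
      using D_scale_le[of "1 - \<theta>" "A k - (g (X (Suc k)) - g (X k))"] \<theta> by (simp add: a_def)
    also have "\<dots> \<le> (1 - \<theta>) * (a k + \<eta> * m k)"
      using D_diff_le[of "A k" "g (X (Suc k)) - g (X k)"] smooth[of "X (Suc k)" "X k"] \<theta> step(1)[of k]
      by (intro mult_left_mono) (auto simp: a_def)
    finally have "(a (Suc k))\<^sup>2 \<le> ((1 - \<theta>) * (a k + \<eta> * m k))\<^sup>2" by (rule power_mono[OF _ nn(2)])
    also have "\<dots> \<le> (1 - \<theta>) * (a k)\<^sup>2 + \<theta> / 16 * (m k)\<^sup>2"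
    proof -
      \<comment> \<open>Jensen: as \<open>\<eta> = \<theta> / 4\<close>,
        \<open>(1 - \<theta>) * (a k + \<eta> * m k)\<close> is the convex combination of
        \<open>a k\<close> and \<open>(1 - \<theta>) / 4 * m k\<close> with weights
        \<open>1 - \<theta>\<close> and \<open>\<theta>\<close>. The first term on the right is the
        Jensen gap, the second comes from replacing \<open>(1 - \<theta>) / 4\<close> by
        \<open>1 / 4\<close>.\<close>
      have "(1 - \<theta>) * (a k)\<^sup>2 + \<theta> / 16 * (m k)\<^sup>2 - ((1 - \<theta>) * (a k + \<eta> * m k))\<^sup>2
          = (1 - \<theta>) * \<theta> * (a k - (1 - \<theta>) / 4 * m k)\<^sup>2 + \<theta> / 16 * (m k)\<^sup>2 * (1 - (1 - \<theta>)\<^sup>2)"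
        unfolding \<eta> by (simp add: power2_eq_square field_simps)
      moreover have "(1 - \<theta>)\<^sup>2 \<le> 1" using \<theta> by (simp add: power_le_one)
      ultimately show ?thesis using \<theta> by (smt (verit) mult_nonneg_nonneg zero_le_power2 divide_nonneg_nonneg)
    qed
    finally show ?thesis .
  qed
  \<comment> \<open>The ratio 1/16 is \<open>(\<eta> / \<theta>)\<^sup>2\<close>. The term
    \<open>(a n)\<^sup>2\<close> carries the induction and is discarded afterwards.\<close>
  have drift: "\<theta> * (\<Sum>k<n. (a k)\<^sup>2) + (a n)\<^sup>2 \<le> \<theta> / 16 * (\<Sum>k<n. (m k)\<^sup>2)" for n
  proof (induction n)
    case (Suc n)
    then show ?case using aS[of n] by (simp add: algebra_simps)
  qed (simp add: a0)
  have desc: "\<eta> * ((m k)\<^sup>2 / 2 - 2 * (a k)\<^sup>2 - (s k)\<^sup>2) \<le> f (X k) - f (X (Suc k))" for k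
  proof -
    define d where "d = X (Suc k) - X k"
    have "f (X k + d) \<le> f (X k) + inner (g (X k)) d + (N d)\<^sup>2 / 2"
      by (rule smooth_descent[OF deriv smooth])
    also have "inner (g (X k)) d = inner (M k) d - inner (A k + S k) d"
      by (simp add: A_def inner_diff_left)
    also have "\<dots> \<le> - \<eta> * (m k)\<^sup>2 + (a k + s k) * (\<eta> * m k)"
    proof -
      have "inner (- (A k + S k)) d \<le> D (- (A k + S k)) * N d" by (rule inner_le)
      also have "\<dots> \<le> (a k + s k) * N d"
        using D_uminus_le[of "A k + S k"] D_triangle[of "A k" "S k"]
        by (intro mult_right_mono N_nonneg) (auto simp: a_def s_def)
      finally show ?thesis using step[of k] unfolding inner_minus_left by (simp add: d_def)
    qed
    finally have "f (X (Suc k)) \<le> f (X k) - \<eta> * (m k)\<^sup>2 + (a k + s k) * (\<eta> * m k) + (\<eta> * m k)\<^sup>2 / 2"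
      using step(1)[of k] by (simp add: d_def)
    \<comment> \<open>Of the full decrease \<open>\<eta> * (m k)\<^sup>2\<close>, the drift takes
      1/8, the noise 1/4 and the quadratic term of the descent inequality another 1/8; one half is
      left.\<close>
    moreover have "(a k + s k) * m k \<le> (m k)\<^sup>2 / 8 + 2 * (a k)\<^sup>2 + (m k)\<^sup>2 / 4 + (s k)\<^sup>2"
    proof -
      have "0 \<le> 2 * (a k - m k / 4)\<^sup>2 + (s k - m k / 2)\<^sup>2" by simp
      then show ?thesis by (simp add: power2_eq_square algebra_simps)
    qed
    then have "\<eta> * ((a k + s k) * m k) \<le> \<eta> * ((m k)\<^sup>2 / 8 + 2 * (a k)\<^sup>2 + (m k)\<^sup>2 / 4 + (s k)\<^sup>2)"
      using \<eta>0 by (intro mult_left_mono) auto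
    moreover have "(\<eta> * m k)\<^sup>2 / 2 \<le> \<eta> * (m k)\<^sup>2 / 8"
    proof -
      have "\<eta> * (\<eta> * (m k)\<^sup>2) \<le> 1 / 4 * (\<eta> * (m k)\<^sup>2)"
        using \<theta> \<eta> \<eta>0 by (intro mult_right_mono) auto
      then show ?thesis by (simp add: power2_eq_square algebra_simps)
    qed
    ultimately show ?thesis by (simp add: algebra_simps)
  qed
  have "(\<Sum>k<K. \<eta> * ((m k)\<^sup>2 / 2 - 2 * (a k)\<^sup>2 - (s k)\<^sup>2)) \<le> (\<Sum>k<K. f (X k) - f (X (Suc k)))"
    by (intro sum_mono desc)
  also have "\<dots> = f (X 0) - f (X K)" by (rule sum_lessThan_telescope'[of "\<lambda>k. f (X k)"])
  also have "\<dots> \<le> f (X 0) - f_low" using lower by simp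
  finally have "(\<Sum>k<K. \<eta> * ((m k)\<^sup>2 / 2 - 2 * (a k)\<^sup>2 - (s k)\<^sup>2)) \<le> f (X 0) - f_low" .
  then have "\<eta> * ((\<Sum>k<K. (m k)\<^sup>2) / 2 - 2 * (\<Sum>k<K. (a k)\<^sup>2) - (\<Sum>k<K. (s k)\<^sup>2)) \<le> f (X 0) - f_low"
    by (simp add: sum_distrib_left[symmetric] sum_subtractf sum_divide_distrib[symmetric])
  then have main: "(\<Sum>k<K. (m k)\<^sup>2) / 2 - 2 * (\<Sum>k<K. (a k)\<^sup>2) - (\<Sum>k<K. (s k)\<^sup>2) \<le> 4 * ((f (X 0) - f_low) / \<theta>)"
    using \<theta> by (simp add: \<eta> field_simps)
  have "\<theta> * (\<Sum>k<K. (a k)\<^sup>2) \<le> \<theta> * ((\<Sum>k<K. (m k)\<^sup>2) / 16)" using drift[of K] by (simp add: algebra_simps) (smt (verit) zero_le_power2)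
  then have aK: "(\<Sum>k<K. (a k)\<^sup>2) \<le> (\<Sum>k<K. (m k)\<^sup>2) / 16" using \<theta> by simp
  \<comment> \<open>Inserting \<open>a \<le> m / 16\<close> leaves
    \<open>3 / 8 * m \<le> 4 * d + s\<close>; hence \<open>3 * (m + a)\<close> is at most
    \<open>34 * d + 17 / 2 * s\<close>, and the remaining \<open>3 * s\<close> raises 17/2 to
    23/2.\<close>
  have total: "3 * (m + a + s) \<le> 34 * d + 23 / 2 * s"
    if "m / 2 - 2 * a - s \<le> 4 * d" "a \<le> m / 16" for m a s d :: real
    using that by (simp add: field_simps)
  have "(\<Sum>k<K. (D (g (X k)))\<^sup>2) \<le> (\<Sum>k<K. 3 * ((m k)\<^sup>2 + (a k)\<^sup>2 + (s k)\<^sup>2))"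
  proof (intro sum_mono)
    fix k
    have "g (X k) = M k - (A k + S k)" by (simp add: A_def)
    then have "D (g (X k)) \<le> m k + (a k + s k)"
      using D_diff_le[of "M k" "A k + S k"] D_triangle[of "A k" "S k"] by (simp add: m_def a_def s_def)
    then have "(D (g (X k)))\<^sup>2 \<le> (m k + (a k + s k))\<^sup>2" by (rule power_mono[OF _ D_nonneg])
    also have "\<dots> \<le> 3 * ((m k)\<^sup>2 + (a k)\<^sup>2 + (s k)\<^sup>2)"
    proof -
      have "0 \<le> (m k - a k)\<^sup>2 + (a k - s k)\<^sup>2 + (m k - s k)\<^sup>2" by simp
      then show ?thesis by (simp add: power2_eq_square algebra_simps)
    qed
    finally show "(D (g (X k)))\<^sup>2 \<le> 3 * ((m k)\<^sup>2 + (a k)\<^sup>2 + (s k)\<^sup>2)" .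
  qed
  also have "\<dots> = 3 * ((\<Sum>k<K. (m k)\<^sup>2) + (\<Sum>k<K. (a k)\<^sup>2) + (\<Sum>k<K. (s k)\<^sup>2))"
    by (simp add: sum_distrib_left sum.distrib)
  also have "\<dots> \<le> 34 * ((f (X 0) - f_low) / \<theta>) + 23 / 2 * (\<Sum>k<K. (s k)\<^sup>2)"
    using main aK by (rule total)
  finally show ?thesis by (simp add: s_def)
qed

end

section \<open>Noise of an adaptive sampling scheme\<close>

text \<open>All samples other than \<open>t\<close> generate this algebra, not only the earlier
  ones. It therefore also contains the remaining draws of the batch of \<open>t\<close>, so that one
  algebra serves for cross terms within a batch and between batches.\<close>

definition others_algebra ::
    "'w measure \<Rightarrow> 's measure \<Rightarrow> 'i set \<Rightarrow> ('i \<Rightarrow> 'w \<Rightarrow> 's) \<Rightarrow> 'i \<Rightarrow> 'w measure" where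
  "others_algebra P S T \<zeta> t = sigma (space P) (\<Union>u\<in>T - {t}. {\<zeta> u -` A \<inter> space P | A. A \<in> sets S})"

lemma space_others_algebra [simp]: "space (others_algebra P S T \<zeta> t) = space P"
  by (simp add: others_algebra_def space_measure_of_conv)

lemma sets_others_algebra:
  "sets (others_algebra P S T \<zeta> t) = sigma_sets (space P) (\<Union>u\<in>T - {t}. {\<zeta> u -` A \<inter> space P | A. A \<in> sets S})"
  unfolding others_algebra_def by (rule sets_measure_of) auto

context prob_space
begin

lemma others_algebra_subalgebra:
  assumes "\<And>u. u \<in> T \<Longrightarrow> \<zeta> u \<in> measurable M S"
  shows "(\<lambda>\<omega>. \<omega>) \<in> measurable M (others_algebra M S T \<zeta> t)"
proof (rule measurableI)
  fix A assume "A \<in> sets (others_algebra M S T \<zeta> t)"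
  moreover have "sets (others_algebra M S T \<zeta> t) \<subseteq> sets M"
    unfolding sets_others_algebra using assms by (intro sets.sigma_sets_subset) (auto intro: measurable_sets)
  ultimately show "(\<lambda>\<omega>. \<omega>) -` A \<inter> space M \<in> sets M"
    using sets.sets_into_space[of A] by (auto simp: Int_absorb2)
qed simp

text \<open>Independence as a product law: \<omega>, seen through the algebra of the other samples,
  is itself a random element, namely the identity map into a coarser measurable space, and is
  independent of \<open>\<zeta> t\<close>.\<close>

lemma distr_pair_others_algebra:
  assumes ind: "indep_vars (\<lambda>_. S) \<zeta> T" and t: "t \<in> T"
  shows "distr M (others_algebra M S T \<zeta> t) (\<lambda>\<omega>. \<omega>) \<Otimes>\<^sub>M distr M S (\<zeta> t) =
    distr M (others_algebra M S T \<zeta> t \<Otimes>\<^sub>M S) (\<lambda>\<omega>. (\<omega>, \<zeta> t \<omega>))"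
proof -
  let ?E = "\<lambda>u. {\<zeta> u -` A \<inter> space M | A. A \<in> sets S}"
  have rv: "\<zeta> u \<in> measurable M S" if "u \<in> T" for u
    using ind that by (auto simp: indep_vars_def2)
  have un: "(\<Union>j\<in>UNIV. case_bool (T - {t}) {t} j) = T"
    using t by (auto simp: UNIV_bool split: bool.splits)
  have "indep_sets (\<lambda>j. sigma_sets (space M) (\<Union>i\<in>case_bool (T - {t}) {t} j. ?E i)) UNIV"
  proof (rule indep_sets_collect_sigma)
    show "indep_sets ?E (\<Union>j\<in>UNIV. case_bool (T - {t}) {t} j)"
      using ind unfolding un by (simp add: indep_vars_def2)
    show "Int_stable (?E i)" for i
    proof (rule Int_stableI)
      fix a b assume "a \<in> ?E i" "b \<in> ?E i"
      then obtain A B where "A \<in> sets S" "B \<in> sets S" "a = \<zeta> i -` A \<inter> space M" "b = \<zeta> i -` B \<inter> space M" by blast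
      then show "a \<inter> b \<in> ?E i" by (intro CollectI exI[of _ "A \<inter> B"]) auto
    qed
    show "disjoint_family_on (case_bool (T - {t}) {t}) UNIV"
      by (auto simp: disjoint_family_on_def split: bool.splits)
  qed
  moreover have "sigma_sets (space M) (\<Union>i\<in>case_bool (T - {t}) {t} j. ?E i) =
      case_bool (sets (others_algebra M S T \<zeta> t)) (sigma_sets (space M) (?E t)) j" for j
    by (cases j) (simp_all add: sets_others_algebra)
  ultimately have ind2: "indep_set (sets (others_algebra M S T \<zeta> t)) (sigma_sets (space M) (?E t))"
    by (simp add: indep_set_def)
  let ?F = "others_algebra M S T \<zeta> t"
  have id: "(\<lambda>\<omega>. \<omega>) \<in> measurable M ?F" using rv by (rule others_algebra_subalgebra)
  interpret N: prob_space "distr M ?F (\<lambda>\<omega>. \<omega>)" using id by (rule prob_space_distr)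
  interpret \<mu>: prob_space "distr M S (\<zeta> t)" using rv[OF t] by (rule prob_space_distr)
  show ?thesis
  proof (rule pair_measure_eqI)
    show "sigma_finite_measure (distr M ?F (\<lambda>\<omega>. \<omega>))" "sigma_finite_measure (distr M S (\<zeta> t))" ..
    show "sets (distr M ?F (\<lambda>\<omega>. \<omega>) \<Otimes>\<^sub>M distr M S (\<zeta> t)) = sets (distr M (?F \<Otimes>\<^sub>M S) (\<lambda>\<omega>. (\<omega>, \<zeta> t \<omega>)))"
      by (simp cong: sets_pair_measure_cong)
    fix A C assume "A \<in> sets (distr M ?F (\<lambda>\<omega>. \<omega>))" "C \<in> sets (distr M S (\<zeta> t))"
    then have A: "A \<in> sets ?F" and C: "C \<in> sets S" by auto
    have AM: "(\<lambda>\<omega>. \<omega>) -` A \<inter> space M = A" "A \<inter> space M = A" using sets.sets_into_space[OF A] by auto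
    have "prob (A \<inter> (\<zeta> t -` C \<inter> space M)) = prob A * prob (\<zeta> t -` C \<inter> space M)"
      using ind2 A C by (intro indep_setD) auto
    moreover have "(\<lambda>\<omega>. (\<omega>, \<zeta> t \<omega>)) -` (A \<times> C) \<inter> space M = A \<inter> (\<zeta> t -` C \<inter> space M)"
      using AM by auto
    moreover have "(\<lambda>\<omega>. (\<omega>, \<zeta> t \<omega>)) \<in> measurable M (?F \<Otimes>\<^sub>M S)"
      using id rv[OF t] by (intro measurable_Pair)
    ultimately show "emeasure (distr M ?F (\<lambda>\<omega>. \<omega>)) A * emeasure (distr M S (\<zeta> t)) C =
        emeasure (distr M (?F \<Otimes>\<^sub>M S) (\<lambda>\<omega>. (\<omega>, \<zeta> t \<omega>))) (A \<times> C)"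
      using A C id rv[OF t] by (simp add: emeasure_distr AM emeasure_eq_measure ennreal_mult)
  qed
qed

text \<open>Fubini on that product law: whatever is determined by the other samples is frozen while
  the sample \<open>t\<close> is averaged out. It stands in for conditioning on the past.\<close>

lemma
  assumes ind: "indep_vars (\<lambda>_. S) \<zeta> T" and t: "t \<in> T"
  defines "F \<equiv> others_algebra M S T \<zeta> t"
  shows nn_integral_others_algebra:
      "\<And>h. (\<lambda>(\<omega>, z). h \<omega> z) \<in> borel_measurable (F \<Otimes>\<^sub>M S) \<Longrightarrow>
        (\<integral>\<^sup>+\<omega>. h \<omega> (\<zeta> t \<omega>) \<partial>M) = (\<integral>\<^sup>+\<omega>. (\<integral>\<^sup>+z. h \<omega> z \<partial>distr M S (\<zeta> t)) \<partial>M)"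
    and lebesgue_integral_others_algebra:
      "\<And>h :: 'a \<Rightarrow> 'b \<Rightarrow> real. (\<lambda>(\<omega>, z). h \<omega> z) \<in> borel_measurable (F \<Otimes>\<^sub>M S) \<Longrightarrow>
        integrable M (\<lambda>\<omega>. h \<omega> (\<zeta> t \<omega>)) \<Longrightarrow>
        (\<integral>\<omega>. h \<omega> (\<zeta> t \<omega>) \<partial>M) = (\<integral>\<omega>. (\<integral>z. h \<omega> z \<partial>distr M S (\<zeta> t)) \<partial>M)"
proof -
  let ?N = "distr M F (\<lambda>\<omega>. \<omega>)" and ?\<mu> = "distr M S (\<zeta> t)"
  have rv: "\<zeta> u \<in> measurable M S" if "u \<in> T" for u
    using ind that by (auto simp: indep_vars_def2)
  have zt: "\<zeta> t \<in> measurable M S" using rv t .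
  have id: "(\<lambda>\<omega>. \<omega>) \<in> measurable M F" unfolding F_def using rv by (rule others_algebra_subalgebra)
  have prod: "?N \<Otimes>\<^sub>M ?\<mu> = distr M (F \<Otimes>\<^sub>M S) (\<lambda>\<omega>. (\<omega>, \<zeta> t \<omega>))"
    unfolding F_def using ind t by (rule distr_pair_others_algebra)
  have pair: "(\<lambda>\<omega>. (\<omega>, \<zeta> t \<omega>)) \<in> measurable M (F \<Otimes>\<^sub>M S)"
    using id zt by (intro measurable_Pair)
  interpret N: prob_space ?N using id by (rule prob_space_distr)
  interpret \<mu>: prob_space ?\<mu> using zt by (rule prob_space_distr)
  interpret pair_sigma_finite ?N ?\<mu> ..
  have sets_eq: "sets (?N \<Otimes>\<^sub>M ?\<mu>) = sets (F \<Otimes>\<^sub>M S)" by (intro sets_pair_measure_cong) auto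
  { fix h :: "'a \<Rightarrow> 'b \<Rightarrow> ennreal"
    assume h: "(\<lambda>(\<omega>, z). h \<omega> z) \<in> borel_measurable (F \<Otimes>\<^sub>M S)"
    then have h': "(\<lambda>(\<omega>, z). h \<omega> z) \<in> borel_measurable (?N \<Otimes>\<^sub>M ?\<mu>)"
      using measurable_cong_sets[OF sets_eq refl] by blast
    have "(\<integral>\<^sup>+\<omega>. h \<omega> (\<zeta> t \<omega>) \<partial>M) = (\<integral>\<^sup>+x. (case x of (\<omega>, z) \<Rightarrow> h \<omega> z) \<partial>(?N \<Otimes>\<^sub>M ?\<mu>))"
      unfolding prod by (subst nn_integral_distr[OF pair]) (use h in auto)
    also have "\<dots> = (\<integral>\<^sup>+\<omega>. (\<integral>\<^sup>+z. h \<omega> z \<partial>?\<mu>) \<partial>?N)"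
      using \<mu>.nn_integral_fst[OF h'] by simp
    also have "\<dots> = (\<integral>\<^sup>+\<omega>. (\<integral>\<^sup>+z. h \<omega> z \<partial>?\<mu>) \<partial>M)"
      using \<mu>.borel_measurable_nn_integral_fst[OF h'] by (subst nn_integral_distr[OF id]) auto
    finally show "(\<integral>\<^sup>+\<omega>. h \<omega> (\<zeta> t \<omega>) \<partial>M) = (\<integral>\<^sup>+\<omega>. (\<integral>\<^sup>+z. h \<omega> z \<partial>?\<mu>) \<partial>M)" . }
  { fix h :: "'a \<Rightarrow> 'b \<Rightarrow> real"
    assume h: "(\<lambda>(\<omega>, z). h \<omega> z) \<in> borel_measurable (F \<Otimes>\<^sub>M S)"
      and int: "integrable M (\<lambda>\<omega>. h \<omega> (\<zeta> t \<omega>))"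
    then have h': "(\<lambda>(\<omega>, z). h \<omega> z) \<in> borel_measurable (?N \<Otimes>\<^sub>M ?\<mu>)"
      using measurable_cong_sets[OF sets_eq refl] by blast
    have int': "integrable (?N \<Otimes>\<^sub>M ?\<mu>) (\<lambda>(\<omega>, z). h \<omega> z)"
      unfolding prod using int by (subst integrable_distr_eq[OF pair]) (use h in auto)
    have "(\<integral>\<omega>. h \<omega> (\<zeta> t \<omega>) \<partial>M) = (\<integral>x. (case x of (\<omega>, z) \<Rightarrow> h \<omega> z) \<partial>(?N \<Otimes>\<^sub>M ?\<mu>))"
      unfolding prod by (subst integral_distr[OF pair]) (use h in auto)
    also have "\<dots> = (\<integral>\<omega>. (\<integral>z. h \<omega> z \<partial>?\<mu>) \<partial>?N)"
      using integral_fst'[OF int'] by simp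
    also have "\<dots> = (\<integral>\<omega>. (\<integral>z. h \<omega> z \<partial>?\<mu>) \<partial>M)"
      using \<mu>.borel_measurable_lebesgue_integral[OF h'] by (subst integral_distr[OF id]) auto
    finally show "(\<integral>\<omega>. h \<omega> (\<zeta> t \<omega>) \<partial>M) = (\<integral>\<omega>. (\<integral>z. h \<omega> z \<partial>?\<mu>) \<partial>M)" . }
qed

end

locale adaptive_sampling = prob_space P for P :: "'w measure" +
  fixes S :: "'s measure" and \<zeta> :: "nat \<times> nat \<Rightarrow> 'w \<Rightarrow> 's" and B :: nat and \<mu> :: "'s measure"
    and G :: "'x::euclidean_space \<Rightarrow> 's \<Rightarrow> 'x" and g :: "'x \<Rightarrow> 'x"
    and x0 :: 'x and X :: "nat \<Rightarrow> 'w \<Rightarrow> 'x"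
  assumes indep: "indep_vars (\<lambda>_. S) \<zeta> (UNIV \<times> {1..B})"
    and law: "\<And>t. t \<in> UNIV \<times> {1..B} \<Longrightarrow> distr P S (\<zeta> t) = \<mu>"
    and G_meas: "(\<lambda>(Y, s). G Y s) \<in> borel_measurable (borel \<Otimes>\<^sub>M S)"
    and g_meas: "g \<in> borel_measurable borel"
    and X_0: "\<And>\<omega>. \<omega> \<in> space P \<Longrightarrow> X 0 \<omega> = x0"
    and X_adapted: "\<And>k. X (Suc k) \<in> borel_measurable (sample_history P S B \<zeta> k)"
    and G_unbiased: "\<And>Y. has_bochner_integral \<mu> (G Y) (g Y)"
    and batch_pos: "1 \<le> B"
begin

abbreviation "T \<equiv> UNIV \<times> {1..B}"
abbreviation "F t \<equiv> others_algebra P S T \<zeta> t"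

definition noise :: "nat \<times> nat \<Rightarrow> 'w \<Rightarrow> 'x" where
  "noise t \<omega> = G (X (fst t) \<omega>) (\<zeta> t \<omega>) - g (X (fst t) \<omega>)"

lemma sample_meas: "t \<in> T \<Longrightarrow> \<zeta> t \<in> measurable P S"
  using indep by (auto simp: indep_vars_def2)

lemma sample_meas_others: "u \<in> T \<Longrightarrow> u \<noteq> t \<Longrightarrow> \<zeta> u \<in> measurable (F t) S"
proof (rule measurableI)
  assume u: "u \<in> T" "u \<noteq> t"
  show "\<zeta> u \<omega> \<in> space S" if "\<omega> \<in> space (F t)" for \<omega>
    using that sample_meas[OF u(1)] by (auto dest: measurable_space)
  show "\<zeta> u -` A \<inter> space (F t) \<in> sets (F t)" if "A \<in> sets S" for A
    unfolding sets_others_algebra space_others_algebra using u that by (intro sigma_sets.Basic) blast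
qed

text \<open>Adaptedness lags by one: iterate \<open>Suc j\<close> depends on the batches up to
  \<open>j\<close> only, and \<open>j < fst t\<close>, so the sample \<open>t\<close> has not yet
  been used.\<close>

lemma X_meas_others:
  assumes "k \<le> fst t"
  shows "X k \<in> borel_measurable (F t)"
proof (cases k)
  case 0
  have "(\<lambda>_. x0) \<in> borel_measurable (F t)" by simp
  then show ?thesis using X_0 0 by (subst measurable_cong[where g = "\<lambda>_. x0"]) auto
next
  case (Suc j)
  have space: "space (sample_history P S B \<zeta> j) = space P" by (simp add: sample_history_def space_measure_of_conv)
  have "sets (sample_history P S B \<zeta> j) \<subseteq> sets (F t)"
    unfolding sample_history_def sets_others_algebra
  proof (subst sets_measure_of)
    let ?C = "{\<zeta> (s, i) -` A \<inter> space P | s i A. s \<le> j \<and> i \<in> {1..B} \<and> A \<in> sets S}"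
    show "?C \<subseteq> Pow (space P)" by auto
    have "?C \<subseteq> (\<Union>u\<in>T - {t}. {\<zeta> u -` A \<inter> space P |A. A \<in> sets S})"
    proof
      fix a assume "a \<in> ?C"
      then obtain s i A where a: "a = \<zeta> (s, i) -` A \<inter> space P" "s \<le> j" "i \<in> {1..B}" "A \<in> sets S" by blast
      then have "(s, i) \<in> T - {t}" using assms Suc by auto
      then show "a \<in> (\<Union>u\<in>T - {t}. {\<zeta> u -` A \<inter> space P |A. A \<in> sets S})" using a by blast
    qed
    then show "sigma_sets (space P) ?C \<subseteq> sigma_sets (space P) (\<Union>u\<in>T - {t}. {\<zeta> u -` A \<inter> space P |A. A \<in> sets S})"
      by (rule sigma_sets_mono')
  qed
  then show ?thesis
    using X_adapted[of j] Suc space by (auto simp: measurable_def)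
qed

lemma noise_meas_others:
  assumes u: "u \<in> T" "u \<noteq> t" "fst u \<le> fst t"
  shows "noise u \<in> borel_measurable (F t)"
proof -
  note [measurable] = X_meas_others[OF u(3)] sample_meas_others[OF u(1,2)] g_meas
  have "(\<lambda>\<omega>. (X (fst u) \<omega>, \<zeta> u \<omega>)) \<in> measurable (F t) (borel \<Otimes>\<^sub>M S)" by measurable
  from measurable_compose[OF this G_meas]
  have [measurable]: "(\<lambda>\<omega>. G (X (fst u) \<omega>) (\<zeta> u \<omega>)) \<in> borel_measurable (F t)" by simp
  show ?thesis unfolding noise_def[abs_def] by measurable
qed

text \<open>Batch positions start at 1, so the pair \<open>(k, 0)\<close> is no sample and leaving
  it out removes nothing; it only supplies the first component \<open>k\<close>.\<close>

lemma X_meas: "X k \<in> borel_measurable P"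
  using measurable_compose[OF others_algebra_subalgebra X_meas_others[of k "(k, 0)"]] sample_meas by simp

lemma noise_meas:
  assumes u: "u \<in> T"
  shows "noise u \<in> borel_measurable P"
proof -
  note [measurable] = X_meas sample_meas[OF u] g_meas
  have "(\<lambda>\<omega>. (X (fst u) \<omega>, \<zeta> u \<omega>)) \<in> measurable P (borel \<Otimes>\<^sub>M S)" by measurable
  from measurable_compose[OF this G_meas]
  have [measurable]: "(\<lambda>\<omega>. G (X (fst u) \<omega>) (\<zeta> u \<omega>)) \<in> borel_measurable P" by simp
  show ?thesis unfolding noise_def[abs_def] by measurable
qed

lemma centered_meas:
  "(\<lambda>(\<omega>, z). G (X (fst t) \<omega>) z - g (X (fst t) \<omega>)) \<in> borel_measurable (F t \<Otimes>\<^sub>M S)"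
proof -
  note [measurable] = X_meas_others[OF order_refl] g_meas
  have "(\<lambda>(\<omega>, z). (X (fst t) \<omega>, z)) \<in> measurable (F t \<Otimes>\<^sub>M S) (borel \<Otimes>\<^sub>M S)" by measurable
  from measurable_compose[OF this G_meas]
  have 1: "(\<lambda>x. G (X (fst t) (fst x)) (snd x)) \<in> borel_measurable (F t \<Otimes>\<^sub>M S)"
    by (simp add: case_prod_beta)
  have 2: "(\<lambda>x. g (X (fst t) (fst x))) \<in> borel_measurable (F t \<Otimes>\<^sub>M S)" by measurable
  show ?thesis unfolding case_prod_beta using 1 2 by (rule borel_measurable_diff)
qed

text \<open>The variance bound holds at every fixed point \<open>Y\<close> with the same
  \<open>v\<close>; with the iterate frozen by the other samples it can be integrated over the
  sample and then over the rest. Nonnegative integrals come first because integrability is part of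
  the claim.\<close>

lemma noise_second_moment:
  fixes \<phi> :: "'c \<Rightarrow> 'x \<Rightarrow> real"
  assumes t: "t \<in> T" and lin: "\<And>c. c \<in> C \<Longrightarrow> bounded_linear (\<phi> c)"
    and int: "\<And>Y. integrable \<mu> (\<lambda>z. \<Sum>c\<in>C. (\<phi> c (G Y z - g Y))\<^sup>2)"
    and le: "\<And>Y. (\<integral>z. (\<Sum>c\<in>C. (\<phi> c (G Y z - g Y))\<^sup>2) \<partial>\<mu>) \<le> v"
  shows "integrable P (\<lambda>\<omega>. \<Sum>c\<in>C. (\<phi> c (noise t \<omega>))\<^sup>2)"
    "(\<integral>\<omega>. (\<Sum>c\<in>C. (\<phi> c (noise t \<omega>))\<^sup>2) \<partial>P) \<le> v"
proof -
  have \<phi>m: "\<phi> c \<in> borel_measurable borel" if "c \<in> C" for c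
    using lin[OF that] by (intro borel_measurable_continuous_onI linear_continuous_on)
  have v: "0 \<le> v"
    by (rule order_trans[OF integral_nonneg_AE le]) (simp add: sum_nonneg)
  let ?Q = "\<lambda>y. \<Sum>c\<in>C. (\<phi> c y)\<^sup>2"
  have Qm: "?Q \<in> borel_measurable borel"
    using \<phi>m by (intro borel_measurable_sum borel_measurable_power)
  have m: "(\<lambda>\<omega>. ?Q (noise t \<omega>)) \<in> borel_measurable P"
    using measurable_compose[OF noise_meas[OF t] Qm] .
  have hm: "(\<lambda>(\<omega>, z). ennreal (?Q (G (X (fst t) \<omega>) z - g (X (fst t) \<omega>)))) \<in> borel_measurable (F t \<Otimes>\<^sub>M S)"
    using measurable_compose[OF measurable_compose[OF centered_meas Qm] measurable_ennreal]
    by (simp add: case_prod_beta)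
  have "(\<integral>\<^sup>+\<omega>. ennreal (?Q (noise t \<omega>)) \<partial>P) =
      (\<integral>\<^sup>+\<omega>. (\<integral>\<^sup>+z. ennreal (?Q (G (X (fst t) \<omega>) z - g (X (fst t) \<omega>))) \<partial>\<mu>) \<partial>P)"
    unfolding noise_def using nn_integral_others_algebra[OF indep t hm] by (simp add: law[OF t])
  also have "\<dots> \<le> (\<integral>\<^sup>+\<omega>. ennreal v \<partial>P)"
  proof (rule nn_integral_mono)
    fix \<omega>
    show "(\<integral>\<^sup>+z. ennreal (?Q (G (X (fst t) \<omega>) z - g (X (fst t) \<omega>))) \<partial>\<mu>) \<le> ennreal v"
      using le by (subst nn_integral_eq_integral[OF int]) (auto simp: sum_nonneg intro!: ennreal_leI)
  qed
  also have "\<dots> = ennreal v" by (simp add: emeasure_space_1)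
  finally have nn: "(\<integral>\<^sup>+\<omega>. ennreal (?Q (noise t \<omega>)) \<partial>P) \<le> ennreal v" .
  show i: "integrable P (\<lambda>\<omega>. ?Q (noise t \<omega>))"
    using nn m by (intro integrableI_nonneg) (auto simp: sum_nonneg top_unique intro: le_less_trans)
  show "(\<integral>\<omega>. ?Q (noise t \<omega>) \<partial>P) \<le> v"
    using nn v by (subst (asm) nn_integral_eq_integral[OF i]) (auto simp: sum_nonneg)
qed

text \<open>Of two different samples, let \<open>t\<close> be one that is not drawn in an earlier
  batch than the other. The noise of \<open>u\<close> is then frozen by the samples other than
  \<open>t\<close>, and averaging over the sample \<open>t\<close> gives 0 by unbiasedness.\<close>

lemma noise_orthogonal:
  fixes \<phi> :: "'x \<Rightarrow> real"
  assumes t: "t \<in> T" and u: "u \<in> T" and tu: "t \<noteq> u" and lin: "bounded_linear \<phi>"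
    and sq: "\<And>s. s \<in> T \<Longrightarrow> integrable P (\<lambda>\<omega>. (\<phi> (noise s \<omega>))\<^sup>2)"
  shows "integrable P (\<lambda>\<omega>. \<phi> (noise t \<omega>) * \<phi> (noise u \<omega>))"
    "(\<integral>\<omega>. \<phi> (noise t \<omega>) * \<phi> (noise u \<omega>) \<partial>P) = 0"
proof -
  have \<phi>m: "\<phi> \<in> borel_measurable borel"
    using lin by (intro borel_measurable_continuous_onI linear_continuous_on)
  have nm: "(\<lambda>\<omega>. \<phi> (noise s \<omega>)) \<in> borel_measurable P" if "s \<in> T" for s
    using measurable_compose[OF noise_meas[OF that] \<phi>m] .
  have prod_int: "integrable P (\<lambda>\<omega>. \<phi> (noise t \<omega>) * \<phi> (noise u \<omega>))" if "t \<in> T" "u \<in> T" for t u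
  proof (rule Bochner_Integration.integrable_bound)
    show "integrable P (\<lambda>\<omega>. (\<phi> (noise t \<omega>))\<^sup>2 + (\<phi> (noise u \<omega>))\<^sup>2)"
      using sq that by (intro Bochner_Integration.integrable_add)
    show "AE \<omega> in P. norm (\<phi> (noise t \<omega>) * \<phi> (noise u \<omega>)) \<le> norm ((\<phi> (noise t \<omega>))\<^sup>2 + (\<phi> (noise u \<omega>))\<^sup>2)"
    proof (rule AE_I2)
      fix \<omega>
      have "2 * (\<bar>\<phi> (noise t \<omega>)\<bar> * \<bar>\<phi> (noise u \<omega>)\<bar>) \<le> (\<phi> (noise t \<omega>))\<^sup>2 + (\<phi> (noise u \<omega>))\<^sup>2"
        using sum_squares_bound[of "\<bar>\<phi> (noise t \<omega>)\<bar>" "\<bar>\<phi> (noise u \<omega>)\<bar>"] by simp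
      moreover have "0 \<le> \<bar>\<phi> (noise t \<omega>)\<bar> * \<bar>\<phi> (noise u \<omega>)\<bar>" by simp
      ultimately show "norm (\<phi> (noise t \<omega>) * \<phi> (noise u \<omega>)) \<le> norm ((\<phi> (noise t \<omega>))\<^sup>2 + (\<phi> (noise u \<omega>))\<^sup>2)"
        unfolding real_norm_def abs_mult by linarith
    qed
  qed (use nm that in measurable)
  show "integrable P (\<lambda>\<omega>. \<phi> (noise t \<omega>) * \<phi> (noise u \<omega>))" using t u by (rule prod_int)
  have zero: "(\<integral>\<omega>. \<phi> (noise u \<omega>) * \<phi> (noise t \<omega>) \<partial>P) = 0"
    if t: "t \<in> T" and u: "u \<in> T" and ut: "u \<noteq> t" "fst u \<le> fst t" for t u
  proof -
    define h where "h = (\<lambda>\<omega> z. \<phi> (noise u \<omega>) * \<phi> (G (X (fst t) \<omega>) z - g (X (fst t) \<omega>)))"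
    have 1: "(\<lambda>x. \<phi> (noise u (fst x))) \<in> borel_measurable (F t \<Otimes>\<^sub>M S)"
      using measurable_compose[OF measurable_fst measurable_compose[OF noise_meas_others[OF u ut] \<phi>m]] .
    have 2: "(\<lambda>x. \<phi> (G (X (fst t) (fst x)) (snd x) - g (X (fst t) (fst x)))) \<in> borel_measurable (F t \<Otimes>\<^sub>M S)"
      using measurable_compose[OF centered_meas \<phi>m] by (simp add: case_prod_beta)
    have hm: "(\<lambda>(\<omega>, z). h \<omega> z) \<in> borel_measurable (F t \<Otimes>\<^sub>M S)"
      unfolding h_def case_prod_beta using 1 2 by (rule borel_measurable_times)
    have "integrable P (\<lambda>\<omega>. h \<omega> (\<zeta> t \<omega>))"
      using prod_int[OF u t] by (simp add: h_def noise_def)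
    from lebesgue_integral_others_algebra[OF indep t hm this]
    have "(\<integral>\<omega>. \<phi> (noise u \<omega>) * \<phi> (noise t \<omega>) \<partial>P) = (\<integral>\<omega>. (\<integral>z. h \<omega> z \<partial>\<mu>) \<partial>P)"
      by (simp add: h_def noise_def law[OF t])
    also have "(\<lambda>\<omega>. \<integral>z. h \<omega> z \<partial>\<mu>) = (\<lambda>\<omega>. 0)"
    proof
      fix \<omega>
      interpret \<mu>: prob_space \<mu> using prob_space_distr[OF sample_meas[OF t]] law[OF t] by simp
      have "has_bochner_integral \<mu> (\<lambda>z. G (X (fst t) \<omega>) z - g (X (fst t) \<omega>)) (g (X (fst t) \<omega>) - g (X (fst t) \<omega>))"
        using G_unbiased[of "X (fst t) \<omega>"] by (simp add: has_bochner_integral_iff \<mu>.prob_space)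
      from has_bochner_integral_bounded_linear[OF lin this]
      have "(\<integral>z. \<phi> (G (X (fst t) \<omega>) z - g (X (fst t) \<omega>)) \<partial>\<mu>) = 0"
        using bounded_linear.linear[OF lin] by (simp add: has_bochner_integral_iff linear_0)
      then show "(\<integral>z. h \<omega> z \<partial>\<mu>) = 0" by (simp add: h_def)
    qed
    finally show ?thesis by simp
  qed
  show "(\<integral>\<omega>. \<phi> (noise t \<omega>) * \<phi> (noise u \<omega>) \<partial>P) = 0"
    using zero[OF t u] zero[OF u t] tu by (cases "fst u \<le> fst t") (auto simp: mult.commute)
qed

text \<open>Cross terms vanish by \<open>noise_orthogonal\<close>, so second moments add up with
  squared weights. Sums of squares of linear functionals are the form in which this works, and
  squared row norms in a fixed basis have that form.\<close>

lemma weighted_noise_second_moment: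
  fixes \<phi> :: "'c \<Rightarrow> 'x \<Rightarrow> real"
  assumes C: "finite C" and lin: "\<And>c. c \<in> C \<Longrightarrow> bounded_linear (\<phi> c)"
    and int: "\<And>Y. integrable \<mu> (\<lambda>z. \<Sum>c\<in>C. (\<phi> c (G Y z - g Y))\<^sup>2)"
    and le: "\<And>Y. (\<integral>z. (\<Sum>c\<in>C. (\<phi> c (G Y z - g Y))\<^sup>2) \<partial>\<mu>) \<le> v"
    and U: "finite U" "U \<subseteq> T"
  shows "integrable P (\<lambda>\<omega>. \<Sum>c\<in>C. (\<phi> c (\<Sum>t\<in>U. w t *\<^sub>R noise t \<omega>))\<^sup>2)"
    "(\<integral>\<omega>. (\<Sum>c\<in>C. (\<phi> c (\<Sum>t\<in>U. w t *\<^sub>R noise t \<omega>))\<^sup>2) \<partial>P) \<le> (\<Sum>t\<in>U. (w t)\<^sup>2) * v"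
proof -
  note second = noise_second_moment[OF _ lin int le]
  have sq: "integrable P (\<lambda>\<omega>. (\<phi> c (noise t \<omega>))\<^sup>2)" if "c \<in> C" "t \<in> T" for c t
  proof (rule Bochner_Integration.integrable_bound[OF second(1)[OF that(2)]])
    have "\<phi> c \<in> borel_measurable borel"
      using lin[OF that(1)] by (intro borel_measurable_continuous_onI linear_continuous_on)
    from measurable_compose[OF noise_meas[OF that(2)] this]
    show "(\<lambda>\<omega>. (\<phi> c (noise t \<omega>))\<^sup>2) \<in> borel_measurable P" by simp
    show "AE \<omega> in P. norm ((\<phi> c (noise t \<omega>))\<^sup>2) \<le> norm (\<Sum>c\<in>C. (\<phi> c (noise t \<omega>))\<^sup>2)"
      using that C by (auto intro!: AE_I2 order_trans[OF _ abs_ge_self] member_le_sum)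
  qed auto
  have expand: "(\<phi> c (\<Sum>t\<in>U. w t *\<^sub>R noise t \<omega>))\<^sup>2 =
      (\<Sum>t\<in>U. \<Sum>u\<in>U. w t * w u * (\<phi> c (noise t \<omega>) * \<phi> c (noise u \<omega>)))" if "c \<in> C" for c \<omega>
  proof -
    have l: "linear (\<phi> c)" using lin[OF that] by (rule bounded_linear.linear)
    show ?thesis
      by (simp add: linear_sum[OF l] linear_cmul[OF l] power2_eq_square sum_product mult_ac)
  qed
  have cross: "integrable P (\<lambda>\<omega>. \<phi> c (noise t \<omega>) * \<phi> c (noise u \<omega>))"
    "(\<integral>\<omega>. \<phi> c (noise t \<omega>) * \<phi> c (noise u \<omega>) \<partial>P) = (if u = t then \<integral>\<omega>. (\<phi> c (noise t \<omega>))\<^sup>2 \<partial>P else 0)"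
    if "c \<in> C" "t \<in> U" "u \<in> U" for c t u
    using noise_orthogonal[of t u "\<phi> c"] sq[OF that(1)] lin[OF that(1)] that U
    by (cases "u = t"; force simp: power2_eq_square)+
  show "integrable P (\<lambda>\<omega>. \<Sum>c\<in>C. (\<phi> c (\<Sum>t\<in>U. w t *\<^sub>R noise t \<omega>))\<^sup>2)"
    using cross(1) by (auto simp: expand intro!: Bochner_Integration.integrable_sum)
  have "(\<integral>\<omega>. (\<Sum>c\<in>C. (\<phi> c (\<Sum>t\<in>U. w t *\<^sub>R noise t \<omega>))\<^sup>2) \<partial>P) =
      (\<Sum>c\<in>C. \<Sum>t\<in>U. \<Sum>u\<in>U. w t * w u * (\<integral>\<omega>. \<phi> c (noise t \<omega>) * \<phi> c (noise u \<omega>) \<partial>P))"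
    using cross(1) by (simp add: expand Bochner_Integration.integral_sum Bochner_Integration.integrable_sum)
  also have "\<dots> = (\<Sum>c\<in>C. \<Sum>t\<in>U. (w t)\<^sup>2 * (\<integral>\<omega>. (\<phi> c (noise t \<omega>))\<^sup>2 \<partial>P))"
  proof (intro sum.cong[OF refl])
    fix c t assume ct: "c \<in> C" "t \<in> U"
    have "(\<Sum>u\<in>U. w t * w u * (\<integral>\<omega>. \<phi> c (noise t \<omega>) * \<phi> c (noise u \<omega>) \<partial>P)) =
        (\<Sum>u\<in>U. if u = t then (w t)\<^sup>2 * (\<integral>\<omega>. (\<phi> c (noise t \<omega>))\<^sup>2 \<partial>P) else 0)"
      using cross(2)[OF ct] by (intro sum.cong[OF refl]) (auto simp: power2_eq_square[of "w t"])
    then show "(\<Sum>u\<in>U. w t * w u * (\<integral>\<omega>. \<phi> c (noise t \<omega>) * \<phi> c (noise u \<omega>) \<partial>P)) =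
        (w t)\<^sup>2 * (\<integral>\<omega>. (\<phi> c (noise t \<omega>))\<^sup>2 \<partial>P)"
      using U ct by simp
  qed
  also have "\<dots> = (\<Sum>t\<in>U. (w t)\<^sup>2 * (\<Sum>c\<in>C. \<integral>\<omega>. (\<phi> c (noise t \<omega>))\<^sup>2 \<partial>P))"
    unfolding sum_distrib_left by (rule sum.swap)
  also have "\<dots> = (\<Sum>t\<in>U. (w t)\<^sup>2 * (\<integral>\<omega>. (\<Sum>c\<in>C. (\<phi> c (noise t \<omega>))\<^sup>2) \<partial>P))"
    using sq U by (intro sum.cong[OF refl], subst Bochner_Integration.integral_sum) auto
  also have "\<dots> \<le> (\<Sum>t\<in>U. (w t)\<^sup>2 * v)"
    using second(2) U by (intro sum_mono mult_left_mono) auto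
  finally show "(\<integral>\<omega>. (\<Sum>c\<in>C. (\<phi> c (\<Sum>t\<in>U. w t *\<^sub>R noise t \<omega>))\<^sup>2) \<partial>P) \<le> (\<Sum>t\<in>U. (w t)\<^sup>2) * v"
    by (simp add: sum_distrib_right)
qed

section \<open>The noise in the momentum\<close>

lemma batch_noise:
  "batch_gradient G B \<zeta> X k \<omega> - g (X k \<omega>) = (\<Sum>i=1..B. (1 / real B) *\<^sub>R noise (k, i) \<omega>)"
proof -
  have "(\<Sum>i=1..B. (1 / real B) *\<^sub>R noise (k, i) \<omega>) =
      batch_gradient G B \<zeta> X k \<omega> - (\<Sum>i=1..B. (1 / real B) *\<^sub>R g (X k \<omega>))"
    by (simp add: batch_gradient_def noise_def scaleR_sum_right scaleR_diff_right sum_subtractf)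
  then show ?thesis using batch_pos by (simp add: sum_constant_scaleR)
qed

fun noise_average :: "real \<Rightarrow> nat \<Rightarrow> 'w \<Rightarrow> 'x" where
  "noise_average \<theta> 0 \<omega> = batch_gradient G B \<zeta> X 0 \<omega> - g (X 0 \<omega>)"
| "noise_average \<theta> (Suc k) \<omega> = (1 - \<theta>) *\<^sub>R noise_average \<theta> k \<omega> +
     \<theta> *\<^sub>R (batch_gradient G B \<zeta> X (Suc k) \<omega> - g (X (Suc k) \<omega>))"

text \<open>Coefficient of batch \<open>s\<close> in the exponential average after \<open>k\<close>
  steps, meant for \<open>s \<le> k\<close>. Batch 0 lacks the factor \<theta> because the momentum
  starts with the whole first batch gradient.\<close>

definition weight :: "real \<Rightarrow> nat \<Rightarrow> nat \<Rightarrow> real" where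
  "weight \<theta> k s = (if s = 0 then (1 - \<theta>) ^ k else \<theta> * (1 - \<theta>) ^ (k - s))"

lemma weight_Suc: "s \<le> k \<Longrightarrow> weight \<theta> (Suc k) s = (1 - \<theta>) * weight \<theta> k s"
  by (simp add: weight_def Suc_diff_le)

lemma noise_average_eq:
  "noise_average \<theta> k \<omega> = (\<Sum>t\<in>{..k} \<times> {1..B}. (weight \<theta> k (fst t) / real B) *\<^sub>R noise t \<omega>)"
proof -
  have "noise_average \<theta> k \<omega> = (\<Sum>s\<le>k. \<Sum>i=1..B. (weight \<theta> k s / real B) *\<^sub>R noise (s, i) \<omega>)"
  proof (induction k)
    case 0
    then show ?case by (simp add: batch_noise weight_def)
  next
    case (Suc k)
    have "(1 - \<theta>) *\<^sub>R noise_average \<theta> k \<omega> = (\<Sum>s\<le>k. \<Sum>i=1..B. (weight \<theta> (Suc k) s / real B) *\<^sub>R noise (s, i) \<omega>)"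
      unfolding Suc by (simp add: scaleR_sum_right weight_Suc)
    moreover have "\<theta> *\<^sub>R (\<Sum>i=1..B. (1 / real B) *\<^sub>R noise (Suc k, i) \<omega>) =
        (\<Sum>i=1..B. (weight \<theta> (Suc k) (Suc k) / real B) *\<^sub>R noise (Suc k, i) \<omega>)"
      by (simp add: scaleR_sum_right weight_def)
    ultimately show ?case by (simp only: noise_average.simps batch_noise sum.atMost_Suc)
  qed
  then show ?thesis by (simp add: sum.cartesian_product case_prod_beta)
qed

definition variance_factor :: "real \<Rightarrow> nat \<Rightarrow> real" where
  "variance_factor \<theta> k = (\<Sum>s\<le>k. (weight \<theta> k s)\<^sup>2)"

lemma variance_factor_nonneg: "0 \<le> variance_factor \<theta> k"
  by (simp add: variance_factor_def sum_nonneg)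

text \<open>The recursion multiplies by \<open>(1 - \<theta>)\<^sup>2\<close> and adds
  \<open>\<theta>\<^sup>2\<close>. As \<open>(1 - \<theta>)\<^sup>2 + \<theta> \<le> 1\<close>, each
  step pays for \<theta> times the current factor, and the sum telescopes from the initial factor 1,
  the source of \<open>1 / \<theta>\<close>.\<close>

lemma variance_factor_sum_le:
  assumes "0 < \<theta>" "\<theta> \<le> 1"
  shows "(\<Sum>k<K. variance_factor \<theta> k) \<le> 1 / \<theta> + \<theta> * real K"
proof -
  have Suc: "variance_factor \<theta> (Suc k) = (1 - \<theta>)\<^sup>2 * variance_factor \<theta> k + \<theta>\<^sup>2" for k
  proof -
    have "variance_factor \<theta> (Suc k) = (\<Sum>s\<le>k. (weight \<theta> (Suc k) s)\<^sup>2) + \<theta>\<^sup>2"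
      by (simp add: variance_factor_def weight_def)
    also have "(\<Sum>s\<le>k. (weight \<theta> (Suc k) s)\<^sup>2) = (1 - \<theta>)\<^sup>2 * variance_factor \<theta> k"
      by (simp add: variance_factor_def weight_Suc power_mult_distrib sum_distrib_left)
    finally show ?thesis .
  qed
  have "\<theta> * (\<Sum>k<K. variance_factor \<theta> k) + variance_factor \<theta> K \<le> 1 + \<theta>\<^sup>2 * real K"
  proof (induction K)
    case 0
    then show ?case by (simp add: variance_factor_def weight_def)
  next
    case (Suc K)
    have "\<theta> * \<theta> \<le> \<theta> * 1" using assms by (intro mult_left_mono) auto
    then have "((1 - \<theta>)\<^sup>2 + \<theta>) * variance_factor \<theta> K \<le> 1 * variance_factor \<theta> K"
      using assms by (intro mult_right_mono variance_factor_nonneg) (simp add: power2_eq_square algebra_simps)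
    then show ?case using Suc \<open>\<And>k. variance_factor \<theta> (Suc k) = _\<close>[of K] by (simp add: algebra_simps)
  qed
  then have "\<theta> * (\<Sum>k<K. variance_factor \<theta> k) \<le> \<theta> * (1 / \<theta> + \<theta> * real K)"
    using variance_factor_nonneg[of \<theta> K] assms by (simp add: power2_eq_square algebra_simps)
  then show ?thesis using assms by simp
qed

lemma noise_average_second_moment:
  fixes \<phi> :: "'c \<Rightarrow> 'x \<Rightarrow> real"
  assumes "finite C" "\<And>c. c \<in> C \<Longrightarrow> bounded_linear (\<phi> c)"
    and "\<And>Y. integrable \<mu> (\<lambda>z. \<Sum>c\<in>C. (\<phi> c (G Y z - g Y))\<^sup>2)"
    and "\<And>Y. (\<integral>z. (\<Sum>c\<in>C. (\<phi> c (G Y z - g Y))\<^sup>2) \<partial>\<mu>) \<le> v"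
  shows "integrable P (\<lambda>\<omega>. \<Sum>c\<in>C. (\<phi> c (noise_average \<theta> k \<omega>))\<^sup>2)"
    "(\<integral>\<omega>. (\<Sum>c\<in>C. (\<phi> c (noise_average \<theta> k \<omega>))\<^sup>2) \<partial>P) \<le> variance_factor \<theta> k / real B * v"
proof -
  have U: "finite ({..k} \<times> {1..B})" "{..k} \<times> {1..B} \<subseteq> T" by auto
  have "(\<Sum>t\<in>{..k} \<times> {1..B}. (weight \<theta> k (fst t) / real B)\<^sup>2) = (\<Sum>s\<le>k. \<Sum>i=1..B. (weight \<theta> k s / real B)\<^sup>2)"
    by (simp only: sum.cartesian_product split_def)
  \<comment> \<open>Each batch contributes \<open>B\<close> samples whose squared weights carry
    \<open>1 / B\<^sup>2\<close>; this is the gain from batching.\<close>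
  also have "\<dots> = variance_factor \<theta> k / real B"
    using batch_pos by (simp add: variance_factor_def power_divide sum_divide_distrib power2_eq_square)
  finally have w: "(\<Sum>t\<in>{..k} \<times> {1..B}. (weight \<theta> k (fst t) / real B)\<^sup>2) = variance_factor \<theta> k / real B" .
  note * = weighted_noise_second_moment[OF assms U, where w = "\<lambda>t. weight \<theta> k (fst t) / real B"]
  show "integrable P (\<lambda>\<omega>. \<Sum>c\<in>C. (\<phi> c (noise_average \<theta> k \<omega>))\<^sup>2)"
    unfolding noise_average_eq by (rule *(1))
  show "(\<integral>\<omega>. (\<Sum>c\<in>C. (\<phi> c (noise_average \<theta> k \<omega>))\<^sup>2) \<partial>P) \<le> variance_factor \<theta> k / real B * v"
    using *(2) unfolding noise_average_eq w .
qed

lemma noise_average_meas: "noise_average \<theta> k \<in> borel_measurable P"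
proof -
  have "(\<lambda>\<omega>. \<Sum>t\<in>{..k} \<times> {1..B}. (weight \<theta> k (fst t) / real B) *\<^sub>R noise t \<omega>) \<in> borel_measurable P"
    by (intro borel_measurable_sum borel_measurable_scaleR noise_meas) auto
  then show ?thesis by (simp add: noise_average_eq[abs_def])
qed

end

section \<open>The mixed norms\<close>

lemma block_space_blk:
  assumes space: "block_space J m n blk" and j: "j \<in> {1..J}"
  shows "blk X j \<in> carrier_mat (m j) (n j)"
    "blk (X + Y) j = blk X j + blk Y j" "blk (c *\<^sub>R X) j = c \<cdot>\<^sub>m blk X j"
    "blk (X - Y) j = blk X j - blk Y j"
proof -
  have "(\<lambda>j\<in>{1..J}. blk X j) \<in> (\<Pi>\<^sub>E j\<in>{1..J}. carrier_mat (m j) (n j))" for X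
    using space unfolding block_space_def bij_betw_def by blast
  from PiE_mem[OF this j] have c: "blk X j \<in> carrier_mat (m j) (n j)" for X
    using j by simp
  then show "blk X j \<in> carrier_mat (m j) (n j)" .
  show add: "blk (X + Y) j = blk X j + blk Y j" for X Y
    using space j unfolding block_space_def by blast
  show sc: "blk (c *\<^sub>R X) j = c \<cdot>\<^sub>m blk X j" for c X
    using space j unfolding block_space_def by blast
  have "X - Y = X + (- 1) *\<^sub>R Y" by simp
  then have "blk (X - Y) j = blk X j + (- 1) \<cdot>\<^sub>m blk Y j" by (simp only: add sc)
  also have "\<dots> = blk X j - blk Y j" using c[of X] c[of Y] by (intro eq_matI) auto
  finally show "blk (X - Y) j = blk X j - blk Y j" .
qed

lemma block_space_surj:
  assumes space: "block_space J m n blk" and C: "\<And>j. j \<in> {1..J} \<Longrightarrow> C j \<in> carrier_mat (m j) (n j)"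
  obtains Y where "\<And>j. j \<in> {1..J} \<Longrightarrow> blk Y j = C j"
proof -
  have "(\<lambda>j\<in>{1..J}. C j) \<in> (\<Pi>\<^sub>E j\<in>{1..J}. carrier_mat (m j) (n j))" using C by auto
  then obtain Y where "(\<lambda>j\<in>{1..J}. C j) = (\<lambda>j\<in>{1..J}. blk Y j)"
    using space unfolding block_space_def bij_betw_def by blast
  from fun_cong[OF this] have "blk Y j = C j" if "j \<in> {1..J}" for j
    using that by (metis restrict_apply')
  then show ?thesis using that by blast
qed

lemma block_space_index_linear:
  assumes space: "block_space J m n blk" and "j \<in> {1..J}" "i < m j" "c < n j"
  shows "bounded_linear (\<lambda>X. blk X j $$ (i, c))"
  unfolding linear_conv_bounded_linear[symmetric]
  using block_space_blk[OF assms(1,2)] assms(3,4)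
  by (intro linearI) (auto simp: carrier_matD[OF block_space_blk(1)[OF assms(1,2)]])

text \<open>Duality holds in two layers, Schatten norms within the blocks and ell norms across them;
  the factors \<open>L j powr (1 / 2)\<close> and \<open>L j powr (- 1 / 2)\<close> cancel in the
  pairing.\<close>

lemma block_space_dual_norm_pair:
  fixes blk :: "'x::euclidean_space \<Rightarrow> nat \<Rightarrow> real mat"
  assumes space: "block_space J m n blk"
    and L: "\<And>j. j \<in> {1..J} \<Longrightarrow> 0 < L j"
    and exps: "2 \<le> \<alpha>" "\<beta> \<le> 2" "conjugate_exponents \<alpha> \<beta>"
    and block_exps: "\<And>j. j \<in> {1..J} \<Longrightarrow> 2 \<le> p j \<and> q j \<le> 2 \<and> conjugate_exponents (p j) (q j)"
  shows "dual_norm_pair (wp_norm J blk L p \<alpha>) (vq_norm J blk L q \<beta>)"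
proof
  let ?w = "\<lambda>X j. L j powr (1 / 2) * schatten_norm (p j) (blk X j)"
  let ?v = "\<lambda>X j. L j powr (- 1 / 2) * schatten_norm (q j) (blk X j)"
  have wp: "wp_norm J blk L p \<alpha> X = ell_norm \<alpha> {# ?w X j. j \<in># mset_set {1..J} #}" for X
    by (simp add: wp_norm_def mixed_norm_def)
  have vq: "vq_norm J blk L q \<beta> X = ell_norm \<beta> {# ?v X j. j \<in># mset_set {1..J} #}" for X
    by (simp add: vq_norm_def mixed_norm_def)
  have LL: "L j powr (1 / 2) * L j powr (- 1 / 2) = 1" if "j \<in> {1..J}" for j
    using L[OF that] by (simp add: powr_add[symmetric])
  have \<alpha>1: "1 \<le> \<alpha>" and p1: "j \<in> {1..J} \<Longrightarrow> 1 \<le> p j" for j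
    using exps block_exps by (auto simp: conjugate_exponents_def)
  have inner: "inner X Y = (\<Sum>j=1..J. mat_inner (blk X j) (blk Y j))" for X Y
    using space unfolding block_space_def by blast
  show "0 \<le> wp_norm J blk L p \<alpha> X" "0 \<le> vq_norm J blk L q \<beta> X" for X
    by (simp_all add: wp vq ell_norm_nonneg)
  show "wp_norm J blk L p \<alpha> (c *\<^sub>R X) = \<bar>c\<bar> * wp_norm J blk L p \<alpha> X" for c X
  proof -
    have "?w (c *\<^sub>R X) j = \<bar>c\<bar> * ?w X j" if "j \<in> {1..J}" for j
      using schatten_norm_smult[OF block_space_blk(1)[OF space that] p1[OF that]]
      by (simp add: block_space_blk(3)[OF space that])
    then have "wp_norm J blk L p \<alpha> (c *\<^sub>R X) = ell_norm \<alpha> {# \<bar>c\<bar> * ?w X j. j \<in># mset_set {1..J} #}"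
      unfolding wp by (rule ell_norm_cong)
    then show ?thesis using ell_norm_scale[of "{1..J}" \<alpha> "\<bar>c\<bar>" "?w X"] \<alpha>1 by (simp add: wp)
  qed
  show "inner U Y \<le> vq_norm J blk L q \<beta> U * wp_norm J blk L p \<alpha> Y" for U Y
  proof -
    have "inner U Y \<le> (\<Sum>j=1..J. \<bar>?v U j * ?w Y j\<bar>)"
      unfolding inner
    proof (rule sum_mono)
      fix j assume j: "j \<in> {1..J}"
      have "mat_inner (blk U j) (blk Y j) \<le> schatten_norm (q j) (blk U j) * schatten_norm (p j) (blk Y j)"
        using schatten_norm_Holder[of "p j" "q j" "blk U j" "m j" "n j" "blk Y j"]
          block_exps[OF j] block_space_blk(1)[OF space j] by force
      also have "\<dots> = (L j powr (1 / 2) * L j powr (- 1 / 2)) *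
          (schatten_norm (q j) (blk U j) * schatten_norm (p j) (blk Y j))"
        by (simp only: LL[OF j] mult_1_left)
      also have "\<dots> = ?v U j * ?w Y j" by (simp only: mult_ac)
      finally show "mat_inner (blk U j) (blk Y j) \<le> \<bar>?v U j * ?w Y j\<bar>" by linarith
    qed
    also have "\<dots> \<le> vq_norm J blk L q \<beta> U * wp_norm J blk L p \<alpha> Y"
      unfolding vq wp using exps by (intro ell_norm_Holder) auto
    finally show ?thesis .
  qed
  show "\<exists>Y. wp_norm J blk L p \<alpha> Y \<le> 1 \<and> vq_norm J blk L q \<beta> U \<le> inner U Y" for U
  proof -
    have "\<forall>j\<in>{1..J}. \<exists>C. C \<in> carrier_mat (m j) (n j) \<and>
        mat_inner (blk U j) C = schatten_norm (q j) (blk U j) \<and> schatten_norm (p j) C \<le> 1"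
    proof
      fix j assume j: "j \<in> {1..J}"
      show "\<exists>C. C \<in> carrier_mat (m j) (n j) \<and>
          mat_inner (blk U j) C = schatten_norm (q j) (blk U j) \<and> schatten_norm (p j) C \<le> 1"
        using schatten_norm_dual_attained[of "p j" "q j" "blk U j" "m j" "n j"]
          block_exps[OF j] block_space_blk(1)[OF space j, of U] by blast
    qed
    then obtain C where C: "\<And>j. j \<in> {1..J} \<Longrightarrow> C j \<in> carrier_mat (m j) (n j)"
      "\<And>j. j \<in> {1..J} \<Longrightarrow> mat_inner (blk U j) (C j) = schatten_norm (q j) (blk U j)"
      "\<And>j. j \<in> {1..J} \<Longrightarrow> schatten_norm (p j) (C j) \<le> 1" by metis
    obtain c where c: "\<And>j. j \<in> {1..J} \<Longrightarrow> 0 \<le> c j"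
      "(\<Sum>j=1..J. c j * ?v U j) = ell_norm \<beta> {# ?v U j. j \<in># mset_set {1..J} #}"
      "ell_norm \<alpha> {# c j. j \<in># mset_set {1..J} #} \<le> 1"
    proof (rule ell_norm_dual_attained[of \<alpha> \<beta> "{1..J}" "?v U"])
      show "0 \<le> ?v U j" for j by (simp add: schatten_norm_nonneg)
    qed (use exps in auto)
    \<comment> \<open>The dual maximizer: \<open>C j\<close> is extremal in block \<open>j\<close>,
      \<open>c j\<close> distributes the lengths over the blocks, and
      \<open>L j powr (- 1 / 2)\<close> undoes the weight in \<open>wp_norm\<close>.\<close>
    obtain Y where Y: "\<And>j. j \<in> {1..J} \<Longrightarrow> blk Y j = (c j * L j powr (- 1 / 2)) \<cdot>\<^sub>m C j"
      using block_space_surj[OF space, of "\<lambda>j. (c j * L j powr (- 1 / 2)) \<cdot>\<^sub>m C j"] C(1) by auto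
    have "\<bar>?w Y j\<bar> \<le> \<bar>c j\<bar>" if j: "j \<in> {1..J}" for j
    proof -
      have "?w Y j = (L j powr (1 / 2) * L j powr (- 1 / 2)) * (c j * schatten_norm (p j) (C j))"
        unfolding Y[OF j] schatten_norm_smult[OF C(1)[OF j] p1[OF j]] using c(1)[OF j] by (simp add: abs_mult mult_ac)
      also have "\<dots> = c j * schatten_norm (p j) (C j)" by (simp only: LL[OF j] mult_1_left)
      finally show ?thesis
        using C(3)[OF j] c(1)[OF j] by (simp add: schatten_norm_nonneg mult_left_le)
    qed
    then have "wp_norm J blk L p \<alpha> Y \<le> ell_norm \<alpha> {# c j. j \<in># mset_set {1..J} #}"
      unfolding wp using \<alpha>1 by (intro ell_norm_mono) auto
    moreover have "inner U Y = vq_norm J blk L q \<beta> U"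
    proof -
      have "mat_inner (blk U j) (blk Y j) = c j * ?v U j" if j: "j \<in> {1..J}" for j
      proof -
        note cm = block_space_blk(1)[OF space j, of U] C(1)[OF j]
        have "mat_inner (blk U j) (blk Y j) = c j * L j powr (- 1 / 2) * mat_inner (blk U j) (C j)"
          unfolding Y[OF j] mat_inner_eq_sum[OF cm] mat_inner_eq_sum[OF cm(1) smult_carrier_mat[OF cm(2)]]
          using cm(2) by (auto simp: sum_distrib_left mult_ac intro!: sum.cong)
        then show ?thesis using C(2)[OF j] by simp
      qed
      then show ?thesis using c(2) by (simp add: inner vq)
    qed
    ultimately show ?thesis using c(3) by (intro exI[of _ Y]) auto
  qed
qed

section \<open>Covariance bounds and the dual norm of the noise\<close>

lemma scalar_prod_mult_mat_vec:
  fixes A :: "real mat"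
  assumes "A \<in> carrier_mat d d"
  shows "scalar_prod (Matrix.vec d w) (A *\<^sub>v Matrix.vec d w) = (\<Sum>i<d. \<Sum>k<d. w i * w k * A $$ (i, k))"
  using assms by (auto simp: scalar_prod_def lessThan_atLeast0 sum_distrib_left mult_ac intro!: sum.cong)

lemma loewner_le_quadratic_form:
  assumes "loewner_le d A1 A2"
  shows "(\<Sum>i<d. \<Sum>k<d. w i * w k * A1 $$ (i, k)) \<le> (\<Sum>i<d. \<Sum>k<d. w i * w k * A2 $$ (i, k))"
proof -
  have A: "A1 \<in> carrier_mat d d" "A2 \<in> carrier_mat d d" "A2 - A1 \<in> carrier_mat d d"
    and "0 \<le> scalar_prod (Matrix.vec d w) ((A2 - A1) *\<^sub>v Matrix.vec d w)"
    using assms by (auto simp: loewner_le_def pos_semidef_def)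
  then have "0 \<le> (\<Sum>i<d. \<Sum>k<d. w i * w k * (A2 - A1) $$ (i, k))"
    by (simp only: scalar_prod_mult_mat_vec)
  also have "\<dots> = (\<Sum>i<d. \<Sum>k<d. w i * w k * A2 $$ (i, k) - w i * w k * A1 $$ (i, k))"
    using A(1,2) by (intro sum.cong refl) (auto simp: algebra_simps)
  finally show ?thesis by (simp add: sum_subtractf)
qed

text \<open>Two forms of one quantity: as a sum of squares of linear functionals of \<open>A\<close>
  it can use the orthogonality of the noise; as a quadratic form in the entries of
  \<open>A A^T\<close> it can be compared through the Loewner order.\<close>

lemma row_norm_square_transpose_mult:
  assumes W: "W \<in> carrier_mat m m" and A: "A \<in> carrier_mat m n" and l: "l < m"
  shows "(row_norm (transpose_mat W * A) l)\<^sup>2 = (\<Sum>c<n. (\<Sum>i<m. W $$ (i, l) * A $$ (i, c))\<^sup>2)" (is ?A)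
    "(row_norm (transpose_mat W * A) l)\<^sup>2 =
       (\<Sum>i<m. \<Sum>k<m. W $$ (i, l) * W $$ (k, l) * (A * transpose_mat A) $$ (i, k))" (is ?B)
proof -
  have "(transpose_mat W * A) $$ (l, c) = (\<Sum>i<m. W $$ (i, l) * A $$ (i, c))" if "c < n" for c
    using that W A l by (subst index_mult_mat_sum[of _ m m _ n]) (auto intro!: sum.cong)
  then show ?A unfolding row_norm_square using A by (auto simp del: index_mult_mat(1) intro!: sum.cong)
  also have "\<dots> = (\<Sum>c<n. \<Sum>i<m. \<Sum>k<m. W $$ (i, l) * W $$ (k, l) * (A $$ (i, c) * A $$ (k, c)))"
    by (simp add: power2_eq_square sum_product mult_ac)
  also have "\<dots> = (\<Sum>i<m. \<Sum>k<m. \<Sum>c<n. W $$ (i, l) * W $$ (k, l) * (A $$ (i, c) * A $$ (k, c)))"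
    by (rule sum_rotate)
  also have "\<dots> = (\<Sum>i<m. \<Sum>k<m. W $$ (i, l) * W $$ (k, l) * (A * transpose_mat A) $$ (i, k))"
    by (intro sum.cong refl)
      (simp add: mult_transpose_index[OF A A] sum_distrib_left del: index_mult_mat(1))
  finally show ?B .
qed

text \<open>In the eigenbasis \<open>W j\<close> of \<open>V j (V j)\<^sup>T\<close> the vector of row norms of \<open>(W j)\<^sup>T N\<close> dominates the
  Schatten norm of the noise \<open>N\<close>, while its entries have second moments at most the squared
  singular values of \<open>V j\<close>.\<close>

lemma (in adaptive_sampling) vq_norm_noise_average:
  fixes blk :: "'x \<Rightarrow> nat \<Rightarrow> real mat"
  assumes space: "block_space J m n blk"
    and exps: "1 \<le> \<beta>" "\<beta> \<le> 2" "\<And>j. j \<in> {1..J} \<Longrightarrow> 1 \<le> q j \<and> q j \<le> 2"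
    and V: "\<And>j. j \<in> {1..J} \<Longrightarrow> V j \<in> carrier_mat (m j) (m j)"
    and variance: "\<And>Y j. j \<in> {1..J} \<Longrightarrow> \<exists>C. has_mat_expectation \<mu> (m j) (m j)
          (\<lambda>z. (blk (G Y z) j - blk (g Y) j) * transpose_mat (blk (G Y z) j - blk (g Y) j)) C \<and>
        loewner_le (m j) C (V j * transpose_mat (V j))"
    and meas: "vq_norm J blk L q \<beta> \<in> borel_measurable borel"
    and \<sigma>: "\<sigma> = 1 / sqrt (real B) *
        ell_norm \<beta> {# L j powr (- 1 / 2) * schatten_norm (q j) (V j). j \<in># mset_set {1..J} #}"
  shows "integrable P (\<lambda>\<omega>. (vq_norm J blk L q \<beta> (noise_average \<theta> k \<omega>))\<^sup>2)"
    "(\<integral>\<omega>. (vq_norm J blk L q \<beta> (noise_average \<theta> k \<omega>))\<^sup>2 \<partial>P) \<le> variance_factor \<theta> k * \<sigma>\<^sup>2"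
proof -
  let ?N = "noise_average \<theta> k"
  \<comment> \<open>Scale of the averaged noise relative to a single sample: every second moment
    bound for one sample gets multiplied by \<open>\<tau>\<^sup>2\<close>.\<close>
  define \<tau> where "\<tau> = sqrt (variance_factor \<theta> k / real B)"
  have \<tau>: "0 \<le> \<tau>" "\<tau>\<^sup>2 = variance_factor \<theta> k / real B"
    by (simp_all add: \<tau>_def variance_factor_nonneg)
  have "\<forall>j\<in>{1..J}. \<exists>W. orthogonal_mat_dim (m j) W \<and>
      (\<forall>r. schatten_norm r (V j) = ell_norm r {# row_norm (transpose_mat W * V j) i. i \<in># mset_set {..<m j} #})"
    using schatten_norm_eq_row_norms[OF V] by metis
  then obtain W where W: "\<And>j. j \<in> {1..J} \<Longrightarrow> orthogonal_mat_dim (m j) (W j)"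
    "\<And>j r. j \<in> {1..J} \<Longrightarrow>
      schatten_norm r (V j) = ell_norm r {# row_norm (transpose_mat (W j) * V j) i. i \<in># mset_set {..<m j} #}"
    by metis
  define \<phi> where "\<phi> = (\<lambda>j l c U. \<Sum>i<m j. W j $$ (i, l) * blk U j $$ (i, c))"
  define x where "x = (\<lambda>j l \<omega>. row_norm (transpose_mat (W j) * blk (?N \<omega>) j) l)"
  have lin: "bounded_linear (\<phi> j l c)" if "j \<in> {1..J}" "c < n j" for j l c
    unfolding \<phi>_def using block_space_index_linear[OF space that(1) _ that(2)]
    by (intro bounded_linear_sum bounded_linear_const_mult) auto
  have row: "(row_norm (transpose_mat (W j) * blk U j) l)\<^sup>2 = (\<Sum>c<n j. (\<phi> j l c U)\<^sup>2)"
    if "j \<in> {1..J}" "l < m j" for j l U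
    using row_norm_square_transpose_mult(1)[OF orthogonal_mat_dimD(1)[OF W(1)[OF that(1)]]
        block_space_blk(1)[OF space that(1)] that(2)] by (simp add: \<phi>_def)
  have var: "integrable \<mu> (\<lambda>z. \<Sum>c<n j. (\<phi> j l c (G Y z - g Y))\<^sup>2)"
    "(\<integral>z. (\<Sum>c<n j. (\<phi> j l c (G Y z - g Y))\<^sup>2) \<partial>\<mu>) \<le> (row_norm (transpose_mat (W j) * V j) l)\<^sup>2"
    if j: "j \<in> {1..J}" and l: "l < m j" for j l Y
  proof -
    note Wc = orthogonal_mat_dimD(1)[OF W(1)[OF j]]
    obtain C where C: "has_mat_expectation \<mu> (m j) (m j)
          (\<lambda>z. (blk (G Y z) j - blk (g Y) j) * transpose_mat (blk (G Y z) j - blk (g Y) j)) C"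
        "loewner_le (m j) C (V j * transpose_mat (V j))"
      using variance[OF j] by blast
    let ?D = "\<lambda>z. blk (G Y z) j - blk (g Y) j"
    have eq: "(\<lambda>z. \<Sum>c<n j. (\<phi> j l c (G Y z - g Y))\<^sup>2) =
        (\<lambda>z. \<Sum>i<m j. \<Sum>k<m j. W j $$ (i, l) * W j $$ (k, l) * (?D z * transpose_mat (?D z)) $$ (i, k))"
    proof
      fix z
      show "(\<Sum>c<n j. (\<phi> j l c (G Y z - g Y))\<^sup>2) =
          (\<Sum>i<m j. \<Sum>k<m j. W j $$ (i, l) * W j $$ (k, l) * (?D z * transpose_mat (?D z)) $$ (i, k))"
        using row[OF j l, of "G Y z - g Y"]
          row_norm_square_transpose_mult(2)[OF Wc block_space_blk(1)[OF space j] l, of "G Y z - g Y"]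
        by (simp only: block_space_blk(4)[OF space j])
    qed
    have entries: "has_bochner_integral \<mu> (\<lambda>z. (?D z * transpose_mat (?D z)) $$ (i, k)) (C $$ (i, k))"
      if "i < m j" "k < m j" for i k
      using C(1) that unfolding has_mat_expectation_def by blast
    have "has_bochner_integral \<mu> (\<lambda>z. \<Sum>c<n j. (\<phi> j l c (G Y z - g Y))\<^sup>2)
        (\<Sum>i<m j. \<Sum>k<m j. W j $$ (i, l) * W j $$ (k, l) * C $$ (i, k))"
      unfolding eq using entries by (intro has_bochner_integral_sum has_bochner_integral_mult_right) auto
    moreover have "(\<Sum>i<m j. \<Sum>k<m j. W j $$ (i, l) * W j $$ (k, l) * C $$ (i, k)) \<le>
        (row_norm (transpose_mat (W j) * V j) l)\<^sup>2"
      unfolding row_norm_square_transpose_mult(2)[OF Wc V[OF j] l]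
      by (rule loewner_le_quadratic_form[OF C(2)])
    ultimately show "integrable \<mu> (\<lambda>z. \<Sum>c<n j. (\<phi> j l c (G Y z - g Y))\<^sup>2)"
      "(\<integral>z. (\<Sum>c<n j. (\<phi> j l c (G Y z - g Y))\<^sup>2) \<partial>\<mu>) \<le> (row_norm (transpose_mat (W j) * V j) l)\<^sup>2"
      by (auto simp: has_bochner_integral_iff)
  qed
  have x2: "(x j l \<omega>)\<^sup>2 = (\<Sum>c\<in>{..<n j}. (\<phi> j l c (?N \<omega>))\<^sup>2)" if "j \<in> {1..J}" "l < m j" for j l \<omega>
    using row[OF that] by (simp add: x_def)
  have xm: "x j l \<in> borel_measurable P" if j: "j \<in> {1..J}" and l: "l < m j" for j l
  proof -
    have "x j l = (\<lambda>\<omega>. sqrt (\<Sum>c\<in>{..<n j}. (\<phi> j l c (?N \<omega>))\<^sup>2))"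
      using x2[OF j l] row_norm_nonneg by (auto simp: x_def fun_eq_iff intro!: real_sqrt_unique[symmetric])
    moreover have "(\<lambda>\<omega>. \<phi> j l c (?N \<omega>)) \<in> borel_measurable P" if "c < n j" for c
      using lin[OF j that]
      by (intro measurable_compose[OF noise_average_meas] borel_measurable_continuous_onI linear_continuous_on)
    ultimately show ?thesis by simp
  qed
  have x_moment: "integrable P (\<lambda>\<omega>. (x j l \<omega>)\<^sup>2)"
    "(\<integral>\<omega>. (x j l \<omega>)\<^sup>2 \<partial>P) \<le> (\<tau> * row_norm (transpose_mat (W j) * V j) l)\<^sup>2"
    if j: "j \<in> {1..J}" and l: "l < m j" for j l
    using noise_average_second_moment[of "{..<n j}" "\<phi> j l", OF _ lin[OF j] var[OF j l], where \<theta> = \<theta> and k = k]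
    by (simp_all add: x2[OF j l] power_mult_distrib \<tau>)
  \<comment> \<open>\<open>ell_norm_second_moment_le\<close> is used twice: over the rows of a block
    with exponent \<open>q j\<close>, then over the blocks with exponent \<beta>. The second use
    needs only the second moments that the first one delivers.\<close>
  define y where "y = (\<lambda>j \<omega>. ell_norm (q j) {# x j l \<omega>. l \<in># mset_set {..<m j} #})"
  have y: "y j \<in> borel_measurable P" "integrable P (\<lambda>\<omega>. (y j \<omega>)\<^sup>2)"
    "(\<integral>\<omega>. (y j \<omega>)\<^sup>2 \<partial>P) \<le> (\<tau> * schatten_norm (q j) (V j))\<^sup>2" if j: "j \<in> {1..J}" for j
  proof -
    have "ell_norm (q j) {# \<tau> * row_norm (transpose_mat (W j) * V j) l. l \<in># mset_set {..<m j} #} =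
        \<tau> * schatten_norm (q j) (V j)"
      using exps(3)[OF j] \<tau> by (simp add: ell_norm_scale W(2)[OF j])
    then show "y j \<in> borel_measurable P" "integrable P (\<lambda>\<omega>. (y j \<omega>)\<^sup>2)"
      "(\<integral>\<omega>. (y j \<omega>)\<^sup>2 \<partial>P) \<le> (\<tau> * schatten_norm (q j) (V j))\<^sup>2"
      using ell_norm_second_moment_le[of "{..<m j}" "q j" "\<lambda>l. \<tau> * row_norm (transpose_mat (W j) * V j) l" "x j"]
        exps(3)[OF j] xm[OF j] x_moment[OF j] \<tau>(1)
      by (simp_all add: y_def[abs_def] row_norm_nonneg)
  qed
  define z where "z = (\<lambda>j \<omega>. L j powr (- 1 / 2) * y j \<omega>)"
  let ?v = "\<lambda>j. L j powr (- 1 / 2) * schatten_norm (q j) (V j)"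
  have z: "z j \<in> borel_measurable P" "integrable P (\<lambda>\<omega>. (z j \<omega>)\<^sup>2)"
    "(\<integral>\<omega>. (z j \<omega>)\<^sup>2 \<partial>P) \<le> (\<tau> * ?v j)\<^sup>2" if j: "j \<in> {1..J}" for j
  proof -
    show "z j \<in> borel_measurable P" using y(1)[OF j] by (simp add: z_def[abs_def])
    show "integrable P (\<lambda>\<omega>. (z j \<omega>)\<^sup>2)" using y(2)[OF j] by (simp add: z_def power_mult_distrib)
    have "(\<integral>\<omega>. (z j \<omega>)\<^sup>2 \<partial>P) = (L j powr (- 1 / 2))\<^sup>2 * (\<integral>\<omega>. (y j \<omega>)\<^sup>2 \<partial>P)"
      by (simp add: z_def power_mult_distrib)
    also have "\<dots> \<le> (L j powr (- 1 / 2))\<^sup>2 * (\<tau> * schatten_norm (q j) (V j))\<^sup>2"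
      using y(3)[OF j] by (intro mult_left_mono) auto
    finally show "(\<integral>\<omega>. (z j \<omega>)\<^sup>2 \<partial>P) \<le> (\<tau> * ?v j)\<^sup>2" by (simp add: power_mult_distrib mult_ac)
  qed
  let ?Z = "\<lambda>\<omega>. ell_norm \<beta> {# z j \<omega>. j \<in># mset_set {1..J} #}"
  have Z: "integrable P (\<lambda>\<omega>. (?Z \<omega>)\<^sup>2)"
    "(\<integral>\<omega>. (?Z \<omega>)\<^sup>2 \<partial>P) \<le> (ell_norm \<beta> {# \<tau> * ?v j. j \<in># mset_set {1..J} #})\<^sup>2"
    using ell_norm_second_moment_le[of "{1..J}" \<beta> "\<lambda>j. \<tau> * ?v j" z] exps(1,2) z \<tau>(1)
    by (auto simp: schatten_norm_nonneg)
  have le: "vq_norm J blk L q \<beta> (?N \<omega>) \<le> ?Z \<omega>" for \<omega>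
    unfolding vq_norm_def mixed_norm_def
  proof (rule ell_norm_mono)
    fix j assume j: "j \<in> {1..J}"
    have "schatten_norm (q j) (blk (?N \<omega>) j) \<le> y j \<omega>"
      unfolding y_def x_def using exps(3)[OF j]
      by (intro schatten_norm_le_row_norms[OF W(1)[OF j] block_space_blk(1)[OF space j]]) auto
    then show "\<bar>L j powr (- 1 / 2) * schatten_norm (q j) (blk (?N \<omega>) j)\<bar> \<le> \<bar>z j \<omega>\<bar>"
      using schatten_norm_nonneg[of "q j" "blk (?N \<omega>) j"]
      by (auto simp: z_def abs_mult intro!: mult_left_mono)
  qed (use exps in auto)
  have vq0: "0 \<le> vq_norm J blk L q \<beta> U" for U by (simp add: vq_norm_def mixed_norm_def ell_norm_nonneg)
  have sq: "(vq_norm J blk L q \<beta> (?N \<omega>))\<^sup>2 \<le> (?Z \<omega>)\<^sup>2" for \<omega>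
    using le vq0 by (intro power_mono)
  show int: "integrable P (\<lambda>\<omega>. (vq_norm J blk L q \<beta> (?N \<omega>))\<^sup>2)"
  proof (rule Bochner_Integration.integrable_bound[OF Z(1)])
    show "(\<lambda>\<omega>. (vq_norm J blk L q \<beta> (?N \<omega>))\<^sup>2) \<in> borel_measurable P"
      using measurable_compose[OF noise_average_meas meas] by simp
  qed (use sq in auto)
  have "(\<integral>\<omega>. (vq_norm J blk L q \<beta> (?N \<omega>))\<^sup>2 \<partial>P) \<le> (\<integral>\<omega>. (?Z \<omega>)\<^sup>2 \<partial>P)"
    using int Z(1) sq by (rule integral_mono)
  also have "\<dots> \<le> (\<tau> * ell_norm \<beta> {# ?v j. j \<in># mset_set {1..J} #})\<^sup>2"
    using Z(2) exps(1) \<tau>(1) by (simp add: ell_norm_scale)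
  also have "\<dots> = variance_factor \<theta> k * \<sigma>\<^sup>2"
    by (simp add: power_mult_distrib \<tau> \<sigma> power_divide)
  finally show "(\<integral>\<omega>. (vq_norm J blk L q \<beta> (?N \<omega>))\<^sup>2 \<partial>P) \<le> variance_factor \<theta> k * \<sigma>\<^sup>2" .
qed

lemma has_bochner_integral_distr_iff:
  fixes f :: "'s \<Rightarrow> 'b::{banach, second_countable_topology}"
  assumes "\<xi> \<in> measurable Q S" "f \<in> borel_measurable S"
  shows "has_bochner_integral (distr Q S \<xi>) f y \<longleftrightarrow> has_bochner_integral Q (\<lambda>\<omega>. f (\<xi> \<omega>)) y"
  using assms by (simp add: has_bochner_integral_iff integrable_distr_eq integral_distr)

section \<open>The convergence rate\<close>

theorem theorem4:
  fixes J :: nat and m n :: "nat \<Rightarrow> nat"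
    and blk :: "'x::euclidean_space \<Rightarrow> nat \<Rightarrow> real mat"
    and f :: "'x \<Rightarrow> real" and gradf :: "'x \<Rightarrow> 'x" and f_low :: real
    and L :: "nat \<Rightarrow> real" and \<alpha> \<beta> :: ereal and p q :: "nat \<Rightarrow> ereal"
    and Q :: "'r measure" and \<Xi> :: "'s measure" and \<xi> :: "'r \<Rightarrow> 's"
    and G :: "'x \<Rightarrow> 's \<Rightarrow> 'x" and V :: "nat \<Rightarrow> real mat"
    and P :: "'w measure" and \<zeta> :: "nat \<times> nat \<Rightarrow> 'w \<Rightarrow> 's"
    and B K :: nat and \<theta> \<eta> \<Delta> \<sigma> :: real
    and X0 :: 'x and X M :: "nat \<Rightarrow> 'w \<Rightarrow> 'x"
  assumes dims: "1 \<le> J" "\<And>j. j \<in> {1..J} \<Longrightarrow> 1 \<le> m j \<and> m j \<le> n j"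
    and space: "block_space J m n blk"
    and C1: "\<And>Y. GDERIV f Y :> gradf Y" "continuous_on UNIV gradf"
    and L_pos: "\<And>j. j \<in> {1..J} \<Longrightarrow> 0 < L j"
    and lower: "\<And>Y. f_low \<le> f Y"
    and exponents: "2 \<le> \<alpha>" "1 \<le> \<beta>" "\<beta> \<le> 2" "conjugate_exponents \<alpha> \<beta>"
    and block_exponents: "\<And>j. j \<in> {1..J} \<Longrightarrow>
        2 \<le> p j \<and> 1 \<le> q j \<and> q j \<le> 2 \<and> conjugate_exponents (p j) (q j)"
    and smooth: "\<And>Y Z. vq_norm J blk L q \<beta> (gradf Z - gradf Y) \<le> wp_norm J blk L p \<alpha> (Z - Y)"
    and prob: "prob_space Q" "\<xi> \<in> measurable Q \<Xi>" "prob_space P"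
    and G_measurable: "(\<lambda>(Y, s). G Y s) \<in> borel_measurable (borel \<Otimes>\<^sub>M \<Xi>)"
    and V_dims: "\<And>j. j \<in> {1..J} \<Longrightarrow> V j \<in> carrier_mat (m j) (m j)"
    and unbiased: "\<And>Y. has_bochner_integral Q (\<lambda>\<omega>. G Y (\<xi> \<omega>)) (gradf Y)"
    and variance: "\<And>Y j. j \<in> {1..J} \<Longrightarrow> \<exists>C.
        has_mat_expectation Q (m j) (m j)
          (\<lambda>\<omega>. (blk (G Y (\<xi> \<omega>)) j - blk (gradf Y) j) *
                transpose_mat (blk (G Y (\<xi> \<omega>)) j - blk (gradf Y) j)) C \<and>
        loewner_le (m j) C (V j * transpose_mat (V j))"
    and sizes: "1 \<le> B" "1 \<le> K"
    and Delta: "\<Delta> = f X0 - f_low"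
    and sigma: "\<sigma> = 1 / sqrt (real B) *
        ell_norm \<beta> {# L j powr (- 1 / 2) * schatten_norm (q j) (V j). j \<in># mset_set {1..J} #}"
    and theta: "\<theta> = (if \<sigma> = 0 then 1 else min (sqrt ((\<Delta> + \<sigma>\<^sup>2) / (\<sigma>\<^sup>2 * real K))) 1)"
    and eta: "\<eta> = \<theta> / 4"
    and samples: "iid_copies Q \<Xi> \<xi> P (UNIV \<times> {1..B}) \<zeta>"
    and iterates: "multi_block_method P \<Xi> (wp_norm J blk L p \<alpha>) G B \<theta> \<eta> X0 \<zeta> X M"
  shows "(\<forall>k<K. integrable P (\<lambda>\<omega>. (vq_norm J blk L q \<beta> (gradf (X k \<omega>)))\<^sup>2)) \<and>
    1 / real K * (\<Sum>k<K. integral\<^sup>L P (\<lambda>\<omega>. (vq_norm J blk L q \<beta> (gradf (X k \<omega>)))\<^sup>2))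
      \<le> 67 * (sqrt (\<sigma>\<^sup>2 * (\<Delta> + \<sigma>\<^sup>2) / real K) + (\<Delta> + \<sigma>\<^sup>2) / real K)"
proof -
  let ?D = "vq_norm J blk L q \<beta>" and ?N = "wp_norm J blk L p \<alpha>"
  interpret norms: dual_norm_pair ?N ?D
    by (rule block_space_dual_norm_pair[OF space L_pos exponents(1,3,4)]) (use block_exponents in auto)
  have D_meas: "?D \<in> borel_measurable borel"
    by (rule borel_measurable_continuous_onI[OF norms.continuous_on_D])
  have g_meas: "gradf \<in> borel_measurable borel"
    by (rule borel_measurable_continuous_onI[OF C1(2)])
  define \<mu> where "\<mu> = distr Q \<Xi> \<xi>"
  have GY_meas: "G Y \<in> borel_measurable \<Xi>" for Y
    using measurable_compose[OF measurable_Pair1' G_measurable, of Y] by simp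
  interpret P: prob_space P by (rule prob(3))
  interpret adaptive_sampling P \<Xi> \<zeta> B \<mu> G gradf X0 X
  proof
    show "P.indep_vars (\<lambda>_. \<Xi>) \<zeta> (UNIV \<times> {1..B})" "\<And>t. t \<in> UNIV \<times> {1..B} \<Longrightarrow> distr P \<Xi> (\<zeta> t) = \<mu>"
      using samples by (auto simp: iid_copies_def \<mu>_def)
    show "(\<lambda>(Y, s). G Y s) \<in> borel_measurable (borel \<Otimes>\<^sub>M \<Xi>)" "gradf \<in> borel_measurable borel" "1 \<le> B"
      by fact+
    show "\<And>\<omega>. \<omega> \<in> space P \<Longrightarrow> X 0 \<omega> = X0" "\<And>k. X (Suc k) \<in> borel_measurable (sample_history P \<Xi> B \<zeta> k)"
      using iterates by (auto simp: multi_block_method_def)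
    show "has_bochner_integral \<mu> (G Y) (gradf Y)" for Y
      using unbiased[of Y] by (simp add: \<mu>_def has_bochner_integral_distr_iff[OF prob(2) GY_meas])
  qed
  \<comment> \<open>The hypothesis speaks of the measure \<open>Q\<close>, the noise estimate of the
    law \<open>\<mu>\<close>. The transfer needs measurability of the matrix entries, which are
    quadratic polynomials in the entries of the block difference.\<close>
  have variance': "\<exists>C. has_mat_expectation \<mu> (m j) (m j)
        (\<lambda>z. (blk (G Y z) j - blk (gradf Y) j) * transpose_mat (blk (G Y z) j - blk (gradf Y) j)) C \<and>
      loewner_le (m j) C (V j * transpose_mat (V j))" if j: "j \<in> {1..J}" for Y j
  proof -
    let ?E = "\<lambda>z. blk (G Y z) j - blk (gradf Y) j"
    obtain C where C: "has_mat_expectation Q (m j) (m j) (\<lambda>\<omega>. ?E (\<xi> \<omega>) * transpose_mat (?E (\<xi> \<omega>))) C"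
      "loewner_le (m j) C (V j * transpose_mat (V j))"
      using variance[OF j] by blast
    have "(\<lambda>z. (?E z * transpose_mat (?E z)) $$ (i, l)) \<in> borel_measurable \<Xi>" if il: "i < m j" "l < m j" for i l
    proof -
      have E: "?E z = blk (G Y z - gradf Y) j" for z by (simp add: block_space_blk(4)[OF space j])
      have "(\<lambda>z. blk (G Y z - gradf Y) j $$ (i, c)) \<in> borel_measurable \<Xi>" if "i < m j" "c < n j" for i c
      proof -
        have "(\<lambda>z. G Y z - gradf Y) \<in> borel_measurable \<Xi>"
          by (rule borel_measurable_diff[OF GY_meas borel_measurable_const])
        moreover have "(\<lambda>U. blk U j $$ (i, c)) \<in> borel_measurable borel"
          by (rule borel_measurable_continuous_onI[OF linear_continuous_on[OF block_space_index_linear[OF space j that]]])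
        ultimately show ?thesis by (rule measurable_compose)
      qed
      then show ?thesis
        unfolding E mult_transpose_index[OF block_space_blk(1)[OF space j] block_space_blk(1)[OF space j] il]
        using il by (intro borel_measurable_sum borel_measurable_times) auto
    qed
    then have "has_mat_expectation \<mu> (m j) (m j) (\<lambda>z. ?E z * transpose_mat (?E z)) C"
      using C(1) unfolding has_mat_expectation_def \<mu>_def by (simp add: has_bochner_integral_distr_iff[OF prob(2)])
    then show ?thesis using C(2) by blast
  qed
  have q12: "\<And>j. j \<in> {1..J} \<Longrightarrow> 1 \<le> q j \<and> q j \<le> 2" using block_exponents by blast
  note noise = vq_norm_noise_average[OF space exponents(2,3) q12 V_dims variance' D_meas sigma]
  have \<sigma>0: "0 \<le> \<sigma>" by (simp add: sigma ell_norm_nonneg)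
  have \<Delta>0: "0 \<le> \<Delta>" using lower by (simp add: Delta)
  have K0: "0 < real K" using sizes by simp
  have \<theta>01: "0 < \<theta>" "\<theta> \<le> 1"
  proof -
    have "0 < sqrt ((\<Delta> + \<sigma>\<^sup>2) / (\<sigma>\<^sup>2 * real K))" if "\<sigma> \<noteq> 0"
      using that \<Delta>0 K0 by (simp add: add_nonneg_pos)
    then show "0 < \<theta>" "\<theta> \<le> 1" by (auto simp: theta)
  qed
  let ?S = "\<lambda>k \<omega>. (?D (noise_average \<theta> k \<omega>))\<^sup>2"
  let ?R = "\<lambda>\<omega>. 34 * \<Delta> / \<theta> + 23 / 2 * (\<Sum>k<K. ?S k \<omega>)"
  have path: "(\<Sum>k<K. (?D (gradf (X k \<omega>)))\<^sup>2) \<le> ?R \<omega>" if \<omega>: "\<omega> \<in> space P" for \<omega>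
  proof -
    have X0: "X 0 \<omega> = X0" using iterates \<omega> by (simp add: multi_block_method_def)
    have "(\<Sum>k<K. (?D (gradf (X k \<omega>)))\<^sup>2) \<le> 34 * (f (X 0 \<omega>) - f_low) / \<theta> + 23 / 2 * (\<Sum>k<K. ?S k \<omega>)"
    proof (rule norms.momentum_path_bound[where M = "\<lambda>k. M k \<omega>" and G = "\<lambda>k. batch_gradient G B \<zeta> X k \<omega>" and \<eta> = \<eta>])
      show "M 0 \<omega> = batch_gradient G B \<zeta> X 0 \<omega>"
        "\<And>k. M (Suc k) \<omega> = (1 - \<theta>) *\<^sub>R M k \<omega> + \<theta> *\<^sub>R batch_gradient G B \<zeta> X (Suc k) \<omega>"
        using iterates \<omega> by (auto simp: multi_block_method_def)
      show "inner (M k \<omega>) (X (Suc k) \<omega> - X k \<omega>) + 1 / (2 * \<eta>) * (?N (X (Suc k) \<omega> - X k \<omega>))\<^sup>2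
          \<le> inner (M k \<omega>) (Y - X k \<omega>) + 1 / (2 * \<eta>) * (?N (Y - X k \<omega>))\<^sup>2" for k Y
        using iterates \<omega> by (simp add: multi_block_method_def is_arg_min_linorder)
    qed (use C1(1) smooth lower \<theta>01 eta in auto)
    then show ?thesis by (simp add: X0 Delta)
  qed
  \<comment> \<open>\<open>?R\<close> is random only through the noise averages; as a pathwise
    majorant it makes the squared gradient norms integrable.\<close>
  have R_int: "integrable P ?R" using noise(1) by auto
  have grad_meas: "(\<lambda>\<omega>. (?D (gradf (X k \<omega>)))\<^sup>2) \<in> borel_measurable P" for k
    using measurable_compose[OF measurable_compose[OF X_meas g_meas] D_meas] by simp
  have grad_int: "integrable P (\<lambda>\<omega>. (?D (gradf (X k \<omega>)))\<^sup>2)" if "k < K" for k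
  proof (rule Bochner_Integration.integrable_bound[OF R_int grad_meas AE_I2])
    fix \<omega> assume "\<omega> \<in> space P"
    have "(?D (gradf (X k \<omega>)))\<^sup>2 \<le> (\<Sum>k<K. (?D (gradf (X k \<omega>)))\<^sup>2)"
      using that by (intro member_le_sum) auto
    also have "\<dots> \<le> ?R \<omega>" by (rule path) fact
    finally show "norm ((?D (gradf (X k \<omega>)))\<^sup>2) \<le> norm (?R \<omega>)" by simp
  qed
  have "(\<Sum>k<K. \<integral>\<omega>. (?D (gradf (X k \<omega>)))\<^sup>2 \<partial>P) = (\<integral>\<omega>. (\<Sum>k<K. (?D (gradf (X k \<omega>)))\<^sup>2) \<partial>P)"
    using grad_int by (subst Bochner_Integration.integral_sum) auto
  also have "\<dots> \<le> (\<integral>\<omega>. ?R \<omega> \<partial>P)"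
    using grad_int by (intro integral_mono R_int path Bochner_Integration.integrable_sum) auto
  also have "\<dots> = 34 * \<Delta> / \<theta> + 23 / 2 * (\<Sum>k<K. \<integral>\<omega>. ?S k \<omega> \<partial>P)"
    using noise(1) by (simp add: P.prob_space)
  also have "\<dots> \<le> 34 * \<Delta> / \<theta> + 23 / 2 * ((\<Sum>k<K. variance_factor \<theta> k) * \<sigma>\<^sup>2)"
    unfolding sum_distrib_right by (intro add_left_mono mult_left_mono sum_mono noise(2)) simp_all
  also have "\<dots> \<le> 34 * \<Delta> / \<theta> + 23 / 2 * ((1 / \<theta> + \<theta> * real K) * \<sigma>\<^sup>2)"
    using variance_factor_sum_le[OF \<theta>01] by (intro add_left_mono mult_left_mono mult_right_mono) auto
  finally have total: "(\<Sum>k<K. \<integral>\<omega>. (?D (gradf (X k \<omega>)))\<^sup>2 \<partial>P)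
      \<le> 34 * \<Delta> / \<theta> + 23 / 2 * ((1 / \<theta> + \<theta> * real K) * \<sigma>\<^sup>2)" .
  define E where "E = \<Delta> + \<sigma>\<^sup>2"
  define u where "u = sqrt (\<sigma>\<^sup>2 * E / real K)"
  have E0: "0 \<le> E" using \<Delta>0 by (simp add: E_def)
  have u0: "0 \<le> u" using E0 by (simp add: u_def)
  \<comment> \<open>\<theta> balances these two quantities: for nonzero \<sigma> it never exceeds
    the unclipped value, at which \<open>\<theta> * \<sigma>\<^sup>2 = u\<close> and
    \<open>\<theta> * u = E / real K\<close>. If \<open>\<theta> = 1\<close>, the first quotient is
    \<open>E / real K\<close> itself.\<close>
  have rate: "E / (\<theta> * real K) \<le> u + E / real K" "\<theta> * \<sigma>\<^sup>2 \<le> u"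
  proof -
    show "\<theta> * \<sigma>\<^sup>2 \<le> u"
    proof (cases "\<sigma> = 0")
      case True
      then show ?thesis using u0 by simp
    next
      case False
      then have "\<theta> \<le> sqrt (E / (\<sigma>\<^sup>2 * real K))" by (simp add: theta E_def)
      then have "\<theta> * \<sigma>\<^sup>2 \<le> sqrt (E / (\<sigma>\<^sup>2 * real K)) * \<sigma>\<^sup>2" by (rule mult_right_mono) simp
      also have "\<dots> = u" using False \<sigma>0 by (simp add: u_def real_sqrt_mult real_sqrt_divide power2_eq_square)
      finally show ?thesis .
    qed
    show "E / (\<theta> * real K) \<le> u + E / real K"
    proof (cases "\<theta> = 1")
      case True
      then show ?thesis using u0 by simp
    next
      case False
      then have s: "\<sigma> \<noteq> 0" and t: "\<theta> = sqrt (E / (\<sigma>\<^sup>2 * real K))"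
        by (auto simp: theta E_def min_def split: if_splits)
      have Epos: "0 < E" using s \<Delta>0 by (simp add: E_def add_nonneg_pos)
      have "\<theta> * u = E / real K"
      proof -
        have "\<theta> * u = sqrt ((E / real K) * (E / real K))"
          unfolding t u_def real_sqrt_mult[symmetric] using s by (simp add: power2_eq_square)
        also have "\<dots> = \<bar>E / real K\<bar>" by (rule real_sqrt_abs2)
        finally show ?thesis using Epos by simp
      qed
      moreover have "E / (\<theta> * real K) = (E / real K) / \<theta>" by simp
      ultimately have "E / (\<theta> * real K) = u" using \<theta>01 by (metis less_irrefl nonzero_mult_div_cancel_left)
      then show ?thesis using Epos K0 by simp
    qed
  qed
  have "1 / real K * (\<Sum>k<K. \<integral>\<omega>. (?D (gradf (X k \<omega>)))\<^sup>2 \<partial>P)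
      \<le> 1 / real K * (34 * \<Delta> / \<theta> + 23 / 2 * ((1 / \<theta> + \<theta> * real K) * \<sigma>\<^sup>2))"
    using total by (rule mult_left_mono) simp
  also have "\<dots> \<le> 34 * (E / (\<theta> * real K)) + 23 / 2 * (\<theta> * \<sigma>\<^sup>2)"
  proof -
    \<comment> \<open>\<open>34 * \<Delta>\<close> is completed to \<open>34 * E\<close>. Since 23/2
      of the added \<sigma>^2 terms were present already, the surplus is 34 - 23/2 = 45/2 and is
      dropped.\<close>
    have "1 / real K * (34 * \<Delta> / \<theta> + 23 / 2 * ((1 / \<theta> + \<theta> * real K) * \<sigma>\<^sup>2)) =
        34 * (E / (\<theta> * real K)) + 23 / 2 * (\<theta> * \<sigma>\<^sup>2) - 45 / 2 * (\<sigma>\<^sup>2 / (\<theta> * real K))"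
      using K0 \<theta>01 by (simp add: E_def field_simps)
    then show ?thesis using K0 \<theta>01 by simp
  qed
  also have "\<dots> \<le> 34 * (u + E / real K) + 23 / 2 * u"
    using rate by (intro add_mono mult_left_mono) auto
  also have "\<dots> \<le> 67 * (u + E / real K)"
  proof -
    have "34 * (u + e) + 23 / 2 * u \<le> 67 * (u + e)" if "0 \<le> e" for e
      using u0 that by (simp add: field_simps)
    then show ?thesis using divide_nonneg_pos[OF E0 K0] .
  qed
  finally show ?thesis using grad_int by (simp add: u_def E_def)
qed

end
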